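(* Let $T>0$, $I=(0,1)$, $I_T=I\times(0,T)$, $\kappa^0\in\mathrm{Lip}(I)$, $\rho^0\in C_0^\infty(I)$ with $\kappa^0_x\ge|\rho^0_x|$ a.e. in $I$, and let $\rho$ be the solution of $\rho_t=\rho_{xx}$ in $I\times(0,\infty)$, $\rho(\cdot,0)=\rho^0$, $\rho(0,t)=\rho(1,t)=0$. Then there exists a viscosity solution $\kappa\in\mathrm{Lip}(\overline{I}_T)$ of $$\kappa_t\kappa_x=\rho_t\rho_x\ \text{in }I_T,\quad\kappa(x,0)=\kappa^0(x)\ \text{in }I,\quad\kappa(0,t)=\kappa^0(0),\ \kappa(1,t)=\kappa^0(1)\ \ \forall t\in[0,T],$$ satisfying $\kappa_x\ge|\rho_x|$ a.e. in $\overline{I}_T$.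
   Context: A viscosity solution of this Dirichlet problem is a function $\kappa\in C(\overline{I}_T)$ which is a (Crandall–Lions) viscosity solution in $I_T$ of $F((x,t),\nabla\kappa)=0$ with $F((x,t),(p_1,p_2))=p_1p_2-\rho_t(x,t)\rho_x(x,t)$, attains the initial datum at $t=0$ and the prescribed boundary values at $x=0,1$. *)

theory Defs
  imports "HOL-Analysis.Analysis"
begin

definition smooth_real :: "(real \<Rightarrow> real) \<Rightarrow> bool" where
  "smooth_real f \<longleftrightarrow> (\<forall>n x. ((deriv ^^ n) f) differentiable (at x))"

definition C0_infty_I :: "(real \<Rightarrow> real) \<Rightarrow> bool" where
  "C0_infty_I f \<longleftrightarrow> smooth_real f \<and> compact (closure {x. f x \<noteq> 0})
     \<and> closure {x. f x \<noteq> 0} \<subseteq> {0<..<1}"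

definition pdx :: "(real \<times> real \<Rightarrow> real) \<Rightarrow> real \<times> real \<Rightarrow> real" where
  "pdx f z = deriv (\<lambda>y. f (y, snd z)) (fst z)"

definition pdt :: "(real \<times> real \<Rightarrow> real) \<Rightarrow> real \<times> real \<Rightarrow> real" where
  "pdt f z = deriv (\<lambda>s. f (fst z, s)) (snd z)"

text \<open>Classical solution of rho_t = rho_xx in (0,1) x (0,oo), continuous up to the
  boundary, with initial datum rho0 and homogeneous Dirichlet boundary values.
  (Such a solution is unique by the maximum principle.)\<close>
definition heat_solution :: "(real \<Rightarrow> real) \<Rightarrow> (real \<times> real \<Rightarrow> real) \<Rightarrow> bool" where
  "heat_solution rho0 rho \<longleftrightarrow>
     continuous_on ({0..1} \<times> {0..}) rho
   \<and> (\<forall>x\<in>{0<..<1}. \<forall>t>0.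
        (\<lambda>y. rho (y, t)) differentiable (at x)
      \<and> (\<lambda>s. rho (x, s)) differentiable (at t)
      \<and> ((\<lambda>y. pdx rho (y, t)) has_real_derivative pdt rho (x, t)) (at x))
   \<and> (\<forall>x\<in>{0..1}. rho (x, 0) = rho0 x)
   \<and> (\<forall>t\<ge>0. rho (0, t) = 0 \<and> rho (1, t) = 0)"

definition C1_test :: "(real \<times> real) set \<Rightarrow> (real \<times> real \<Rightarrow> real)
     \<Rightarrow> (real \<times> real \<Rightarrow> real \<times> real \<Rightarrow> real) \<Rightarrow> bool" where
  "C1_test S \<phi> \<phi>' \<longleftrightarrow> (\<forall>z\<in>S. (\<phi> has_derivative \<phi>' z) (at z))
     \<and> continuous_on S (\<lambda>z. \<phi>' z (1, 0)) \<and> continuous_on S (\<lambda>z. \<phi>' z (0, 1))"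

text \<open>Crandall--Lions viscosity sub/super/solution in an open set S of
  F(z, Du) = 0, with F z p1 p2 for gradient (p1, p2) = (u_x, u_t).\<close>
definition visc_subsolution :: "(real \<times> real) set \<Rightarrow> (real \<times> real \<Rightarrow> real \<Rightarrow> real \<Rightarrow> real)
     \<Rightarrow> (real \<times> real \<Rightarrow> real) \<Rightarrow> bool" where
  "visc_subsolution S F u \<longleftrightarrow> continuous_on S u \<and>
     (\<forall>\<phi> \<phi>'. C1_test S \<phi> \<phi>' \<longrightarrow> (\<forall>z0\<in>S.
        (\<exists>e>0. \<forall>z\<in>S \<inter> ball z0 e. u z - \<phi> z \<le> u z0 - \<phi> z0)
        \<longrightarrow> F z0 (\<phi>' z0 (1, 0)) (\<phi>' z0 (0, 1)) \<le> 0))"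

definition visc_supersolution :: "(real \<times> real) set \<Rightarrow> (real \<times> real \<Rightarrow> real \<Rightarrow> real \<Rightarrow> real)
     \<Rightarrow> (real \<times> real \<Rightarrow> real) \<Rightarrow> bool" where
  "visc_supersolution S F u \<longleftrightarrow> continuous_on S u \<and>
     (\<forall>\<phi> \<phi>'. C1_test S \<phi> \<phi>' \<longrightarrow> (\<forall>z0\<in>S.
        (\<exists>e>0. \<forall>z\<in>S \<inter> ball z0 e. u z - \<phi> z \<ge> u z0 - \<phi> z0)
        \<longrightarrow> F z0 (\<phi>' z0 (1, 0)) (\<phi>' z0 (0, 1)) \<ge> 0))"

definition visc_solution :: "(real \<times> real) set \<Rightarrow> (real \<times> real \<Rightarrow> real \<Rightarrow> real \<Rightarrow> real)
     \<Rightarrow> (real \<times> real \<Rightarrow> real) \<Rightarrow> bool" where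
  "visc_solution S F u \<longleftrightarrow> visc_subsolution S F u \<and> visc_supersolution S F u"

end

theory Submission
  imports Defs "HOL-Complex_Analysis.Great_Picard"
begin

text \<open>
  By the maximum principle \<open>rho\<close> is its Fourier sine series, hence smooth up to the boundary; it
  extends to the line as an odd function of period 2, and \<open>kappa0\<close> extends by point reflections of its
  graph, so that the lateral boundary disappears.  With \<open>G = rho\<^sub>t rho\<^sub>x = rho\<^sub>x rho\<^sub>x\<^sub>x\<close> the equation is
  \<open>kappa\<^sub>t = G / kappa\<^sub>x\<close>, and \<open>u = kappa\<^sub>x\<close> solves the conservation law \<open>u\<^sub>t = (G / u)\<^sub>x\<close>.  For \<open>g > 0\<close> the
  function \<open>W = sqrt (g\<^sup>2 (1 + T - t) + rho\<^sub>x\<^sup>2)\<close> is a strict subsolution of it, because \<open>G / W = W\<^sub>x\<close>.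
  If the datum is steepened by \<open>g (2 + T) x\<close>, the Lax-Friedrichs scheme therefore keeps \<open>u \<ge> W\<close>, where
  it is monotone; moreover \<open>u\<close> stays below a bound independent of \<open>g\<close>, and \<open>\<bar>G / u\<bar> \<le> \<bar>rho\<^sub>x\<^sub>x\<bar>\<close>.
  Arzela-Ascoli yields a limit of the scheme for vanishing mesh, which is a viscosity solution because
  the scheme is monotone and consistent, with Lipschitz bounds that do not depend on \<open>g\<close>; then \<open>g\<close> is
  sent to 0.  The lower bound survives as monotonicity of \<open>kappa \<plusminus> rho\<close> in \<open>x\<close>, and monotone Lipschitz
  functions are differentiable almost everywhere.
\<close>

section \<open>Monotonicity from one-sided slopes\<close>

text \<open>The quotient \<open>G / kappa_x\<close> and the monotonicity of the scheme both call for
  slopes bounded away from 0, while the target inequality lets \<open>kappa_x\<close> vanish. Hence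
  the steepening by \<open>g\<close>, and the limit g = 0 is taken in the product form of the
  equation, which is stable without a lower bound on the slope. The characteristic speed of the
  conservation law is |G| / u^2, at most A / g^2, so the mesh obeys 2 A tau = g^2 h; the factor 2
  leaves room for test functions whose difference quotients are only known to reach g / 2. Estimates
  come in two kinds. Crude ones blow up as g tends to 0; they serve compactness at fixed
  \<open>g\<close> or carry a factor that vanishes with the mesh. Sharp ones hold over increments of
  2 h, or up to numerical diffusion, and become Lipschitz bounds only in the mesh limit. In time a
  single step may move by order \<open>h\<close>, a speed of order 1 / g^2; a parabolic barrier
  shows that this part is diffusion and disappears. Measure theory enters because the slope
  inequality is given and wanted almost everywhere, whereas the scheme handles increments.\<close>

lemma right_increase_imp_le:
  fixes H :: "real \<Rightarrow> real"
  assumes "a \<le> b" and cont: "continuous_on {a..b} H"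
    and step: "\<And>x. x \<in> {a..<b} \<Longrightarrow> \<exists>y\<in>{x<..b}. H x \<le> H y"
  shows "H a \<le> H b"
proof -
  define S where "S = {x\<in>{a..b}. H a \<le> H x}"
  have "closed ({a..b} \<inter> H -` {H a..})"
    by (rule continuous_closed_preimage[OF cont]) auto
  then have "closed S" by (simp add: S_def vimage_def Int_def)
  moreover have S: "a \<in> S" "bdd_above S" using \<open>a \<le> b\<close> by (auto simp: S_def bdd_above_def)
  \<comment> \<open>This is the last point at which \<open>H\<close> is at least \<open>H a\<close>;
    \<open>step\<close> would move it further right unless it is \<open>b\<close>.\<close>
  ultimately have m: "Sup S \<in> S" using closed_contains_Sup by blast
  have "Sup S = b"
  proof (rule ccontr)
    assume "Sup S \<noteq> b"
    with m obtain y where "y \<in> {Sup S<..b}" "H (Sup S) \<le> H y" using step[of "Sup S"] by (force simp: S_def)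
    with m have "y \<in> S" by (auto simp: S_def)
    with S(2) \<open>y \<in> {Sup S<..b}\<close> show False using cSup_upper by fastforce
  qed
  with m show ?thesis by (simp add: S_def)
qed

lemma left_increase_imp_le:
  fixes H :: "real \<Rightarrow> real"
  assumes "a \<le> b" and cont: "continuous_on {a..b} H"
    and step: "\<And>x. x \<in> {a<..b} \<Longrightarrow> \<exists>y\<in>{a..<x}. H y \<le> H x"
  shows "H a \<le> H b"
proof -
  have "- H (- (- b)) \<le> - H (- (- a))"
  proof (rule right_increase_imp_le[of "-b" "-a" "\<lambda>x. - H (- x)"])
    show "continuous_on {- b..- a} (\<lambda>x. - H (- x))"
      by (intro continuous_intros continuous_on_compose2[OF cont]) auto
    show "\<exists>y\<in>{x<..- a}. - H (- x) \<le> - H (- y)" if x: "x \<in> {- b..<- a}" for x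
    proof -
      from x have "-x \<in> {a<..b}" by auto
      from step[OF this] obtain y where "y \<in> {a..<-x}" "H y \<le> H (-x)" by auto
      then show ?thesis by (intro bexI[of _ "-y"]) auto
    qed
  qed (use assms in auto)
  then show ?thesis by simp
qed

text \<open>The measure of an open superset of the good set, plus \<open>L\<close> times that of an open superset
  of the rest, grows at least as fast as \<open>F\<close> at every point, on one side.\<close>
lemma increment_le_of_one_sided_slopes:
  fixes F :: "real \<Rightarrow> real"
  assumes "a \<le> b" and lip: "L-lipschitz_on {a..b} F" and E: "E \<in> sets lebesgue" and "0 \<le> p"
    and slopes: "(\<forall>x\<in>E \<inter> {a..<b}. \<forall>d>0. \<exists>y\<in>{x<..b}. y < x + d \<and> F y - F x \<le> p * (y - x)) \<or>
      (\<forall>x\<in>E \<inter> {a<..b}. \<forall>d>0. \<exists>y\<in>{a..<x}. x - d < y \<and> F x - F y \<le> p * (x - y))"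
  shows "F b - F a \<le> p * measure lebesgue (E \<inter> {a..b}) + L * measure lebesgue ({a..b} - E)"
proof (rule field_le_epsilon)
  fix e :: real assume "e > 0"
  have "0 \<le> L" using lip lipschitz_on_nonneg by blast
  have mI: "{a..b} \<in> lmeasurable" by simp
  have outer: "\<exists>U. open U \<and> X \<subseteq> U \<and> measure lebesgue (U \<inter> {a..b}) \<le> measure lebesgue X + d"
    if X: "X \<in> sets lebesgue" "X \<subseteq> {a..b}" and "d > 0" for X d
  proof -
    obtain U where U: "open U" "X \<subseteq> U" "U - X \<in> lmeasurable" "emeasure lebesgue (U - X) < ennreal d"
      using sets_lebesgue_outer_open[OF X(1) \<open>d > 0\<close>] by blast
    have Xm: "X \<in> lmeasurable" using X mI by (meson fmeasurableI2)
    have "measure lebesgue (U \<inter> {a..b}) \<le> measure lebesgue (X \<union> (U - X))"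
      by (rule measure_mono_fmeasurable) (use U Xm in \<open>auto intro: fmeasurable.Un simp del: Un_Diff_cancel\<close>)
    also have "\<dots> \<le> measure lebesgue X + measure lebesgue (U - X)"
      by (rule measure_Un_le) (use U Xm in auto)
    also have "measure lebesgue (U - X) \<le> d"
      using U(4) U(3) \<open>d > 0\<close> by (simp add: emeasure_eq_measure2 ennreal_less_iff)
    finally show ?thesis using U by auto
  qed
  \<comment> \<open>The excess \<open>d\<close> of the two open covers is weighted by p + L in the
    end, which must stay below \<open>e\<close>; the 1 keeps the denominator positive.\<close>
  define d where "d = e / (2 * (p + L + 1))"
  have "d > 0" using \<open>e > 0\<close> \<open>0 \<le> p\<close> \<open>0 \<le> L\<close> by (simp add: d_def)
  obtain U where U: "open U" "E \<inter> {a..b} \<subseteq> U"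
     "measure lebesgue (U \<inter> {a..b}) \<le> measure lebesgue (E \<inter> {a..b}) + d"
    using outer[OF sets.Int[OF E fmeasurableD[OF mI]] inf_le2 \<open>d > 0\<close>] by blast
  obtain V where V: "open V" "{a..b} - E \<subseteq> V"
     "measure lebesgue (V \<inter> {a..b}) \<le> measure lebesgue ({a..b} - E) + d"
    using outer[OF sets.Diff[OF fmeasurableD[OF mI] E] Diff_subset \<open>d > 0\<close>] by blast
  define m where "m = (\<lambda>W x. measure lebesgue (W \<inter> {a..x}))"
  have m_diff: "m W y = m W x + measure lebesgue (W \<inter> {x<..y})"
    if "open W" "a \<le> x" "x \<le> y" for W x y
  proof -
    have "W \<inter> {a..y} = (W \<inter> {a..x}) \<union> (W \<inter> {x<..y})" using that by auto
    moreover have "W \<inter> {a..x} \<in> lmeasurable" "W \<inter> {x<..y} \<in> lmeasurable"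
      using \<open>open W\<close> by (auto intro!: bounded_set_imp_lmeasurable bounded_Int)
    moreover have "(W \<inter> {x<..y}) - (W \<inter> {a..x}) = W \<inter> {x<..y}" by auto
    ultimately show ?thesis unfolding m_def by (simp add: measure_Un2 del: measure_completion)
  qed
  have small: "0 \<le> measure lebesgue (W \<inter> {x<..y}) \<and> measure lebesgue (W \<inter> {x<..y}) \<le> y - x"
    if "open W" "x \<le> y" for W x y
    using measure_mono_fmeasurable[of "W \<inter> {x<..y}" "{x<..y}" lebesgue]
      bounded_set_imp_lmeasurable[of "{x<..y}"] that by auto
  have full: "measure lebesgue (W \<inter> {x<..y}) = y - x" if "{x<..y} \<subseteq> W" "x \<le> y" for W and x y :: real
    using that by (simp add: Int_absorb1)
  have m_lip: "1-lipschitz_on {a..b} (m W)" if "open W" for W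
  proof (rule lipschitz_on_leI)
    show "dist (m W x) (m W y) \<le> 1 * dist x y" if "x \<in> {a..b}" "y \<in> {a..b}" "x \<le> y" for x y
      using m_diff[OF \<open>open W\<close>, of x y] small[OF \<open>open W\<close>, of x y] that by (auto simp: dist_real_def)
  qed auto
  \<comment> \<open>Inside \<open>U\<close> the first term pays for a slope of at most
    \<open>p\<close>, inside \<open>V\<close> the second pays for the Lipschitz constant. Where the
    covers overlap, the additional term is nondecreasing and does no harm.\<close>
  define H where "H = (\<lambda>x. p * m U x + L * m V x - F x)"
  have cont: "continuous_on {a..b} H"
    unfolding H_def by (intro continuous_intros lipschitz_on_continuous_on[OF m_lip] lipschitz_on_continuous_on[OF lip] U V)
  have grow: "H u \<le> H v"
    if uv: "a \<le> u" "u < v" "v \<le> b"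
      and good: "{u<..v} \<subseteq> U \<and> F v - F u \<le> p * (v - u) \<or> {u<..v} \<subseteq> V" for u v
    using good
  proof
    assume *: "{u<..v} \<subseteq> U \<and> F v - F u \<le> p * (v - u)"
    have "m U v = m U u + (v - u)" "m V u \<le> m V v"
      using * uv m_diff[OF U(1), of u v] full[of u v U] m_diff[OF V(1), of u v] small[OF V(1), of u v] by auto
    then have "p * m U v = p * m U u + p * (v - u)" "L * m V u \<le> L * m V v"
      using \<open>0 \<le> L\<close> by (simp_all add: mult_left_mono flip: distrib_left)
    with * show ?thesis by (simp add: H_def)
  next
    assume *: "{u<..v} \<subseteq> V"
    have "m V v = m V u + (v - u)" "m U u \<le> m U v"
      using * uv m_diff[OF V(1), of u v] full[of u v V] m_diff[OF U(1), of u v] small[OF U(1), of u v] by auto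
    then have "L * m V v = L * m V u + L * (v - u)" "p * m U u \<le> p * m U v"
      using \<open>0 \<le> p\<close> by (simp_all add: mult_left_mono flip: distrib_left)
    moreover have "F v - F u \<le> L * (v - u)"
      using lipschitz_onD[OF lip, of v u] uv by (auto simp: dist_real_def)
    ultimately show ?thesis by (simp add: H_def)
  qed
  have nbhd: "\<exists>d>0. ball x d \<subseteq> (if x \<in> E then U else V)" if "x \<in> {a..b}" for x
    using that U(1,2) V(1,2) open_contains_ball_eq[of "if x \<in> E then U else V"] by (auto split: if_splits)
  have "H a \<le> H b"
    using slopes
  proof
    assume *: "\<forall>x\<in>E \<inter> {a..<b}. \<forall>d>0. \<exists>y\<in>{x<..b}. y < x + d \<and> F y - F x \<le> p * (y - x)"
    show ?thesis
    proof (rule right_increase_imp_le[OF \<open>a \<le> b\<close> cont])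
      fix x assume x: "x \<in> {a..<b}"
      then obtain d where d: "d > 0" "ball x d \<subseteq> (if x \<in> E then U else V)" using nbhd[of x] by auto
      obtain y where y: "y \<in> {x<..b}" "y < x + d" "x \<in> E \<Longrightarrow> F y - F x \<le> p * (y - x)"
      proof (cases "x \<in> E")
        \<comment> \<open>Off \<open>E\<close> the Lipschitz constant is already paid for by
          \<open>V\<close>, so any sufficiently close \<open>y\<close> serves.\<close>
        case False
        then show ?thesis using that[of "min b (x + d/2)"] d(1) x by auto
      qed (use * x d(1) that in blast)
      have "{x<..y} \<subseteq> ball x d" using y(1,2) by (auto simp: dist_real_def)
      then have "H x \<le> H y" using x y d(2) by (intro grow) (auto split: if_splits)
      with y(1) show "\<exists>y\<in>{x<..b}. H x \<le> H y" by blast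
    qed
  next
    assume *: "\<forall>x\<in>E \<inter> {a<..b}. \<forall>d>0. \<exists>y\<in>{a..<x}. x - d < y \<and> F x - F y \<le> p * (x - y)"
    show ?thesis
    proof (rule left_increase_imp_le[OF \<open>a \<le> b\<close> cont])
      fix x assume x: "x \<in> {a<..b}"
      then obtain d where d: "d > 0" "ball x d \<subseteq> (if x \<in> E then U else V)" using nbhd[of x] by auto
      obtain y where y: "y \<in> {a..<x}" "x - d < y" "x \<in> E \<Longrightarrow> F x - F y \<le> p * (x - y)"
      proof (cases "x \<in> E")
        case False
        then show ?thesis using that[of "max a (x - d/2)"] d(1) x by auto
      qed (use * x d(1) that in blast)
      have "{y<..x} \<subseteq> ball x d" using y(1,2) by (auto simp: dist_real_def)
      then have "H y \<le> H x" using x y d(2) by (intro grow) (auto split: if_splits)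
      with y(1) show "\<exists>y\<in>{a..<x}. H y \<le> H x" by blast
    qed
  qed
  moreover have "m U a = 0" "m V a = 0" 
    by (cases "a \<in> U"; cases "a \<in> V"; simp add: m_def)+
  ultimately have "F b - F a \<le> p * m U b + L * m V b" by (simp add: H_def)
  also have "\<dots> \<le> p * (measure lebesgue (E \<inter> {a..b}) + d) + L * (measure lebesgue ({a..b} - E) + d)"
    using U(3) V(3) \<open>0 \<le> p\<close> \<open>0 \<le> L\<close> by (auto simp: m_def intro!: add_mono mult_left_mono)
  also have "\<dots> \<le> p * measure lebesgue (E \<inter> {a..b}) + L * measure lebesgue ({a..b} - E) + e"
  proof -
    have "(p + L) * d \<le> e"
      using \<open>e > 0\<close> \<open>0 \<le> p\<close> \<open>0 \<le> L\<close> by (simp add: d_def divide_simps)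
    then show ?thesis by (simp add: algebra_simps)
  qed
  finally show "F b - F a \<le> p * measure lebesgue (E \<inter> {a..b}) + L * measure lebesgue ({a..b} - E) + e" .
qed

text \<open>Off a null set \<open>- F\<close> has right slopes below every p > 0, and the null set
  costs \<open>L\<close> times zero. This turns the pointwise hypothesis on \<open>kappa0\<close>
  into monotonicity of \<open>kappa0\<close> plus or minus \<open>rho0\<close>, the only form in
  which it is used later.\<close>

lemma mono_of_AE_deriv_nonneg:
  fixes F :: "real \<Rightarrow> real"
  assumes "a \<le> b" and lip: "L-lipschitz_on {a..b} F"
    and ae: "AE x in lborel. x \<in> {a<..<b} \<longrightarrow> (\<exists>D. (F has_real_derivative D) (at x) \<and> D \<ge> 0)"
  shows "F a \<le> F b"
proof -
  obtain N where N: "N \<in> null_sets lborel"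
    "{x. \<not> (x \<in> {a<..<b} \<longrightarrow> (\<exists>D. (F has_real_derivative D) (at x) \<and> D \<ge> 0))} \<subseteq> N"
    using ae unfolding eventually_ae_filter by auto
  define E where "E = - (N \<union> {a, b})"
  have null: "N \<union> {a, b} \<in> null_sets lebesgue"
    using N(1) by (auto intro!: null_sets.Un null_sets_completionI finite_imp_null_set_lborel)
  have E: "E \<in> sets lebesgue" 
    using null null_setsD2[OF null] by (auto simp: E_def Compl_eq_Diff_UNIV intro: sets.compl_sets)
  have m0: "measure lebesgue ({a..b} - E) = 0"
  proof -
    have "{a..b} - E \<in> null_sets lebesgue"
      by (rule null_sets_subset[OF null sets.Diff[OF fmeasurableD[OF lmeasurable_interval(1)] E]]) (auto simp: E_def)
    then show ?thesis by (simp add: measure_eq_0_null_sets)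
  qed
  have "- F b - (- F a) \<le> e" if "e > 0" for e
  proof -
    define p where "p = e / (b - a + 1)"
    have "p > 0" using that \<open>a \<le> b\<close> by (simp add: p_def)
    have "- F b - (- F a) \<le> p * measure lebesgue (E \<inter> {a..b}) + L * measure lebesgue ({a..b} - E)"
    proof (rule increment_le_of_one_sided_slopes[OF \<open>a \<le> b\<close> _ E])
      show "L-lipschitz_on {a..b} (\<lambda>x. - F x)" using lip by (simp add: lipschitz_on_minus)
      show "0 \<le> p" using \<open>p > 0\<close> by simp
      show "(\<forall>x\<in>E \<inter> {a..<b}. \<forall>d>0. \<exists>y\<in>{x<..b}. y < x + d \<and> - F y - - F x \<le> p * (y - x)) \<or>
       (\<forall>x\<in>E \<inter> {a<..b}. \<forall>d>0. \<exists>y\<in>{a..<x}. x - d < y \<and> - F x - - F y \<le> p * (x - y))"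
      proof (intro disjI1 ballI allI impI)
        fix x d :: real assume x: "x \<in> E \<inter> {a..<b}" and "d > 0"
        then have "x \<in> {a<..<b}" "x \<notin> N" by (auto simp: E_def)
        then obtain D where D: "(F has_real_derivative D) (at x)" "D \<ge> 0" using N(2) by blast
        have "((\<lambda>y. F y + p * y) has_real_derivative D + p) (at x)"
          by (auto intro!: derivative_eq_intros D)
        then obtain r where r: "r > 0" "\<And>h. 0 < h \<Longrightarrow> h < r \<Longrightarrow> F x + p * x < F (x + h) + p * (x + h)"
          using DERIV_pos_inc_right[of "\<lambda>y. F y + p * y" "D + p" x] D(2) \<open>p > 0\<close> by auto
        define h where "h = min (r/2) (min (d/2) (b - x))"
        have h: "0 < h" "h < r" "h < d" "x + h \<le> b" using r \<open>d > 0\<close> x by (auto simp: h_def)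
        show "\<exists>y\<in>{x<..b}. y < x + d \<and> - F y - - F x \<le> p * (y - x)"
          using h r(2)[OF h(1,2)] by (intro bexI[of _ "x + h"]) (auto simp: algebra_simps)
      qed
    qed
    also have "\<dots> \<le> p * (b - a)" 
      using m0 \<open>p > 0\<close> measure_mono_fmeasurable[of "E \<inter> {a..b}" "{a..b}" lebesgue] E \<open>a \<le> b\<close> by auto
    also have "\<dots> \<le> e" using that \<open>a \<le> b\<close> by (simp add: p_def divide_simps)
    finally show ?thesis .
  qed
  then have "- F b - (- F a) \<le> 0 + e" if "e > 0" for e using that by simp
  then have "- F b - (- F a) \<le> 0" by (rule field_le_epsilon)
  then show ?thesis by simp
qed

section \<open>Almost everywhere differentiability\<close>

text \<open>A substitute for the density theorem. Inside an open \<open>U\<close> that exceeds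
  \<open>E\<close> by less than \<open>d\<close>, Vitali gives disjoint balls covering almost all of
  \<open>E\<close>; summing \<open>gap\<close> over them bounds c times the measure of
  \<open>E\<close> by that of \<open>U - E\<close>, hence by \<open>d\<close>.\<close>

lemma null_of_uniform_density_gap:
  fixes E :: "real set"
  assumes E: "E \<in> sets lebesgue" and "c > 0"
    and gap: "\<And>x r. 0 < r \<Longrightarrow> c * measure lebesgue (E \<inter> cball x r) \<le> measure lebesgue (cball x r - E)"
  shows "E \<in> null_sets lebesgue"
proof -
  let ?e = "emeasure lebesgue"
  have small: "ennreal c * ?e E \<le> 0 + ennreal d" if "d > 0" for d
  proof -
    obtain U where U: "open U" "E \<subseteq> U" "U - E \<in> lmeasurable" "?e (U - E) < ennreal d"
      using sets_lebesgue_outer_open[OF E \<open>d > 0\<close>] by blast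
    define K where "K = {i :: real \<times> real. 0 < snd i \<and> cball (fst i) (snd i) \<subseteq> U}"
    have K_pos: "0 < snd i" if "i \<in> K" for i using that by (simp add: K_def)
    have cover: "\<exists>i. i \<in> K \<and> x \<in> cball (fst i) (snd i) \<and> snd i < e" if "x \<in> E" "0 < e" for x e
    proof -
      have "x \<in> U" using U(2) that(1) by (rule subsetD)
      then obtain r where r: "r > 0" "cball x r \<subseteq> U" using U(1) by (meson open_contains_cball_eq)
      have "cball x (min r (e/2)) \<subseteq> U"
        using subset_trans[OF subset_cball[OF min.cobounded1] r(2)] .
      then show ?thesis using r(1) that(2) by (intro exI[of _ "(x, min r (e/2))"]) (simp add: K_def)
    qed
    obtain C where C: "countable C" "C \<subseteq> K"
      "pairwise (\<lambda>i j. disjnt (cball (fst i) (snd i)) (cball (fst j) (snd j))) C"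
      "negligible (E - (\<Union>i\<in>C. cball (fst i) (snd i)))"
      by (rule Vitali_covering_theorem_cballs[of K snd E fst, OF K_pos cover]) (auto intro: that)
    define B where "B i = cball (fst i) (snd i)" for i :: "real \<times> real"
    have B: "B i \<in> sets lebesgue" for i by (simp add: B_def)
    have disj: "disjoint_family_on B C" 
      using C(3) by (auto simp: disjoint_family_on_def pairwise_def disjnt_def B_def)
    have null: "E - (\<Union>i\<in>C. B i) \<in> null_sets lebesgue"
      using C(4) by (simp add: B_def negligible_iff_null_sets)
    have EB: "E \<inter> B i \<in> sets lebesgue" "B i - E \<in> sets lebesgue" for i using E B by auto
    have "(\<Union>i\<in>C. E \<inter> B i) \<in> sets lebesgue" by (rule sets.countable_UN'[OF C(1)]) (use EB in blast)
    then have "?e ((\<Union>i\<in>C. E \<inter> B i) \<union> (E - (\<Union>i\<in>C. B i))) = ?e (\<Union>i\<in>C. E \<inter> B i)"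
      by (rule emeasure_Un_null_set[OF _ null])
    moreover have "(\<Union>i\<in>C. E \<inter> B i) \<union> (E - (\<Union>i\<in>C. B i)) = E" by blast
    ultimately have "?e E = ?e (\<Union>i\<in>C. E \<inter> B i)" by metis
    also have "\<dots> = (\<integral>\<^sup>+i. ?e (E \<inter> B i) \<partial>count_space C)"
      by (rule emeasure_UN_countable[OF EB(1) C(1)]) (use disj in \<open>unfold disjoint_family_on_def, blast\<close>)
    finally have "ennreal c * ?e E \<le> ennreal c * (\<integral>\<^sup>+i. ?e (E \<inter> B i) \<partial>count_space C)"
      by (simp add: mult_left_mono)
    also have "\<dots> = (\<integral>\<^sup>+i. ennreal c * ?e (E \<inter> B i) \<partial>count_space C)"
      by (simp add: nn_integral_cmult)
    also have "\<dots> \<le> (\<integral>\<^sup>+i. ?e (B i - E) \<partial>count_space C)"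
    proof (rule nn_integral_mono)
      fix i assume "i \<in> space (count_space C)"
      then have "0 < snd i" using C(2) by (auto simp: K_def)
      have "E \<inter> B i \<in> lmeasurable" "B i - E \<in> lmeasurable"
        using fmeasurable_Int_fmeasurable[OF lmeasurable_cball E, of "fst i" "snd i"]
          fmeasurable_Diff[OF lmeasurable_cball E, of "fst i" "snd i"] by (simp_all add: B_def Int_commute)
      then show "ennreal c * ?e (E \<inter> B i) \<le> ?e (B i - E)"
        using gap[OF \<open>0 < snd i\<close>, of "fst i"] \<open>c > 0\<close>
        by (simp add: emeasure_eq_measure2 B_def flip: ennreal_mult)
    qed
    also have "\<dots> = ?e (\<Union>i\<in>C. B i - E)"
      by (rule emeasure_UN_countable[OF EB(2) C(1), symmetric]) (use disj in \<open>unfold disjoint_family_on_def, blast\<close>)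
    also have "\<dots> \<le> ?e (U - E)"
    proof (rule emeasure_mono)
      show "(\<Union>i\<in>C. B i - E) \<subseteq> U - E" using C(2) by (fastforce simp: B_def K_def)
    qed (use U(3) in simp)
    finally show ?thesis using U(4) by simp
  qed
  have "ennreal c * ?e E \<le> 0" by (rule ennreal_le_epsilon) (rule small)
  then show ?thesis using E \<open>c > 0\<close> by (auto simp: null_sets_def)
qed

text \<open>Points where, on the side given by the sign \<open>s\<close>, the lower Dini derivative is at most about \<open>p\<close>.\<close>
definition low_slope :: "(real \<Rightarrow> real) \<Rightarrow> real \<Rightarrow> real \<Rightarrow> real \<Rightarrow> bool" where
  "low_slope F s p x \<longleftrightarrow> (\<forall>n::nat. \<exists>r\<in>{0<..<1 / (n + 1)}. (F (x + s * r) - F x) / (s * r) < p)"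

lemma low_slopeD:
  assumes "low_slope F s p x" "d > 0"
  obtains r where "0 < r" "r < d" "(F (x + s * r) - F x) / (s * r) < p"
proof -
  obtain n :: nat where "1 / (n + 1) < d" using nat_approx_posE[OF \<open>d > 0\<close>] by (auto simp: add.commute)
  moreover obtain r where "r \<in> {0<..<1 / (real n + 1)}" "(F (x + s * r) - F x) / (s * r) < p"
    using assms(1) unfolding low_slope_def by blast
  ultimately show ?thesis by (intro that[of r]) (auto simp: add.commute)
qed

lemma not_low_slopeD:
  assumes "\<not> low_slope F s p x"
  obtains d where "d > 0" "\<And>r. 0 < r \<Longrightarrow> r < d \<Longrightarrow> (F (x + s * r) - F x) / (s * r) \<ge> p"
proof -
  obtain n :: nat where n: "\<forall>r\<in>{0<..<1 / (real n + 1)}. \<not> (F (x + s * r) - F x) / (s * r) < p"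
    using assms unfolding low_slope_def by blast
  show ?thesis by (rule that[of "1 / (real n + 1)"]) (use n in \<open>auto simp: not_less\<close>)
qed

lemma increment_le_of_low_slope:
  assumes "a \<le> b" and lip: "L-lipschitz_on UNIV F" and mono: "mono F" and E: "E \<in> sets lebesgue"
    and s: "s \<in> {1, -1}" and low: "\<And>x. x \<in> E \<Longrightarrow> low_slope F s p x"
  shows "F b - F a \<le> p * measure lebesgue (E \<inter> {a..b}) + L * measure lebesgue ({a..b} - E)"
proof (cases "E = {}")
  case True
  then show ?thesis using lipschitz_onD[OF lip, of a b] \<open>a \<le> b\<close> by (auto simp: dist_real_def)
next
  case False
  then obtain x where "low_slope F s p x" using low by auto
  then obtain r where r: "0 < r" "(F (x + s * r) - F x) / (s * r) < p"
    using low_slopeD[of F s p x 1] by auto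
  \<comment> \<open>A monotone \<open>F\<close> has nonnegative quotients, so a single point of
    \<open>E\<close> forces p \<ge> 0. For empty \<open>E\<close> the sign of \<open>p\<close> is
    open, and the Lipschitz bound alone was enough.\<close>
  have "0 \<le> (F (x + s * r) - F x) / (s * r)"
    using s r(1) monoD[OF mono, of x "x + r"] monoD[OF mono, of "x - r" x] by (auto simp: divide_simps)
  then have "0 \<le> p" using r by simp
  show ?thesis
  proof (rule increment_le_of_one_sided_slopes[OF \<open>a \<le> b\<close> lipschitz_on_subset[OF lip] E \<open>0 \<le> p\<close>])
    show "(\<forall>x\<in>E \<inter> {a..<b}. \<forall>d>0. \<exists>y\<in>{x<..b}. y < x + d \<and> F y - F x \<le> p * (y - x)) \<or>
      (\<forall>x\<in>E \<inter> {a<..b}. \<forall>d>0. \<exists>y\<in>{a..<x}. x - d < y \<and> F x - F y \<le> p * (x - y))"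
    proof (cases "s = 1")
      case True
      show ?thesis
      proof (intro disjI1 ballI allI impI)
        fix x d :: real assume x: "x \<in> E \<inter> {a..<b}" "d > 0"
        then obtain r where "0 < r" "r < min d (b - x)" "(F (x + s * r) - F x) / (s * r) < p"
          using low_slopeD[OF low, of x "min d (b - x)"] by auto
        with True x show "\<exists>y\<in>{x<..b}. y < x + d \<and> F y - F x \<le> p * (y - x)"
          by (intro bexI[of _ "x + r"]) (auto simp: field_simps)
      qed
    next
      case False
      then have "s = -1" using s by auto
      show ?thesis
      proof (intro disjI2 ballI allI impI)
        fix x d :: real assume x: "x \<in> E \<inter> {a<..b}" "d > 0"
        then obtain r where "0 < r" "r < min d (x - a)" "(F (x + s * r) - F x) / (s * r) < p"
          using low_slopeD[OF low, of x "min d (x - a)"] by auto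
        with \<open>s = -1\<close> x show "\<exists>y\<in>{a..<x}. x - d < y \<and> F x - F y \<le> p * (x - y)"
          by (intro bexI[of _ "x - r"]) (auto simp: field_simps)
      qed
    qed
  qed auto
qed

text \<open>The function L x - F x is again monotone and \<open>L\<close>-Lipschitz, and its slopes
  below L - q are slopes of \<open>F\<close> above \<open>q\<close>. Adding the two increment
  estimates on a ball eliminates \<open>F\<close> and leaves (q - p) |E inside| \<le> L |ball
  outside E|, a density gap. The denominator L + 1 avoids division by zero.\<close>

lemma null_low_high_slopes:
  assumes lip: "L-lipschitz_on UNIV F" and mono: "mono F" and E: "E \<in> sets lebesgue"
    and s: "s \<in> {1, -1}" "s' \<in> {1, -1}" and "p < q"
    and low: "\<And>x. x \<in> E \<Longrightarrow> low_slope F s p x"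
    and high: "\<And>x. x \<in> E \<Longrightarrow> low_slope (\<lambda>x. L * x - F x) s' (L - q) x"
  shows "E \<in> null_sets lebesgue"
proof (rule null_of_uniform_density_gap[OF E])
  have "0 \<le> L" using lip lipschitz_on_nonneg by blast
  show "0 < (q - p) / (L + 1)" using \<open>p < q\<close> \<open>0 \<le> L\<close> by simp
  fix x r :: real assume "0 < r"
  define a b where "a = x - r" and "b = x + r"
  have ab: "a \<le> b" "cball x r = {a..b}" using \<open>0 < r\<close> by (auto simp: a_def b_def cball_eq_atLeastAtMost)
  let ?m = "measure lebesgue"
  have bnd: "F y - F x \<le> L * (y - x)" if "x \<le> y" for x y
    using lipschitz_onD[OF lip, of x y] that by (auto simp: dist_real_def)
  have 1: "F b - F a \<le> p * ?m (E \<inter> {a..b}) + L * ?m ({a..b} - E)"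
    by (rule increment_le_of_low_slope[OF ab(1) lip mono E s(1) low])
  have lip': "L-lipschitz_on UNIV (\<lambda>x. L * x - F x)"
  proof (rule lipschitz_on_leI[OF _ \<open>0 \<le> L\<close>])
    fix x y :: real assume "x \<le> y"
    then show "dist (L * x - F x) (L * y - F y) \<le> L * dist x y"
      using bnd[of x y] monoD[OF mono, of x y] by (simp add: dist_real_def algebra_simps)
  qed
  have mono': "mono (\<lambda>x. L * x - F x)" using bnd by (intro monoI) (simp add: algebra_simps)
  have 2: "(L * b - F b) - (L * a - F a) \<le> (L - q) * ?m (E \<inter> {a..b}) + L * ?m ({a..b} - E)"
    by (rule increment_le_of_low_slope[OF ab(1) lip' mono' E s(2) high])
  have "{a..b} = (E \<inter> {a..b}) \<union> ({a..b} - E)" by auto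
  moreover have "?m ((E \<inter> {a..b}) \<union> ({a..b} - E)) = ?m (E \<inter> {a..b}) + ?m ({a..b} - E)"
  proof -
    have "E \<inter> {a..b} \<in> lmeasurable" "{a..b} - E \<in> lmeasurable"
      using fmeasurable_Int_fmeasurable[OF lmeasurable_interval(1) E, of a b]
        fmeasurable_Diff[OF lmeasurable_interval(1) E, of a b] by (simp_all add: Int_commute)
    moreover have "({a..b} - E) - (E \<inter> {a..b}) = {a..b} - E" by auto
    ultimately show ?thesis by (simp add: measure_Un2 del: measure_completion)
  qed
  ultimately have "b - a = ?m (E \<inter> {a..b}) + ?m ({a..b} - E)" using ab by simp
  then have "L * (b - a) = L * (?m (E \<inter> {a..b}) + ?m ({a..b} - E))" by (rule arg_cong)
  with 1 2 have "(q - p) * ?m (E \<inter> {a..b}) \<le> L * ?m ({a..b} - E)" by (simp add: algebra_simps)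
  also have "\<dots> \<le> (L + 1) * ?m ({a..b} - E)" by (intro mult_right_mono) auto
  finally show "(q - p) / (L + 1) * ?m (E \<inter> cball x r) \<le> ?m (cball x r - E)"
    using \<open>0 \<le> L\<close> by (simp add: ab(2) field_simps)
qed

text \<open>With no rational gap between a lower slope on one side and an upper slope on either
  side, all four Dini derivatives agree; the Lipschitz bound makes them finite.\<close>

lemma differentiable_of_no_slope_gap:
  assumes lip: "L-lipschitz_on UNIV F"
    and gap: "\<And>s s' p q. s \<in> {1, -1} \<Longrightarrow> s' \<in> {1, -1} \<Longrightarrow> p < q \<Longrightarrow> p \<in> \<rat> \<Longrightarrow> q \<in> \<rat> \<Longrightarrow>
      \<not> (low_slope F s p x \<and> low_slope (\<lambda>x. L * x - F x) s' (L - q) x)"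
  shows "F differentiable (at x)"
proof -
  have "0 \<le> L" using lip lipschitz_on_nonneg by blast
  \<comment> \<open>The infimum of this set is the smaller of the two lower Dini derivatives at
    \<open>x\<close>.\<close>
  define A where "A = {p. \<exists>s\<in>{1, -1}. low_slope F s p x}"
  have q_bound: "\<bar>(F (x + h) - F x) / h\<bar> \<le> L" if "h \<noteq> 0" for h
    using lipschitz_onD[OF lip, of "x + h" x] that by (auto simp: dist_real_def abs_divide pos_divide_le_eq)
  have "low_slope F 1 (L + 1) x"
    unfolding low_slope_def
  proof
    fix n :: nat
    show "\<exists>r\<in>{0<..<1 / (real n + 1)}. (F (x + 1 * r) - F x) / (1 * r) < L + 1"
      using q_bound[of "1 / (n + 1) / 2"] by (intro bexI[of _ "1 / (n + 1) / 2"]) (auto simp: field_simps)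
  qed
  then have ne: "A \<noteq> {}" by (auto simp: A_def)
  have bdd: "bdd_below A"
  proof (rule bdd_belowI[of _ "- L"])
    fix p assume "p \<in> A"
    then obtain s where s: "s \<in> {1, -1}" "low_slope F s p x" by (auto simp: A_def)
    then obtain r where "0 < r" "(F (x + s * r) - F x) / (s * r) < p"
      using low_slopeD[of F s p x 1] by auto
    moreover have "\<bar>(F (x + s * r) - F x) / (s * r)\<bar> \<le> L" using s \<open>0 < r\<close> by (intro q_bound) auto
    ultimately show "- L \<le> p" by (metis abs_le_D2 le_less_trans less_imp_le minus_le_iff)
  qed
  define D where "D = Inf A"
  have "((\<lambda>h. (F (x + h) - F x) / h) \<longlongrightarrow> D) (at 0)"
  proof (rule tendstoI)
    fix e :: real assume "e > 0"
    have "\<not> low_slope F s (D - e/2) x" if "s \<in> {1, -1}" for s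
      using cInf_lower[OF _ bdd, of "D - e/2"] that \<open>e > 0\<close> by (auto simp: A_def D_def)
    then have n: "\<not> low_slope F 1 (D - e/2) x" "\<not> low_slope F (-1) (D - e/2) x" by auto
    obtain d1 where d1: "d1 > 0"
      "\<And>r. 0 < r \<Longrightarrow> r < d1 \<Longrightarrow> (F (x + 1 * r) - F x) / (1 * r) \<ge> D - e/2"
      using not_low_slopeD[OF n(1)] by blast
    obtain d2 where d2: "d2 > 0"
      "\<And>r. 0 < r \<Longrightarrow> r < d2 \<Longrightarrow> (F (x + (-1) * r) - F x) / ((-1) * r) \<ge> D - e/2"
      using not_low_slopeD[OF n(2)] by blast
    obtain p0 s0 where p0: "s0 \<in> {1, -1}" "low_slope F s0 p0 x" "p0 < D + e/4"
      using cInf_lessD[OF ne, of "D + e/4"] \<open>e > 0\<close> by (auto simp: D_def A_def)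
    \<comment> \<open>The rationals are squeezed between a slope that occurs, below D + e/4, and the
      tolerance D + e/2, so that \<open>gap\<close> excludes slopes above \<open>q\<close> on both
      sides.\<close>
    obtain p where p: "p \<in> \<rat>" "D + e/4 < p" "p < D + e/3" using Rats_dense_in_real[of "D + e/4" "D + e/3"] \<open>e > 0\<close> by auto
    obtain q where q: "q \<in> \<rat>" "D + e/3 < q" "q < D + e/2" using Rats_dense_in_real[of "D + e/3" "D + e/2"] \<open>e > 0\<close> by auto
    have "low_slope F s0 p x" using p0 p(2) unfolding low_slope_def by (meson less_trans)
    then have "\<not> low_slope (\<lambda>x. L * x - F x) s (L - q) x" if "s \<in> {1, -1}" for s
      using gap[OF p0(1) that, of p q] p q by auto
    then have n': "\<not> low_slope (\<lambda>x. L * x - F x) 1 (L - q) x" "\<not> low_slope (\<lambda>x. L * x - F x) (-1) (L - q) x" by auto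
    obtain d3 where d3: "d3 > 0" "\<And>r. 0 < r \<Longrightarrow> r < d3 \<Longrightarrow>
        (L * (x + 1 * r) - F (x + 1 * r) - (L * x - F x)) / (1 * r) \<ge> L - q"
      using not_low_slopeD[OF n'(1)] by blast
    obtain d4 where d4: "d4 > 0" "\<And>r. 0 < r \<Longrightarrow> r < d4 \<Longrightarrow>
        (L * (x + (-1) * r) - F (x + (-1) * r) - (L * x - F x)) / ((-1) * r) \<ge> L - q"
      using not_low_slopeD[OF n'(2)] by blast
    define d where "d = min (min d1 d2) (min d3 d4)"
    have "\<bar>(F (x + h) - F x) / h - D\<bar> < e" if "h \<noteq> 0" "\<bar>h\<bar> < d" for h
    proof (cases "h > 0")
      case True
      then have "(F (x + h) - F x) / h \<ge> D - e/2" "(L * (x + h) - F (x + h) - (L * x - F x)) / h \<ge> L - q"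
        using d1(2)[of h] d3(2)[of h] that by (auto simp: d_def)
      moreover have "(L * (x + h) - F (x + h) - (L * x - F x)) / h = L - (F (x + h) - F x) / h"
        using True by (simp add: field_simps)
      moreover define X where "X = (F (x + h) - F x) / h"
      ultimately have "D - e/2 \<le> X" "L - q \<le> L - X" by simp_all
      then have "\<bar>X - D\<bar> < e" using q \<open>e > 0\<close> by linarith
      then show ?thesis by (simp add: X_def)
    next
      case False
      then have "(F (x + h) - F x) / h \<ge> D - e/2" "(L * (x + h) - F (x + h) - (L * x - F x)) / h \<ge> L - q"
        using d2(2)[of "-h"] d4(2)[of "-h"] that by (auto simp: d_def)
      moreover have "(L * (x + h) - F (x + h) - (L * x - F x)) / h = L - (F (x + h) - F x) / h"
        using that by (simp add: field_simps)
      moreover define X where "X = (F (x + h) - F x) / h"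
      ultimately have "D - e/2 \<le> X" "L - q \<le> L - X" by simp_all
      then have "\<bar>X - D\<bar> < e" using q \<open>e > 0\<close> by linarith
      then show ?thesis by (simp add: X_def)
    qed
    moreover have "d > 0" using d1 d2 d3 d4 by (simp add: d_def)
    ultimately show "\<forall>\<^sub>F h in at 0. dist ((F (x + h) - F x) / h) D < e"
      unfolding eventually_at by (intro exI[of _ d]) (auto simp: dist_real_def)
  qed
  then have "(F has_real_derivative D) (at x)" by (simp add: DERIV_def)
  then show ?thesis by (meson real_differentiable_def)
qed

text \<open>The exceptional set is a countable union over rational p < q and the four choices of
  sides. Each piece is null on every horizontal line, hence null in the plane by Tonelli; continuity
  of \<open>K\<close> in both variables supplies the measurability that this needs.\<close>

lemma AE_differentiable_of_mono_lipschitz_slices: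
  fixes K :: "real \<times> real \<Rightarrow> real"
  assumes cont: "continuous_on UNIV K"
    and lip: "\<And>t. L-lipschitz_on UNIV (\<lambda>x. K (x, t))"
    and mono: "\<And>t. mono (\<lambda>x. K (x, t))"
  shows "AE z in lborel. (\<lambda>y. K (y, snd z)) differentiable (at (fst z))"
proof -
  define W where "W J s p = {z. low_slope (\<lambda>x. J (x, snd z)) s p (fst z)}"
    for J :: "real \<times> real \<Rightarrow> real" and s p
  have W: "W J s p \<in> sets borel" if J: "continuous_on UNIV J" for J s p
  proof -
    \<comment> \<open>The strict inequality in \<open>low_slope\<close> makes the union over the
      uncountably many \<open>r\<close> open, so \<open>W\<close> is a countable intersection of
      open sets.\<close>
    have "W J s p = (\<Inter>n::nat. \<Union>r\<in>{0<..<1 / (n + 1)}. {z. (J (fst z + s * r, snd z) - J z) / (s * r) < p})"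
      by (auto simp: W_def low_slope_def)
    moreover have "open (\<Union>r\<in>{0<..<1 / (real n + 1)}. {z. (J (fst z + s * r, snd z) - J z) / (s * r) < p})" for n
    proof (intro open_UN ballI)
      fix r :: real assume "r \<in> {0<..<1 / (real n + 1)}"
      show "open {z. (J (fst z + s * r, snd z) - J z) / (s * r) < p}"
        unfolding divide_inverse
        by (intro open_Collect_less continuous_intros continuous_on_compose2[OF J]) auto
    qed
    ultimately show ?thesis by auto
  qed
  define J where "J z = L * fst z - K z" for z
  have J: "continuous_on UNIV J" unfolding J_def by (intro continuous_intros cont)
  define Z where "Z s s' p q = W K s p \<inter> W J s' (L - q)" for s s' p q
  have Z: "Z s s' p q \<in> null_sets lborel" if "s \<in> {1, -1}" "s' \<in> {1, -1}" "p < q" for s s' p q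
  proof -
    have meas: "Z s s' p q \<in> sets (lborel \<Otimes>\<^sub>M lborel :: (real \<times> real) measure)"
      unfolding lborel_prod using W[OF cont] W[OF J] by (auto simp: Z_def)
    have slice: "(\<lambda>x. (x, t)) -` Z s s' p q \<in> null_sets lborel" for t
    proof -
      have b: "(\<lambda>x. (x, t)) -` Z s s' p q \<in> sets borel"
        using sets_Pair2[OF meas, of t] by simp
      have "(\<lambda>x. (x, t)) -` Z s s' p q \<in> null_sets lebesgue"
        by (rule null_low_high_slopes[OF lip mono _ that, of _ t])
          (use b in \<open>auto simp: Z_def W_def J_def\<close>)
      then show ?thesis using b by (simp add: null_sets_def)
    qed
    have "emeasure (lborel \<Otimes>\<^sub>M lborel) (Z s s' p q) = (\<integral>\<^sup>+t. emeasure lborel ((\<lambda>x. (x, t)) -` Z s s' p q) \<partial>lborel)"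
      by (rule lborel_pair.emeasure_pair_measure_alt2[OF meas])
    also have "\<dots> = 0" using slice by (simp add: null_sets_def)
    finally show ?thesis using meas unfolding lborel_prod by (simp add: null_sets_def)
  qed
  define R where "R = {i :: real \<times> real. fst i \<in> \<rat> \<and> snd i \<in> \<rat> \<and> fst i < snd i}"
  have "countable R"
    by (rule countable_subset[of _ "\<rat> \<times> \<rat>"]) (auto simp: R_def countable_rat)
  have "(\<Union>s\<in>{1, -1}. \<Union>s'\<in>{1, -1}. \<Union>i\<in>R. Z s s' (fst i) (snd i)) \<in> null_sets lborel"
    by (intro null_sets_UN' \<open>countable R\<close> Z) (auto simp: R_def)
  then show ?thesis
  proof (rule AE_I'[OF _ subsetI])
    fix z assume z: "z \<in> {z \<in> space lborel. \<not> (\<lambda>y. K (y, snd z)) differentiable at (fst z)}"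
    show "z \<in> (\<Union>s\<in>{1, -1}. \<Union>s'\<in>{1, -1}. \<Union>i\<in>R. Z s s' (fst i) (snd i))"
    proof (rule ccontr)
      assume no: "\<not> ?thesis"
      have "(\<lambda>y. K (y, snd z)) differentiable at (fst z)"
      proof (rule differentiable_of_no_slope_gap[OF lip])
        fix s s' p q :: real assume *: "s \<in> {1, -1}" "s' \<in> {1, -1}" "p < q" "p \<in> \<rat>" "q \<in> \<rat>"
        then have "(p, q) \<in> R" by (simp add: R_def)
        with * no have "z \<notin> Z s s' (fst (p, q)) (snd (p, q))" by blast
        then show "\<not> (low_slope (\<lambda>y. K (y, snd z)) s p (fst z) \<and>
           low_slope (\<lambda>x. L * x - K (x, snd z)) s' (L - q) (fst z))"
          by (auto simp: Z_def W_def J_def)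
      qed
      with z show False by auto
    qed
  qed
qed

section \<open>Fourier sine series and the heat equation\<close>

text \<open>\<open>S j\<close> stands for the \<open>j\<close>-th space derivative of an odd,
  2-periodic solution, so that \<open>S_dt\<close>, with its index shift by 2, is the heat equation
  at every order. The bounds hold up to t = 0, where the time derivative is one-sided.\<close>

locale heat_family =
  fixes S :: "nat \<Rightarrow> real \<Rightarrow> real \<Rightarrow> real" and B :: "nat \<Rightarrow> real"
  assumes S_bound: "0 \<le> t \<Longrightarrow> \<bar>S j x t\<bar> \<le> B j"
    and S_dx: "0 \<le> t \<Longrightarrow> ((\<lambda>x. S j x t) has_real_derivative S (Suc j) x t) (at x)"
    and S_dt: "0 \<le> t \<Longrightarrow> ((\<lambda>t. S j x t) has_real_derivative S (j + 2) x t) (at t within {0..})"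
    and S_minus: "0 \<le> t \<Longrightarrow> S j (- x) t = - ((- 1) ^ j * S j x t)"
    and S_period: "S j (x + 2) t = S j x t"

lemma smooth_real_has_deriv:
  "smooth_real f \<Longrightarrow> ((deriv ^^ n) f has_real_derivative (deriv ^^ Suc n) f x) (at x)"
  unfolding funpow.simps comp_def by (metis smooth_real_def DERIV_deriv_iff_real_differentiable)

lemma abs_bound_of_compact:
  fixes g :: "'a::topological_space \<Rightarrow> real"
  assumes "compact X" "continuous_on X g"
  obtains M where "\<And>x. x \<in> X \<Longrightarrow> \<bar>g x\<bar> \<le> M"
proof -
  obtain M where "\<forall>y\<in>g ` X. norm y \<le> M"
    using compact_imp_bounded[OF compact_continuous_image[OF assms(2,1)]] unfolding bounded_iff by blast
  then show ?thesis by (intro that[of M]) auto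
qed

lemma higher_deriv_eq_0_outside_support:
  assumes "x \<notin> closure {x. f x \<noteq> (0::real)}"
  shows "(deriv ^^ n) f x = 0"
  using assms
proof (induction n arbitrary: x)
  case 0
  then show ?case using closure_subset[of "{x. f x \<noteq> 0}"] by auto
next
  case (Suc n)
  have "((deriv ^^ n) f has_real_derivative 0) (at x)"
    by (rule has_field_derivative_transform_within_open[of "\<lambda>_. 0" _ _ "- closure {x. f x \<noteq> 0}"])
      (use Suc in auto)
  then show ?case by (simp add: DERIV_imp_deriv)
qed

lemma C0_infty_I_boundary:
  assumes "C0_infty_I f"
  shows "(deriv ^^ n) f 0 = 0" "(deriv ^^ n) f 1 = 0"
proof -
  have "closure {x. f x \<noteq> 0} \<subseteq> {0<..<1}" using assms by (simp add: C0_infty_I_def)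
  then have "0 \<notin> closure {x. f x \<noteq> 0}" "1 \<notin> closure {x. f x \<noteq> 0}" by (meson greaterThanLessThan_iff less_irrefl subsetD)+
  then show "(deriv ^^ n) f 0 = 0" "(deriv ^^ n) f 1 = 0" by (auto intro: higher_deriv_eq_0_outside_support)
qed

text \<open>The free phase \<open>c\<close> absorbs the alternation of sine and cosine, so that
  integration by parts reproduces its own form and can be iterated.\<close>

lemma integral_mult_sin_by_parts:
  fixes g g' :: "real \<Rightarrow> real"
  assumes g: "\<And>x. (g has_real_derivative g' x) (at x)" and g': "continuous_on {0..1} g'"
    and zero: "g 0 = 0" "g 1 = 0" and "w \<noteq> 0"
  shows "w * integral {0..1} (\<lambda>x. g x * sin (w * x + c)) = - integral {0..1} (\<lambda>x. g' x * sin (w * x + (c - pi / 2)))"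
proof -
  let ?s = "\<lambda>x. sin (w * x + (c - pi / 2))"
  have sc: "cos (w * x + (c - pi / 2)) = sin (w * x + c)" for x
    unfolding add_diff_eq cos_diff by simp
  have "((\<lambda>x. g' x * ?s x + w * (g x * sin (w * x + c))) has_integral g 1 * ?s 1 - g 0 * ?s 0) {0..1}"
    by (rule fundamental_theorem_of_calculus)
      (auto intro!: derivative_eq_intros has_field_derivative_at_within[OF g]
        simp: sc simp flip: has_real_derivative_iff_has_vector_derivative)
  then have 1: "integral {0..1} (\<lambda>x. g' x * ?s x + w * (g x * sin (w * x + c))) = 0"
    using zero by (simp add: integral_unique)
  have cg: "continuous_on {0..1} g"
    using g by (meson DERIV_continuous_on has_field_derivative_at_within)
  have "integral {0..1} (\<lambda>x. g' x * ?s x + w * (g x * sin (w * x + c))) =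
      integral {0..1} (\<lambda>x. g' x * ?s x) + integral {0..1} (\<lambda>x. w * (g x * sin (w * x + c)))"
    by (rule integral_add) (intro integrable_continuous_real continuous_intros g' cg)+
  with 1 show ?thesis by simp
qed

text \<open>Integration by parts \<open>n\<close> times; the boundary terms vanish because all
  derivatives of a compactly supported function are 0 at the end points.\<close>

lemma sine_coefficient_decay:
  assumes f: "C0_infty_I f"
  obtains C where "\<And>w c. w > 0 \<Longrightarrow> w ^ n * \<bar>integral {0..1} (\<lambda>x. f x * sin (w * x + c))\<bar> \<le> C"
proof -
  let ?D = "\<lambda>n. (deriv ^^ n) f"
  have D: "(?D n has_real_derivative ?D (Suc n) x) (at x)" for n x
    using f smooth_real_has_deriv by (auto simp: C0_infty_I_def)
  have cont: "continuous_on {0..1} (?D n)" for n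
    using D by (meson DERIV_continuous_on has_field_derivative_at_within)
  have zero: "?D n 0 = 0" "?D n 1 = 0" for n
    using C0_infty_I_boundary[OF f] by auto
  have step: "w ^ n * \<bar>integral {0..1} (\<lambda>x. f x * sin (w * x + c))\<bar> =
      \<bar>integral {0..1} (\<lambda>x. ?D n x * sin (w * x + (c - n * (pi / 2))))\<bar>" if "w > 0" for w c n
  proof (induction n)
    case (Suc n)
    have "w ^ Suc n * \<bar>integral {0..1} (\<lambda>x. f x * sin (w * x + c))\<bar> =
       \<bar>w * integral {0..1} (\<lambda>x. ?D n x * sin (w * x + (c - n * (pi / 2))))\<bar>"
      using Suc that by (simp add: abs_mult mult.assoc)
    also have "\<dots> = \<bar>integral {0..1} (\<lambda>x. ?D (Suc n) x * sin (w * x + (c - n * (pi / 2) - pi / 2)))\<bar>"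
      using integral_mult_sin_by_parts[OF D cont zero, of w n "c - n * (pi / 2)"] that by simp
    also have "c - n * (pi / 2) - pi / 2 = c - Suc n * (pi / 2)" by (simp add: algebra_simps)
    finally show ?case .
  qed simp
  obtain C where C: "\<And>x. x \<in> {0..1} \<Longrightarrow> \<bar>?D n x\<bar> \<le> C"
    using abs_bound_of_compact[OF compact_Icc cont[of n]] by blast
  show ?thesis
  proof (rule that)
    fix w c :: real assume "w > 0"
    have "norm (integral {0..1} (\<lambda>x. ?D n x * sin (w * x + (c - n * (pi / 2))))) \<le> C * (1 - 0)"
    proof (rule integral_bound)
      show "norm (?D n x * sin (w * x + (c - n * (pi / 2)))) \<le> C" if "x \<in> {0..1}" for x
        using mult_mono[OF C[OF that] abs_sin_le_one] C[OF that] by (force simp: abs_mult)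
    qed (auto intro!: continuous_intros cont)
    then show "w ^ n * \<bar>integral {0..1} (\<lambda>x. f x * sin (w * x + c))\<bar> \<le> C" by (simp add: step[OF \<open>w > 0\<close>])
  qed
qed

text \<open>Completeness of the sine system by the substitution y = cos (pi x). Orthogonality to all
  sines gives orthogonality of \<open>g\<close> to sin (pi x) times every polynomial in cos (pi x);
  such polynomials approximate \<open>g\<close> uniformly, so the integral of g^2 sin (pi x)
  vanishes.\<close>

lemma sine_orthogonal_imp_0:
  fixes g :: "real \<Rightarrow> real"
  assumes cont: "continuous_on {0..1} g" and bd: "g 0 = 0" "g 1 = 0"
    and orth: "\<And>m::nat. integral {0..1} (\<lambda>x. g x * sin (m * pi * x)) = 0"
    and "x \<in> {0..1}"
  shows "g x = 0"
proof -
  have orth_int: "integral {0..1} (\<lambda>x. g x * sin (of_int m * pi * x)) = 0" for m :: int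
  proof (cases m)
    case (neg n)
    then have "real_of_int m = - real (Suc n)" by (simp only: of_int_minus of_int_of_nat_eq)
    then have "of_int m * pi * x = - (real (Suc n) * pi * x)" for x :: real by (simp del: of_nat_Suc)
    then have "(\<lambda>x. g x * sin (of_int m * pi * x)) = (\<lambda>x. - (g x * sin (real (Suc n) * pi * x)))"
      by (simp only: sin_minus) simp
    then show ?thesis using orth[of "Suc n"] by simp
  qed (use orth in simp)
  have pow: "integral {0..1} (\<lambda>x. g x * sin (of_int m * pi * x) * cos (pi * x) ^ i) = 0" for m :: int and i :: nat
  proof (induction i arbitrary: m)
    case (Suc i)
    have sc: "sin (of_int m * pi * x) * cos (pi * x) =
        (sin (of_int (m + 1) * pi * x) + sin (of_int (m - 1) * pi * x)) / 2" for x
    proof -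
      have "of_int (m + 1) * pi * x = of_int m * pi * x + pi * x" "of_int (m - 1) * pi * x = of_int m * pi * x - pi * x"
        by (simp_all add: algebra_simps)
      then show ?thesis by (simp only: sin_add sin_diff) simp
    qed
    have *: "g x * sin (of_int m * pi * x) * cos (pi * x) ^ Suc i =
        1 / 2 * (g x * sin (of_int (m + 1) * pi * x) * cos (pi * x) ^ i)
       + 1 / 2 * (g x * sin (of_int (m - 1) * pi * x) * cos (pi * x) ^ i)" for x
    proof -
      have "g x * sin (of_int m * pi * x) * cos (pi * x) ^ Suc i =
        g x * (sin (of_int m * pi * x) * cos (pi * x)) * cos (pi * x) ^ i" by simp
      then show ?thesis unfolding sc by (simp add: ring_distribs add_divide_distrib)
    qed
    show ?case unfolding *
      by (subst integral_add) (auto intro!: integrable_continuous_real continuous_intros cont simp: Suc[of "m + 1", simplified] Suc[of "m - 1", simplified])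
  qed (use orth_int in simp)
  define h where "h y = g (arccos y / pi)" for y
  have "continuous_on {-1..1} h"
    unfolding h_def
    by (intro continuous_on_compose2[OF cont] continuous_intros)
      (auto simp: arccos_lbound arccos_ubound)
  have gh: "g x = h (cos (pi * x))" if "x \<in> {0..1}" for x
    using that by (simp add: h_def arccos_cos)
  obtain M where M: "\<And>x. x \<in> {0..1} \<Longrightarrow> \<bar>g x\<bar> \<le> M"
    using abs_bound_of_compact[OF compact_Icc cont] by blast
  have "0 \<le> M" using M[of 0] by simp
  \<comment> \<open>The weight sin (pi x) comes from the substitution and is positive inside the
    interval, so a zero integral still forces g = 0 there.\<close>
  let ?I = "integral {0..1} (\<lambda>x. g x * g x * sin (pi * x))"
  have "?I \<le> 0 + e" if "e > 0" for e
  proof -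
    define d where "d = e / (M + 1)"
    have "d > 0" using that \<open>0 \<le> M\<close> by (simp add: d_def)
    obtain p where p: "real_polynomial_function p" "\<And>y. y \<in> {-1..1} \<Longrightarrow> \<bar>h y - p y\<bar> < d"
      using Stone_Weierstrass_real_polynomial_function[OF compact_Icc \<open>continuous_on {-1..1} h\<close> \<open>d > 0\<close>] by blast
    then obtain a n where pa: "p = (\<lambda>y. \<Sum>i\<le>n. a i * y ^ i)" by (auto simp: real_polynomial_function_iff_sum)
    have int_i: "(\<lambda>x. g x * sin (pi * x) * cos (pi * x) ^ i) integrable_on {0..1}" for i
      by (intro integrable_continuous_real continuous_intros cont)
    have "integral {0..1} (\<lambda>x. g x * sin (pi * x) * p (cos (pi * x))) =
      integral {0..1} (\<lambda>x. \<Sum>i\<le>n. a i * (g x * sin (pi * x) * cos (pi * x) ^ i))"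
      by (simp add: pa sum_distrib_left mult_ac)
    also have "\<dots> = (\<Sum>i\<le>n. a i * integral {0..1} (\<lambda>x. g x * sin (pi * x) * cos (pi * x) ^ i))"
      by (subst integral_sum) (auto intro!: integrable_on_mult_right int_i)
    also have "\<dots> = 0" using pow[of 1] by simp
    finally have 0: "integral {0..1} (\<lambda>x. g x * sin (pi * x) * p (cos (pi * x))) = 0" .
    have cp: "continuous_on {0..1} (\<lambda>x. p (cos (pi * x)))" unfolding pa by (intro continuous_intros)
    have "?I = integral {0..1} (\<lambda>x. g x * g x * sin (pi * x) - g x * sin (pi * x) * p (cos (pi * x)))"
      by (subst integral_diff) (use 0 in \<open>auto intro!: integrable_continuous_real continuous_intros cont cp\<close>)
    also have "\<dots> \<le> norm \<dots>" by simp
    also have "\<dots> \<le> M * d * (1 - 0)"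
    proof (rule integral_bound)
      fix x :: real assume x: "x \<in> {0..1}"
      have "g x * g x * sin (pi * x) - g x * sin (pi * x) * p (cos (pi * x)) =
         g x * sin (pi * x) * (h (cos (pi * x)) - p (cos (pi * x)))"
        by (simp add: gh[OF x] algebra_simps)
      also have "\<bar>\<dots>\<bar> \<le> M * 1 * d"
        unfolding abs_mult using M[OF x] p(2)[of "cos (pi * x)"] \<open>0 \<le> M\<close>
        by (intro mult_mono) auto
      finally show "norm (g x * g x * sin (pi * x) - g x * sin (pi * x) * p (cos (pi * x))) \<le> M * d" by simp
    qed (auto intro!: continuous_intros cont cp)
    also have "\<dots> \<le> e" using that \<open>0 \<le> M\<close> by (simp add: d_def field_simps)
    finally show ?thesis by simp
  qed
  then have "?I \<le> 0" by (rule field_le_epsilon)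
  moreover have nn: "0 \<le> g x * g x * sin (pi * x)" if "x \<in> {0..1}" for x
    by (rule mult_nonneg_nonneg[OF zero_le_square sin_ge_zero]) (use that in auto)
  then have "0 \<le> ?I" by (intro integral_nonneg integrable_continuous_real continuous_intros cont) auto
  ultimately have I: "((\<lambda>x. g x * g x * sin (pi * x)) has_integral 0) (cbox 0 1)"
    by (auto simp: has_integral_iff intro!: integrable_continuous_real continuous_intros cont)
  show ?thesis
  proof (cases "x = 0 \<or> x = 1")
    case False
    then have x: "0 < x" "x < 1" using \<open>x \<in> {0..1}\<close> by auto
    have "g x * g x * sin (pi * x) = 0"
      by (rule has_integral_0_cbox_imp_0[OF _ _ I]) (use nn x in \<open>auto intro!: continuous_intros cont\<close>)
    moreover have "sin (pi * x) > 0" using x by (intro sin_gt_zero) auto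
    ultimately show ?thesis by simp
  qed (use bd in auto)
qed

lemma integral_sin_mult_sin:
  fixes k m :: nat
  assumes "0 < k" "0 < m"
  shows "integral {0..1} (\<lambda>x. sin (k * pi * x) * sin (m * pi * x)) = (if k = m then 1/2 else 0)"
proof -
  have cosint: "integral {0..1} (\<lambda>x. cos (of_int n * pi * x)) = (if n = 0 then 1 else 0)" for n :: int
  proof (cases "n = 0")
    case False
    have "((\<lambda>x. cos (of_int n * pi * x)) has_integral sin (of_int n * pi * 1) / (of_int n * pi) - sin (of_int n * pi * 0) / (of_int n * pi)) {0..1}"
      by (rule fundamental_theorem_of_calculus)
       (use False in \<open>auto intro!: derivative_eq_intros simp flip: has_real_derivative_iff_has_vector_derivative\<close>)
    moreover have "sin (of_int n * pi) = 0" by (simp add: sin_times_pi_eq_0)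
    ultimately show ?thesis using False by (simp add: integral_unique)
  qed simp
  have *: "sin (k * pi * x) * sin (m * pi * x) =
     1/2 * cos (of_int (int k - int m) * pi * x) - 1/2 * cos (of_int (int k + int m) * pi * x)" for x
    by (simp add: sin_times_sin algebra_simps diff_divide_distrib)
  show ?thesis unfolding *
    by (subst integral_diff) (use assms in \<open>auto intro!: integrable_continuous_real continuous_intros simp: cosint simp del: of_int_add of_int_diff\<close>)
qed

theorem heat_family_exists:
  assumes f: "C0_infty_I f"
  shows "\<exists>S B. heat_family S B \<and> (\<forall>x\<in>{0..1}. S 0 x 0 = f x)"
proof -
  define w where "w k = real k * pi" for k
  \<comment> \<open>The factor 2 compensates for the sines having squared norm 1/2 on the unit
    interval.\<close>
  define b where "b k = 2 * integral {0..1} (\<lambda>x. f x * sin (w k * x))" for k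
  define M where "M j k = \<bar>b k\<bar> * w k ^ j" for j k
  have b0: "b 0 = 0" by (simp add: b_def w_def)
  have w_ge: "0 \<le> w k" for k by (simp add: w_def)
  have M_summable: "summable (M j)" for j
  proof -
    \<comment> \<open>Two powers more than the \<open>j\<close> derivatives require leave a majorant
      of order 1 / k^2.\<close>
    obtain C where C: "\<And>u c. u > 0 \<Longrightarrow> u ^ (j + 2) * \<bar>integral {0..1} (\<lambda>x. f x * sin (u * x + c))\<bar> \<le> C"
      using sine_coefficient_decay[OF f, of "j + 2"] by blast
    have "norm (M j k) \<le> 2 * C * inverse (real k ^ 2)" for k
    proof (cases "k = 0")
      case False
      then have "w k > 0" "real k \<le> w k" using pi_gt3 by (auto simp: w_def)
      have "M j k * real k ^ 2 \<le> M j k * w k ^ 2"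
        using \<open>real k \<le> w k\<close> w_ge by (intro mult_left_mono power_mono) (auto simp: M_def)
      also have "\<dots> = 2 * (w k ^ (j + 2) * \<bar>integral {0..1} (\<lambda>x. f x * sin (w k * x + 0))\<bar>)"
        by (simp add: M_def b_def power_add power2_eq_square mult_ac abs_mult)
      also have "\<dots> \<le> 2 * C" using C[OF \<open>w k > 0\<close>, of 0] by simp
      finally show ?thesis using False w_ge by (simp add: field_simps M_def abs_mult)
    qed (simp add: M_def b0)
    moreover have "summable (\<lambda>k. 2 * C * inverse (real k ^ 2))"
      using inverse_power_summable[of 2] by (intro summable_mult) simp
    ultimately show ?thesis by (intro summable_comparison_test'[of _ 0 "M j"])
  qed
  \<comment> \<open>Shifting the phase by pi / 2 per derivative keeps a single formula for all
    orders; two shifts change the sign, which matches the time derivative of the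
    exponential.\<close>
  define u where "u j k x t = b k * w k ^ j * exp (- (w k)\<^sup>2 * t) * sin (w k * x + j * (pi / 2))" for j k x t
  define S where "S j x t = (\<Sum>k. u j k x t)" for j x t
  have u_bound: "norm (u j k x t) \<le> M j k" if "0 \<le> t" for j k x t
  proof -
    have "\<bar>b k * w k ^ j\<bar> * \<bar>exp (- (w k)\<^sup>2 * t)\<bar> * \<bar>sin (w k * x + j * (pi / 2))\<bar> \<le> \<bar>b k * w k ^ j\<bar> * 1 * 1"
      using that by (intro mult_mono) auto
    then show ?thesis using w_ge[of k] by (simp add: u_def M_def abs_mult)
  qed
  have u_summable: "summable (\<lambda>k. u j k x t)" if "0 \<le> t" for j x t
    by (rule summable_comparison_test'[OF M_summable u_bound[OF that]])
  have u_dx: "((\<lambda>x. u j k x t) has_real_derivative u (Suc j) k x t) (at x)" for j k x t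
  proof -
    have "w k * x + Suc j * (pi / 2) = (w k * x + j * (pi / 2)) + pi / 2"
      by (simp add: algebra_simps add_divide_distrib)
    then have "cos (w k * x + j * (pi / 2)) = sin (w k * x + Suc j * (pi / 2))"
      by (simp only: sin_add) simp
    then show ?thesis unfolding u_def by (auto intro!: derivative_eq_intros)
  qed
  have u_dt: "((\<lambda>t. u j k x t) has_real_derivative u (j + 2) k x t) (at t within X)" for j k x t X
  proof -
    have "sin (w k * x + (j + 2) * (pi / 2)) = - sin (w k * x + j * (pi / 2))"
      using sin_periodic_pi[of "w k * x + j * (pi / 2)"] by (simp add: algebra_simps)
    then show ?thesis unfolding u_def 
      by (auto intro!: derivative_eq_intros simp: power_add power2_eq_square)
  qed
  have "heat_family S (\<lambda>j. suminf (M j))"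
  proof
    fix t x :: real and j assume t: "0 \<le> t"
    have "summable (\<lambda>k. norm (u j k x t))" 
      by (rule summable_comparison_test'[OF M_summable, of 0 _ j]) (use u_bound[OF t] in simp)
    then have "norm (S j x t) \<le> (\<Sum>k. norm (u j k x t))" unfolding S_def by (rule summable_norm)
    also have "\<dots> \<le> suminf (M j)"
      by (intro suminf_le u_bound t M_summable \<open>summable (\<lambda>k. norm (u j k x t))\<close>)
    finally show "\<bar>S j x t\<bar> \<le> suminf (M j)" by simp
  next
    fix t x :: real and j assume t: "0 \<le> t"
    show "((\<lambda>x. S j x t) has_real_derivative S (Suc j) x t) (at x)"
      unfolding S_def
      by (rule has_field_derivative_series'(2)[of UNIV "\<lambda>k x. u j k x t" "\<lambda>k x. u (Suc j) k x t" 0])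
        (auto intro!: u_dx Weierstrass_m_test'[OF _ M_summable] u_bound[OF t, simplified] u_summable t)
  next
    fix t x :: real and j assume t: "0 \<le> t"
    have "\<exists>g. \<forall>t\<in>{0..}. (\<lambda>k. u j k x t) sums g t \<and> (g has_real_derivative S (j + 2) x t) (at t within {0..})"
      unfolding S_def
      by (rule has_field_derivative_series[where f = "\<lambda>k t. u j k x t" and f' = "\<lambda>k t. u (j + 2) k x t" and ?x0.0 = 0])
       (intro convex_real_interval u_dt Weierstrass_m_test[OF u_bound M_summable] u_summable | simp)+
    then obtain g where g: "\<And>t. t \<in> {0..} \<Longrightarrow> (\<lambda>k. u j k x t) sums g t"
      "\<And>t. t \<in> {0..} \<Longrightarrow> (g has_real_derivative S (j + 2) x t) (at t within {0..})" by blast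
    have "g s = S j x s" if "s \<in> {0..}" for s using g(1)[OF that] by (simp add: S_def sums_iff)
    then show "((\<lambda>t. S j x t) has_real_derivative S (j + 2) x t) (at t within {0..})"
      using g(2)[of t] t by (subst has_field_derivative_cong_eventually[symmetric, of g])
        (auto simp: eventually_at_filter)
  next
    fix t x :: real and j assume t: "0 \<le> t"
    have "u j k (- x) t = - ((- 1) ^ j) * u j k x t" for k
    proof -
      have "w k * (- x) + j * (pi / 2) = - ((w k * x + j * (pi / 2)) - j * pi)"
        by (simp add: field_simps)
      then have "sin (w k * (- x) + j * (pi / 2)) = - sin ((w k * x + j * (pi / 2)) - j * pi)"
        by (simp only: sin_minus)
      also have "\<dots> = - ((- 1) ^ j) * sin (w k * x + j * (pi / 2))"
        unfolding sin_diff by simp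
      finally show ?thesis by (simp add: u_def)
    qed
    then have "S j (- x) t = (\<Sum>k. - ((- 1) ^ j) * u j k x t)" by (simp add: S_def)
    also have "\<dots> = - ((- 1) ^ j) * S j x t" unfolding S_def by (rule suminf_mult[OF u_summable[OF t]])
    finally show "S j (- x) t = - ((- 1) ^ j * S j x t)" by simp
  next
    fix t x :: real and j
    have "u j k (x + 2) t = u j k x t" for k
    proof -
      have "sin (w k * (x + 2) + j * (pi / 2)) = sin ((w k * x + j * (pi / 2)) + 2 * real k * pi)"
        by (simp add: w_def algebra_simps)
      also have "\<dots> = sin (w k * x + j * (pi / 2))" by (simp add: sin_add)
      finally show ?thesis by (simp add: u_def)
    qed
    then show "S j (x + 2) t = S j x t" by (simp add: S_def)
  qed
  moreover have "S 0 x 0 = f x" if "x \<in> {0..1}" for x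
  proof -
    interpret heat_family S "\<lambda>j. suminf (M j)" by fact
    have "(f has_real_derivative deriv f x) (at x)" for x
      using f smooth_real_has_deriv[of f 0] by (auto simp: C0_infty_I_def)
    then have cf: "continuous_on {0..1} f"
      by (meson DERIV_continuous_on has_field_derivative_at_within)
    have cS: "continuous_on {0..1} (\<lambda>x. S 0 x 0)"
      using S_dx[of 0 0] by (meson DERIV_continuous_on has_field_derivative_at_within order_refl)
    have f01: "f 0 = 0" "f 1 = 0"
      using C0_infty_I_boundary[OF f, of 0] by auto
    have S01: "S 0 0 0 = 0" "S 0 1 0 = 0"
      using S_minus[of 0 0 0] S_minus[of 0 0 1] S_period[of 0 "-1" 0] by auto
    have "f x - S 0 x 0 = 0"
    proof (rule sine_orthogonal_imp_0[where g = "\<lambda>x. f x - S 0 x 0", OF _ _ _ _ that])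
      show "continuous_on {0..1} (\<lambda>x. f x - S 0 x 0)" by (intro continuous_intros cf cS)
      show "integral {0..1} (\<lambda>x. (f x - S 0 x 0) * sin (real m * pi * x)) = 0" for m :: nat
      proof (cases "m = 0")
        case False
        have u0: "u 0 k x 0 = b k * sin (k * pi * x)" for k x by (simp add: u_def w_def)
        \<comment> \<open>Uniform convergence permits integration term by term against the sine of
          frequency \<open>m\<close>, and only the term k = m survives.\<close>
        have ul: "uniform_limit {0..1} (\<lambda>n x. \<Sum>k<n. b k * (sin (k * pi * x) * sin (m * pi * x)))
           (\<lambda>x. \<Sum>k. b k * (sin (k * pi * x) * sin (m * pi * x))) sequentially"
        proof (rule Weierstrass_m_test[OF _ M_summable[of 0]])
          show "norm (b k * (sin (k * pi * x) * sin (m * pi * x))) \<le> M 0 k" for k x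
            using mult_mono[OF abs_sin_le_one abs_sin_le_one, of "m * pi * x" "k * pi * x"]
            by (auto simp: M_def abs_mult intro!: mult_left_le)
        qed
        obtain I J where IJ: "\<And>n. ((\<lambda>x. \<Sum>k<n. b k * (sin (k * pi * x) * sin (m * pi * x))) has_integral I n) {0..1}"
          "((\<lambda>x. \<Sum>k. b k * (sin (k * pi * x) * sin (m * pi * x))) has_integral J) {0..1}" "I \<longlonglongrightarrow> J"
          by (rule uniform_limit_integral[OF ul]) (auto intro!: continuous_intros)
        have "I n = b m / 2" if "n > m" for n
        proof -
          have "I n = integral {0..1} (\<lambda>x. \<Sum>k<n. b k * (sin (k * pi * x) * sin (m * pi * x)))"
            using IJ(1)[of n] by (simp add: integral_unique)
          also have "\<dots> = (\<Sum>k<n. b k * integral {0..1} (\<lambda>x. sin (k * pi * x) * sin (m * pi * x)))"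
            by (subst integral_sum) (auto intro!: integrable_continuous_real continuous_intros)
          also have "\<dots> = (\<Sum>k<n. if k = m then b m / 2 else 0)"
          proof (intro sum.cong refl)
            show "b k * integral {0..1} (\<lambda>x. sin (k * pi * x) * sin (m * pi * x)) = (if k = m then b m / 2 else 0)" for k
              using False by (cases "k = 0") (simp_all add: integral_sin_mult_sin b0)
          qed
          also have "\<dots> = b m / 2" using that by simp
          finally show ?thesis .
        qed
        then have "I \<longlonglongrightarrow> b m / 2"
          by (intro tendsto_eventually eventually_at_top_linorderI[of "Suc m"]) auto
        with IJ(3) have "J = b m / 2" using LIMSEQ_unique by blast
        moreover have "(\<Sum>k. b k * (sin (k * pi * x) * sin (m * pi * x))) = S 0 x 0 * sin (m * pi * x)" for x
          using suminf_mult2[OF u_summable[of 0 0 x], of "sin (m * pi * x)"] by (simp add: S_def u0 mult.assoc)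
        ultimately have "integral {0..1} (\<lambda>x. S 0 x 0 * sin (m * pi * x)) = b m / 2"
          using IJ(2) by (simp add: integral_unique)
        moreover have "integral {0..1} (\<lambda>x. f x * sin (m * pi * x)) = b m / 2" by (simp add: b_def w_def)
        moreover have "integral {0..1} (\<lambda>x. f x * sin (m * pi * x) - S 0 x 0 * sin (m * pi * x)) =
           integral {0..1} (\<lambda>x. f x * sin (m * pi * x)) - integral {0..1} (\<lambda>x. S 0 x 0 * sin (m * pi * x))"
          by (intro integral_diff integrable_continuous_real continuous_intros cf cS)
        ultimately show ?thesis by (simp add: left_diff_distrib)
      qed simp
    qed (use f01 S01 in auto)
    then show ?thesis by simp
  qed
  ultimately show ?thesis by blast
qed

section \<open>Uniqueness for the heat equation and the subsolution\<close>

text \<open>Subtracting e t forces w_t \<ge> e at an interior maximum with positive value. There w_x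
  = 0, and the derivative of \<open>wx\<close> equals w_t > 0, so \<open>wx\<close> is positive just
  to the right and \<open>w\<close> rises above its maximum. Only the derivative of
  \<open>wx\<close> is involved, no second-order expansion.\<close>

lemma heat_maximum_principle:
  fixes w wx wt :: "real \<times> real \<Rightarrow> real"
  assumes cont: "continuous_on ({0..1} \<times> {0..}) w"
    and wx: "\<And>x t. 0 < x \<Longrightarrow> x < 1 \<Longrightarrow> 0 < t \<Longrightarrow> ((\<lambda>y. w (y, t)) has_real_derivative wx (x, t)) (at x)"
    and wt: "\<And>x t. 0 < x \<Longrightarrow> x < 1 \<Longrightarrow> 0 < t \<Longrightarrow> ((\<lambda>s. w (x, s)) has_real_derivative wt (x, t)) (at t)"
    and wxx: "\<And>x t. 0 < x \<Longrightarrow> x < 1 \<Longrightarrow> 0 < t \<Longrightarrow> ((\<lambda>y. wx (y, t)) has_real_derivative wt (x, t)) (at x)"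
    and init: "\<And>x. x \<in> {0..1} \<Longrightarrow> w (x, 0) \<le> 0"
    and lateral: "\<And>t. 0 \<le> t \<Longrightarrow> w (0, t) \<le> 0" "\<And>t. 0 \<le> t \<Longrightarrow> w (1, t) \<le> 0"
    and "x \<in> {0..1}" "0 \<le> t"
  shows "w (x, t) \<le> 0"
proof -
  have "w (x, t) \<le> e * t" if "e > 0" for e
  proof (rule ccontr)
    assume pos: "\<not> w (x, t) \<le> e * t"
    define v where "v z = w z - e * snd z" for z
    have "continuous_on ({0..1} \<times> {0..t}) v"
      unfolding v_def by (intro continuous_intros continuous_on_subset[OF cont]) auto
    moreover have "compact ({0..1::real} \<times> {0..t})" by (intro compact_Times compact_Icc)
    moreover have "{0..1::real} \<times> {0..t} \<noteq> {}" using \<open>0 \<le> t\<close> by auto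
    ultimately obtain z0 where z0: "z0 \<in> {0..1} \<times> {0..t}" "\<And>z. z \<in> {0..1} \<times> {0..t} \<Longrightarrow> v z \<le> v z0"
      using continuous_attains_sup[of "{0..1} \<times> {0..t}" v] by blast
    obtain x0 t0 where z0_eq: "z0 = (x0, t0)" by fastforce
    have x0: "0 \<le> x0" "x0 \<le> 1" and t0: "0 \<le> t0" "t0 \<le> t" using z0(1) z0_eq by auto
    have "v (x, t) \<le> v (x0, t0)" using z0(2)[of "(x, t)"] assms(8,9) z0_eq by auto
    then have "0 < v (x0, t0)" using pos by (simp add: v_def)
    moreover have "v (x0, t0) \<le> w (x0, t0)" using t0 \<open>e > 0\<close> by (simp add: v_def)
    ultimately have "0 < w (x0, t0)" by simp
    have x0': "0 < x0" "x0 < 1" and t0': "0 < t0"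
      using init[of x0] lateral[of t0] \<open>0 < w (x0, t0)\<close> x0 t0 by (auto simp: less_le)
    \<comment> \<open>The maximum may lie at the final time, so it is compared with earlier times
      only.\<close>
    have "wt (x0, t0) \<ge> e"
    proof (rule ccontr)
      assume neg: "\<not> e \<le> wt (x0, t0)"
      have "((\<lambda>s. w (x0, s) - e * s) has_real_derivative wt (x0, t0) - e) (at t0)"
        by (auto intro!: derivative_eq_intros wt x0' t0')
      then obtain d where d: "d > 0" "\<And>h. 0 < h \<Longrightarrow> h < d \<Longrightarrow> w (x0, t0) - e * t0 < w (x0, t0 - h) - e * (t0 - h)"
        using DERIV_neg_dec_left[of "\<lambda>s. w (x0, s) - e * s" "wt (x0, t0) - e" t0] neg by auto
      define h where "h = min (d/2) t0"
      have h: "0 < h" "h < d" "h \<le> t0" using d t0' by (auto simp: h_def)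
      show False using d(2)[OF h(1,2)] z0(2)[of "(x0, t0 - h)"] h x0 t0 by (auto simp: z0_eq v_def)
    qed
    then have "wt (x0, t0) > 0" using \<open>e > 0\<close> by simp
    have le: "w (y, t0) \<le> w (x0, t0)" if "y \<in> {0..1}" for y
      using z0(2)[of "(y, t0)"] that t0 by (auto simp: z0_eq v_def)
    have "wx (x0, t0) = 0"
    proof (rule DERIV_local_max[OF wx[OF x0' t0']])
      show "0 < min x0 (1 - x0)" using x0' by auto
      show "\<forall>y. \<bar>x0 - y\<bar> < min x0 (1 - x0) \<longrightarrow> w (y, t0) \<le> w (x0, t0)"
        using le by (auto simp: abs_less_iff)
    qed
    then obtain d where d: "d > 0" "\<And>h. 0 < h \<Longrightarrow> h < d \<Longrightarrow> 0 < wx (x0 + h, t0)"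
      using DERIV_pos_inc_right[OF wxx[OF x0' t0'] \<open>wt (x0, t0) > 0\<close>] by auto
    define h where "h = min (d/2) ((1 - x0)/2)"
    have h: "0 < h" "h < d" "x0 + h < 1" using d x0' by (auto simp: h_def min_def field_simps)
    have "\<exists>z. x0 < z \<and> z < x0 + h \<and> w (x0 + h, t0) - w (x0, t0) = (x0 + h - x0) * wx (z, t0)"
      by (rule MVT2) (use h x0' t0' wx in auto)
    then obtain z where z: "x0 < z" "z < x0 + h" "w (x0 + h, t0) - w (x0, t0) = h * wx (z, t0)" by auto
    have "0 < h * wx (z, t0)" using d(2)[of "z - x0"] z h by (intro mult_pos_pos) auto
    with z(3) le[of "x0 + h"] h x0' show False by auto
  qed
  then have "w (x, t) \<le> 0 + e" if "e > 0" for e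
  proof -
    have "e / (t + 1) > 0" using that \<open>0 \<le> t\<close> by auto
    then have "w (x, t) \<le> e / (t + 1) * t" by fact
    also have "\<dots> \<le> e" using that \<open>0 \<le> t\<close> by (simp add: field_simps)
    finally show ?thesis by simp
  qed
  then show ?thesis by (rule field_le_epsilon)
qed

lemma lipschitz_of_deriv_bound:
  fixes f f' :: "real \<Rightarrow> real"
  assumes "convex X" and f: "\<And>x. x \<in> X \<Longrightarrow> (f has_real_derivative f' x) (at x within X)"
    and b: "\<And>x. x \<in> X \<Longrightarrow> \<bar>f' x\<bar> \<le> M" and "x \<in> X" "y \<in> X"
  shows "\<bar>f x - f y\<bar> \<le> M * \<bar>x - y\<bar>"
  using field_differentiable_bound[OF assms(1) f, of M x y] assms by simp

lemma first_order_expansion: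
  fixes f f' :: "real \<Rightarrow> real"
  assumes "convex X" and f: "\<And>x. x \<in> X \<Longrightarrow> (f has_real_derivative f' x) (at x within X)"
    and f': "\<And>x y. x \<in> X \<Longrightarrow> y \<in> X \<Longrightarrow> \<bar>f' x - f' y\<bar> \<le> K * \<bar>x - y\<bar>" and "x \<in> X" "y \<in> X" "0 \<le> K"
  shows "\<bar>f y - f x - (y - x) * f' x\<bar> \<le> K * (y - x)\<^sup>2"
proof -
  define Y where "Y = closed_segment x y"
  have Y: "Y \<subseteq> X" unfolding Y_def using assms by (simp add: closed_segment_subset)
  have "\<bar>(f y - y * f' x) - (f x - x * f' x)\<bar> \<le> (K * \<bar>y - x\<bar>) * \<bar>y - x\<bar>"
  proof (rule lipschitz_of_deriv_bound[where X = Y])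
    show "((\<lambda>z. f z - z * f' x) has_real_derivative f' z - f' x) (at z within Y)" if "z \<in> Y" for z
      using Y that by (auto intro!: derivative_eq_intros has_field_derivative_subset[OF f])
    show "\<bar>f' z - f' x\<bar> \<le> K * \<bar>y - x\<bar>" if "z \<in> Y" for z
    proof -
      have "\<bar>z - x\<bar> \<le> \<bar>y - x\<bar>" using that by (auto simp: Y_def closed_segment_eq_real_ivl split: if_splits)
      then have "K * \<bar>z - x\<bar> \<le> K * \<bar>y - x\<bar>" using \<open>0 \<le> K\<close> by (rule mult_left_mono)
      with f'[of z x] Y that \<open>x \<in> X\<close> show ?thesis by auto
    qed
  qed (auto simp: Y_def)
  then show ?thesis by (simp add: algebra_simps power2_eq_square flip: abs_mult)
qed

context heat_family
begin

lemma B_nonneg: "0 \<le> B j"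
  using S_bound[of 0 j 0] by simp

lemma S_lipschitz:
  assumes "0 \<le> t" "0 \<le> s"
  shows "\<bar>S j x t - S j y s\<bar> \<le> B (Suc j) * \<bar>x - y\<bar> + B (j + 2) * \<bar>t - s\<bar>"
proof -
  have "\<bar>S j x t - S j y t\<bar> \<le> B (Suc j) * \<bar>x - y\<bar>"
    by (rule lipschitz_of_deriv_bound[of UNIV _ "\<lambda>x. S (Suc j) x t"]) (use assms S_dx S_bound in auto)
  moreover have "\<bar>S j y t - S j y s\<bar> \<le> B (j + 2) * \<bar>t - s\<bar>"
    by (rule lipschitz_of_deriv_bound[of "{0..}" _ "\<lambda>t. S (j + 2) y t"])
      (use assms S_dt S_bound in \<open>auto simp: convex_real_interval\<close>)
  ultimately show ?thesis by linarith
qed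

lemma S_continuous: "continuous_on (UNIV \<times> {0..}) (\<lambda>z. S j (fst z) (snd z))"
proof -
  have "(B (Suc j) + B (j + 2))-lipschitz_on (UNIV \<times> {0..}) (\<lambda>z. S j (fst z) (snd z))"
  proof (rule lipschitz_onI)
    fix p q :: "real \<times> real" assume "p \<in> UNIV \<times> {0..}" "q \<in> UNIV \<times> {0..}"
    then have "\<bar>S j (fst p) (snd p) - S j (fst q) (snd q)\<bar> \<le> B (Suc j) * \<bar>fst p - fst q\<bar> + B (j + 2) * \<bar>snd p - snd q\<bar>"
      by (intro S_lipschitz) auto
    also have "\<dots> \<le> B (Suc j) * dist p q + B (j + 2) * dist p q"
      using dist_fst_le[of p q] dist_snd_le[of p q] by (intro add_mono mult_left_mono B_nonneg) (auto simp: dist_real_def)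
    finally show "dist (S j (fst p) (snd p)) (S j (fst q) (snd q)) \<le> (B (Suc j) + B (j + 2)) * dist p q"
      by (simp add: dist_real_def algebra_simps)
  qed (use B_nonneg in simp)
  then show ?thesis by (rule lipschitz_on_continuous_on)
qed

lemma S_dt_at: "0 < t \<Longrightarrow> ((\<lambda>t. S j x t) has_real_derivative S (j + 2) x t) (at t)"
  using S_dt[of t j x] at_within_interior[of t "{0..}"] by (simp add: interior_real_atLeast)

lemma S0_lateral: "0 \<le> t \<Longrightarrow> S 0 0 t = 0" "0 \<le> t \<Longrightarrow> S 0 1 t = 0"
  using S_minus[of t 0 0] S_minus[of t 0 1] S_period[of 0 "-1" t] by auto

lemma heat_solution_eq_S0:
  assumes sol: "heat_solution f rho" and init: "\<And>x. x \<in> {0..1} \<Longrightarrow> S 0 x 0 = f x"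
    and xt: "x \<in> {0..1}" "0 \<le> t"
  shows "rho (x, t) = S 0 x t"
proof -
  let ?S = "\<lambda>j z. S j (fst z) (snd z)"
  have cr: "continuous_on ({0..1} \<times> {0..}) rho" using sol by (simp add: heat_solution_def)
  have cS: "continuous_on ({0..1} \<times> {0..}) (?S 0)" by (rule continuous_on_subset[OF S_continuous]) auto
  have rx: "((\<lambda>y. rho (y, t)) has_real_derivative pdx rho (x, t)) (at x)"
    and rt: "((\<lambda>s. rho (x, s)) has_real_derivative pdt rho (x, t)) (at t)"
    and rxx: "((\<lambda>y. pdx rho (y, t)) has_real_derivative pdt rho (x, t)) (at x)"
    if "0 < x" "x < 1" "0 < t" for x t
    using sol that by (auto simp: heat_solution_def pdx_def pdt_def DERIV_deriv_iff_real_differentiable)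
  have Sdx: "((\<lambda>y. S 0 y t) has_real_derivative S 1 x t) (at x)"
      "((\<lambda>y. S 1 y t) has_real_derivative S 2 x t) (at x)"
    and Sdt: "((\<lambda>s. S 0 x s) has_real_derivative S 2 x t) (at t)" if "0 < t" for x t
    using S_dx[of t 0 x] S_dx[of t 1 x] S_dt_at[OF that, of 0 x] that by (auto simp: numeral_2_eq_2)
  have ic: "continuous_on ({0..1} \<times> {0..}) (\<lambda>z. rho z - ?S 0 z)"
      "continuous_on ({0..1} \<times> {0..}) (\<lambda>z. ?S 0 z - rho z)"
    by (intro continuous_intros cr cS)+
  have bd: "rho (x, 0) = S 0 x 0" if "x \<in> {0..1}" for x using sol init that by (simp add: heat_solution_def)
  have lat: "rho (0, t) = S 0 0 t" "rho (1, t) = S 0 1 t" if "0 \<le> t" for t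
    using sol that S0_lateral by (simp_all add: heat_solution_def)
  have "rho (x, t) - ?S 0 (x, t) \<le> 0"
  proof (rule heat_maximum_principle[of "\<lambda>z. rho z - ?S 0 z" "\<lambda>z. pdx rho z - ?S 1 z" "\<lambda>z. pdt rho z - ?S 2 z"])
    fix x t :: real assume a: "0 < x" "x < 1" "0 < t"
    show "((\<lambda>y. rho (y, t) - ?S 0 (y, t)) has_real_derivative pdx rho (x, t) - ?S 1 (x, t)) (at x)"
      "((\<lambda>s. rho (x, s) - ?S 0 (x, s)) has_real_derivative pdt rho (x, t) - ?S 2 (x, t)) (at t)"
      "((\<lambda>y. pdx rho (y, t) - ?S 1 (y, t)) has_real_derivative pdt rho (x, t) - ?S 2 (x, t)) (at x)"
      using DERIV_diff[OF rx[OF a] Sdx(1)[OF a(3)]] DERIV_diff[OF rt[OF a] Sdt[OF a(3)]]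
        DERIV_diff[OF rxx[OF a] Sdx(2)[OF a(3)]] by simp_all
  qed (use xt bd lat in \<open>simp_all add: ic\<close>)
  moreover have "?S 0 (x, t) - rho (x, t) \<le> 0"
  proof (rule heat_maximum_principle[of "\<lambda>z. ?S 0 z - rho z" "\<lambda>z. ?S 1 z - pdx rho z" "\<lambda>z. ?S 2 z - pdt rho z"])
    fix x t :: real assume a: "0 < x" "x < 1" "0 < t"
    show "((\<lambda>y. ?S 0 (y, t) - rho (y, t)) has_real_derivative ?S 1 (x, t) - pdx rho (x, t)) (at x)"
      "((\<lambda>s. ?S 0 (x, s) - rho (x, s)) has_real_derivative ?S 2 (x, t) - pdt rho (x, t)) (at t)"
      "((\<lambda>y. ?S 1 (y, t) - pdx rho (y, t)) has_real_derivative ?S 2 (x, t) - pdt rho (x, t)) (at x)"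
      using DERIV_diff[OF Sdx(1)[OF a(3)] rx[OF a]] DERIV_diff[OF Sdt[OF a(3)] rt[OF a]]
        DERIV_diff[OF Sdx(2)[OF a(3)] rxx[OF a]] by simp_all
  qed (use xt bd lat in \<open>simp_all add: ic\<close>)
  ultimately show ?thesis by simp
qed

lemma heat_solution_derivatives:
  assumes sol: "heat_solution f rho" and init: "\<And>x. x \<in> {0..1} \<Longrightarrow> S 0 x 0 = f x"
    and x: "0 < x" "x < 1" and t: "0 < t"
  shows "pdx rho (x, t) = S 1 x t" "pdt rho (x, t) = S 2 x t"
proof -
  have "((\<lambda>y. rho (y, t)) has_real_derivative S 1 x t) (at x)"
    by (rule has_field_derivative_transform_within_open[of "\<lambda>y. S 0 y t" _ _ "{0<..<1}"])
      (use S_dx[of t 0 x] heat_solution_eq_S0[OF sol init] x t in auto)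
  then show "pdx rho (x, t) = S 1 x t" by (simp add: pdx_def DERIV_imp_deriv)
  have "((\<lambda>s. rho (x, s)) has_real_derivative S 2 x t) (at t)"
    by (rule has_field_derivative_transform_within_open[of "\<lambda>s. S 0 x s" _ _ "{0<..}"])
      (use S_dt_at[of t 0 x] heat_solution_eq_S0[OF sol init] x t in \<open>auto simp: numeral_2_eq_2\<close>)
  then show "pdt rho (x, t) = S 2 x t" by (simp add: pdt_def DERIV_imp_deriv)
qed

end

section \<open>Bounded Lipschitz functions on a time strip\<close>

definition blip :: "real \<Rightarrow> (real \<Rightarrow> real \<Rightarrow> real) \<Rightarrow> bool" where
  "blip T F \<longleftrightarrow> (\<exists>M\<ge>0. \<forall>x y. \<forall>t\<in>{0..T}. \<forall>s\<in>{0..T}.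
     \<bar>F x t\<bar> \<le> M \<and> \<bar>F x t - F y s\<bar> \<le> M * (\<bar>x - y\<bar> + \<bar>t - s\<bar>))"

lemma blipI:
  assumes "\<And>x t. t \<in> {0..T} \<Longrightarrow> \<bar>F x t\<bar> \<le> M1"
    "\<And>x y t s. t \<in> {0..T} \<Longrightarrow> s \<in> {0..T} \<Longrightarrow> \<bar>F x t - F y s\<bar> \<le> M2 * (\<bar>x - y\<bar> + \<bar>t - s\<bar>)"
  shows "blip T F"
proof -
  define M where "M = \<bar>M1\<bar> + \<bar>M2\<bar>"
  have "\<bar>F x t\<bar> \<le> M \<and> \<bar>F x t - F y s\<bar> \<le> M * (\<bar>x - y\<bar> + \<bar>t - s\<bar>)"
    if "t \<in> {0..T}" "s \<in> {0..T}" for x y t s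
  proof
    show "\<bar>F x t\<bar> \<le> M" using assms(1)[OF that(1), of x] by (simp add: M_def)
    have "M2 * (\<bar>x - y\<bar> + \<bar>t - s\<bar>) \<le> M * (\<bar>x - y\<bar> + \<bar>t - s\<bar>)" by (intro mult_right_mono) (auto simp: M_def)
    then show "\<bar>F x t - F y s\<bar> \<le> M * (\<bar>x - y\<bar> + \<bar>t - s\<bar>)" using assms(2)[OF that, of x y] by linarith
  qed
  then show ?thesis unfolding blip_def by (intro exI[of _ M]) (auto simp: M_def)
qed

lemma blipE:
  assumes "blip T F"
  obtains M where "0 \<le> M" "\<And>x t. t \<in> {0..T} \<Longrightarrow> \<bar>F x t\<bar> \<le> M"
    "\<And>x y t s. t \<in> {0..T} \<Longrightarrow> s \<in> {0..T} \<Longrightarrow> \<bar>F x t - F y s\<bar> \<le> M * (\<bar>x - y\<bar> + \<bar>t - s\<bar>)"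
  using assms unfolding blip_def by blast

lemma blip_const: "blip T (\<lambda>x t. c)"
  by (rule blipI[of _ _ "\<bar>c\<bar>" 0]) auto

lemma blip_time: "blip T (\<lambda>x t. t)"
  by (rule blipI[of _ _ T 1]) auto

lemma blip_add:
  assumes "blip T F" "blip T G"
  shows "blip T (\<lambda>x t. F x t + G x t)"
proof -
  from assms obtain M N where M: "0 \<le> M" "\<And>x t. t \<in> {0..T} \<Longrightarrow> \<bar>F x t\<bar> \<le> M"
    "\<And>x y t s. t \<in> {0..T} \<Longrightarrow> s \<in> {0..T} \<Longrightarrow> \<bar>F x t - F y s\<bar> \<le> M * (\<bar>x - y\<bar> + \<bar>t - s\<bar>)"
    and N: "0 \<le> N" "\<And>x t. t \<in> {0..T} \<Longrightarrow> \<bar>G x t\<bar> \<le> N"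
    "\<And>x y t s. t \<in> {0..T} \<Longrightarrow> s \<in> {0..T} \<Longrightarrow> \<bar>G x t - G y s\<bar> \<le> N * (\<bar>x - y\<bar> + \<bar>t - s\<bar>)"
    by (elim blipE) blast
  show ?thesis
  proof (rule blipI[of _ _ "M + N" "M + N"])
    fix x y t s assume "t \<in> {0..T}" "s \<in> {0..T}"
    then show "\<bar>F x t + G x t - (F y s + G y s)\<bar> \<le> (M + N) * (\<bar>x - y\<bar> + \<bar>t - s\<bar>)"
      using M(3)[of t s x y] N(3)[of t s x y] unfolding distrib_right by linarith
  next
    fix x t assume "t \<in> {0..T}"
    then show "\<bar>F x t + G x t\<bar> \<le> M + N" using M(2)[of t x] N(2)[of t x] by linarith
  qed
qed

lemma blip_mult:
  assumes "blip T F" "blip T G"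
  shows "blip T (\<lambda>x t. F x t * G x t)"
proof -
  from assms obtain M N where M: "0 \<le> M" "\<And>x t. t \<in> {0..T} \<Longrightarrow> \<bar>F x t\<bar> \<le> M"
    "\<And>x y t s. t \<in> {0..T} \<Longrightarrow> s \<in> {0..T} \<Longrightarrow> \<bar>F x t - F y s\<bar> \<le> M * (\<bar>x - y\<bar> + \<bar>t - s\<bar>)"
    and N: "0 \<le> N" "\<And>x t. t \<in> {0..T} \<Longrightarrow> \<bar>G x t\<bar> \<le> N"
    "\<And>x y t s. t \<in> {0..T} \<Longrightarrow> s \<in> {0..T} \<Longrightarrow> \<bar>G x t - G y s\<bar> \<le> N * (\<bar>x - y\<bar> + \<bar>t - s\<bar>)"
    by (elim blipE) blast
  show ?thesis
  proof (rule blipI[of _ _ "M * N" "2 * (M * N)"])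
    fix x y t s assume ts: "t \<in> {0..T}" "s \<in> {0..T}"
    have "F x t * G x t - F y s * G y s = F x t * (G x t - G y s) + (F x t - F y s) * G y s"
      by (simp add: algebra_simps)
    also have "\<bar>\<dots>\<bar> \<le> \<bar>F x t\<bar> * \<bar>G x t - G y s\<bar> + \<bar>F x t - F y s\<bar> * \<bar>G y s\<bar>"
      by (metis abs_mult abs_triangle_ineq)
    also have "\<dots> \<le> M * (N * (\<bar>x - y\<bar> + \<bar>t - s\<bar>)) + M * (\<bar>x - y\<bar> + \<bar>t - s\<bar>) * N"
      using M(1) M(2)[OF ts(1), of x] M(3)[OF ts, of x y] N(2)[OF ts(2), of y] N(3)[OF ts, of x y]
      by (intro add_mono mult_mono) auto
    also have "\<dots> = 2 * (M * N) * (\<bar>x - y\<bar> + \<bar>t - s\<bar>)" by (simp add: algebra_simps)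
    finally show "\<bar>F x t * G x t - F y s * G y s\<bar> \<le> 2 * (M * N) * (\<bar>x - y\<bar> + \<bar>t - s\<bar>)" .
  next
    fix x t assume t: "t \<in> {0..T}"
    then show "\<bar>F x t * G x t\<bar> \<le> M * N" unfolding abs_mult using M(1) M(2)[OF t] N(2)[OF t] by (intro mult_mono) auto
  qed
qed

lemma blip_minus: "blip T F \<Longrightarrow> blip T (\<lambda>x t. - F x t)"
  using blip_mult[OF blip_const[of _ "-1"]] by simp

lemma blip_diff: "blip T F \<Longrightarrow> blip T G \<Longrightarrow> blip T (\<lambda>x t. F x t - G x t)"
  using blip_add[OF _ blip_minus] by simp

lemma blip_power: "blip T F \<Longrightarrow> blip T (\<lambda>x t. F x t ^ n)"
  by (induction n) (auto intro: blip_const blip_mult)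

lemma blip_inverse:
  assumes "blip T F" "c > 0" and c: "\<And>x t. t \<in> {0..T} \<Longrightarrow> c \<le> F x t"
  shows "blip T (\<lambda>x t. inverse (F x t))"
proof -
  from assms(1) obtain M where M: "0 \<le> M"
    "\<And>x y t s. t \<in> {0..T} \<Longrightarrow> s \<in> {0..T} \<Longrightarrow> \<bar>F x t - F y s\<bar> \<le> M * (\<bar>x - y\<bar> + \<bar>t - s\<bar>)"
    by (elim blipE) blast
  show ?thesis
  proof (rule blipI[of _ _ "inverse c" "M / c\<^sup>2"])
    fix x y t s assume ts: "t \<in> {0..T}" "s \<in> {0..T}"
    have pos: "0 < F x t" "0 < F y s" "c * c \<le> F x t * F y s" 
      using c[OF ts(1), of x] c[OF ts(2), of y] \<open>c > 0\<close> by (auto intro: mult_mono)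
    have "\<bar>inverse (F x t) - inverse (F y s)\<bar> = \<bar>F y s - F x t\<bar> / (F x t * F y s)"
      using pos by (simp add: field_simps abs_divide abs_mult)
    also have "\<dots> \<le> M * (\<bar>x - y\<bar> + \<bar>t - s\<bar>) / c\<^sup>2"
      using M(2)[OF ts, of x y] pos \<open>c > 0\<close> \<open>0 \<le> M\<close>
      by (intro frac_le) (auto simp: power2_eq_square abs_minus_commute)
    finally show "\<bar>inverse (F x t) - inverse (F y s)\<bar> \<le> M / c\<^sup>2 * (\<bar>x - y\<bar> + \<bar>t - s\<bar>)" by simp
  next
    fix x t assume t: "t \<in> {0..T}"
    then show "\<bar>inverse (F x t)\<bar> \<le> inverse c" using c[OF t, of x] \<open>c > 0\<close> by (simp add: le_imp_inverse_le)
  qed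
qed

lemma blip_sqrt:
  assumes "blip T F" "c > 0" and c: "\<And>x t. t \<in> {0..T} \<Longrightarrow> c\<^sup>2 \<le> F x t"
  shows "blip T (\<lambda>x t. sqrt (F x t))"
proof -
  from assms(1) obtain M where M: "0 \<le> M" "\<And>x t. t \<in> {0..T} \<Longrightarrow> \<bar>F x t\<bar> \<le> M"
    "\<And>x y t s. t \<in> {0..T} \<Longrightarrow> s \<in> {0..T} \<Longrightarrow> \<bar>F x t - F y s\<bar> \<le> M * (\<bar>x - y\<bar> + \<bar>t - s\<bar>)"
    by (elim blipE) blast
  show ?thesis
  proof (rule blipI[of _ _ "sqrt M" "M / c"])
    fix x y t s assume ts: "t \<in> {0..T}" "s \<in> {0..T}"
    have sq: "c \<le> sqrt (F x t)" "c \<le> sqrt (F y s)" using c[OF ts(1)] c[OF ts(2)] by (auto intro: real_le_rsqrt)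
    have nn: "0 \<le> F x t" "0 \<le> F y s" using c[OF ts(1), of x] c[OF ts(2), of y] by (meson order_trans zero_le_power2)+
    have "(sqrt (F x t) - sqrt (F y s)) * (sqrt (F x t) + sqrt (F y s)) = F x t - F y s"
      using nn by (simp add: algebra_simps)
    then have "\<bar>sqrt (F x t) - sqrt (F y s)\<bar> * (sqrt (F x t) + sqrt (F y s)) = \<bar>F x t - F y s\<bar>"
      using sq \<open>c > 0\<close> by (metis abs_mult abs_of_pos add_pos_pos less_le_trans)
    moreover have "\<bar>sqrt (F x t) - sqrt (F y s)\<bar> * c \<le> \<bar>sqrt (F x t) - sqrt (F y s)\<bar> * (sqrt (F x t) + sqrt (F y s))"
      using sq \<open>c > 0\<close> by (intro mult_left_mono) auto
    ultimately have "\<bar>sqrt (F x t) - sqrt (F y s)\<bar> * c \<le> M * (\<bar>x - y\<bar> + \<bar>t - s\<bar>)" using M(3)[OF ts, of x y] by linarith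
    then show "\<bar>sqrt (F x t) - sqrt (F y s)\<bar> \<le> M / c * (\<bar>x - y\<bar> + \<bar>t - s\<bar>)" using \<open>c > 0\<close> by (simp add: field_simps)
  next
    fix x t assume t: "t \<in> {0..T}"
    then have "0 \<le> F x t" using c[OF t, of x] by (meson order_trans zero_le_power2)
    with M(2)[OF t, of x] show "\<bar>sqrt (F x t)\<bar> \<le> sqrt M" by simp
  qed
qed

section \<open>The discrete step and its subsolution\<close>

context heat_family
begin

lemma blip_S: "blip T (S j)"
proof (rule blipI[of _ _ "B j" "B (Suc j) + B (j + 2)"])
  fix x y t s assume "t \<in> {0..T}" "s \<in> {0..T}"
  then have "\<bar>S j x t - S j y s\<bar> \<le> B (Suc j) * \<bar>x - y\<bar> + B (j + 2) * \<bar>t - s\<bar>" by (intro S_lipschitz) auto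
  also have "\<dots> \<le> (B (Suc j) + B (j + 2)) * (\<bar>x - y\<bar> + \<bar>t - s\<bar>)"
    using B_nonneg[of "Suc j"] B_nonneg[of "j + 2"] by (simp add: algebra_simps)
  finally show "\<bar>S j x t - S j y s\<bar> \<le> (B (Suc j) + B (j + 2)) * (\<bar>x - y\<bar> + \<bar>t - s\<bar>)" .
qed (use S_bound in auto)

definition G :: "real \<Rightarrow> real \<Rightarrow> real" where "G x t = S 1 x t * S 2 x t"

text \<open>The added 1 makes A \<ge> 1, so that the mesh condition with g \<le> 1 yields tau \<le>
  h.\<close>

definition A :: real where "A = B 1 * B 2 + 1"

text \<open>The terms are grouped by neighbour: each bracket depends on one value of
  \<open>u\<close> only, and comparison is carried out bracket by bracket.\<close>

definition lf_step :: "real \<Rightarrow> real \<Rightarrow> real \<Rightarrow> (real \<Rightarrow> real) \<Rightarrow> real \<Rightarrow> real" where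
  "lf_step h tau t u x = (u (x + h) / 2 + tau / (2 * h) * (G (x + h) t / u (x + h)))
     + (u (x - h) / 2 - tau / (2 * h) * (G (x - h) t / u (x - h)))"

text \<open>A smoothed absolute value of \<open>rho_x\<close>. The decrease of g^2 (1 + T - t) in
  time produces the strictness; the 1 keeps W \<ge> g up to t = T.\<close>

definition W :: "real \<Rightarrow> real \<Rightarrow> real \<Rightarrow> real \<Rightarrow> real" where
  "W T g x t = sqrt (g\<^sup>2 * (1 + T - t) + (S 1 x t)\<^sup>2)"

lemma A_ge_1: "1 \<le> A"
  using B_nonneg[of 1] B_nonneg[of 2] by (simp add: A_def)

lemma G_bound: "0 \<le> t \<Longrightarrow> \<bar>G x t\<bar> \<le> A"
proof -
  assume "0 \<le> t"
  then have "\<bar>G x t\<bar> \<le> B 1 * B 2"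
    unfolding G_def abs_mult by (intro mult_mono S_bound B_nonneg) auto
  then show ?thesis by (simp add: A_def)
qed

lemma W_ge:
  assumes "t \<in> {0..T}" "0 < g"
  shows "g \<le> W T g x t" "\<bar>S 1 x t\<bar> \<le> W T g x t"
    "g\<^sup>2 \<le> g\<^sup>2 * (1 + T - t) + (S 1 x t)\<^sup>2"
    "(W T g x t)\<^sup>2 = g\<^sup>2 * (1 + T - t) + (S 1 x t)\<^sup>2"
proof -
  have 1: "g\<^sup>2 * 1 \<le> g\<^sup>2 * (1 + T - t)" using assms by (intro mult_left_mono) auto
  have 2: "0 \<le> (S 1 x t)\<^sup>2" "0 \<le> g\<^sup>2" by simp_all
  show 3: "g\<^sup>2 \<le> g\<^sup>2 * (1 + T - t) + (S 1 x t)\<^sup>2" using 1 2 by linarith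
  then show "g \<le> W T g x t" unfolding W_def by (rule real_le_rsqrt)
  have "(S 1 x t)\<^sup>2 \<le> g\<^sup>2 * (1 + T - t) + (S 1 x t)\<^sup>2" using 1 2 by linarith
  then show "\<bar>S 1 x t\<bar> \<le> W T g x t" unfolding W_def by (intro real_le_rsqrt) simp
  show "(W T g x t)\<^sup>2 = g\<^sup>2 * (1 + T - t) + (S 1 x t)\<^sup>2"
    unfolding W_def using 3 2 by (intro real_sqrt_pow2) linarith
qed

text \<open>\<open>W\<close> is a strict subsolution of \<open>u\<^sub>t = (G / u)\<^sub>x\<close>, because \<open>G / W = W\<^sub>x\<close> and
  \<open>W\<^sub>x\<^sub>x - W\<^sub>t \<ge> g\<^sup>2 / (2 W)\<close>; the slack absorbs the consistency error of the scheme.\<close>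
lemma W_discrete_subsolution:
  assumes "0 < g" "g \<le> 1" "0 < T"
  shows "\<exists>h0>0. \<forall>h tau x t. 0 < h \<and> h \<le> h0 \<and> 2 * A * tau = g\<^sup>2 * h \<and> 0 \<le> t \<and> t + tau \<le> T \<longrightarrow>
     W T g x (t + tau) \<le> lf_step h tau t (\<lambda>x. W T g x t) x"
proof -
  let ?W = "W T g"
  define Wx where "Wx x t = S 1 x t * S 2 x t * inverse (?W x t)" for x t
  define Wxx where "Wxx x t = ((S 2 x t)\<^sup>2 + S 1 x t * S 3 x t) * inverse (?W x t)
     - (S 1 x t * S 2 x t)\<^sup>2 * inverse (?W x t) ^ 3" for x t
  define Wt where "Wt x t = (S 1 x t * S 3 x t - g\<^sup>2 / 2) * inverse (?W x t)" for x t
  \<comment> \<open>The closure properties of \<open>blip\<close> give Lipschitz constants of the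
    derivatives of \<open>W\<close> without computing them; they may depend on \<open>g\<close>,
    through the lower bound W \<ge> g that makes root and inverse admissible.\<close>
  have bW: "blip T ?W" unfolding W_def
    by (rule blip_sqrt[of _ _ g]) 
      (use assms W_ge(3) in \<open>auto intro!: blip_add blip_mult blip_diff blip_const blip_time blip_power blip_S\<close>)
  have bi: "blip T (\<lambda>x t. inverse (?W x t))" by (rule blip_inverse[OF bW \<open>0 < g\<close>]) (use W_ge assms in auto)
  have bWx: "blip T Wx" unfolding Wx_def by (intro blip_mult blip_S bi)
  have bWxx: "blip T Wxx" unfolding Wxx_def by (intro blip_mult blip_S bi blip_add blip_diff blip_power)
  have bWt: "blip T Wt" unfolding Wt_def by (intro blip_mult blip_S bi blip_diff blip_const)
  obtain K1 where K1: "0 \<le> K1" "\<And>x t. t \<in> {0..T} \<Longrightarrow> \<bar>?W x t\<bar> \<le> K1" using bW by (elim blipE) blast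
  obtain K2 where K2: "0 \<le> K2" "\<And>x y t s. t \<in> {0..T} \<Longrightarrow> s \<in> {0..T} \<Longrightarrow> \<bar>Wx x t - Wx y s\<bar> \<le> K2 * (\<bar>x - y\<bar> + \<bar>t - s\<bar>)"
    using bWx by (elim blipE) blast
  obtain K3 where K3: "0 \<le> K3" "\<And>x y t s. t \<in> {0..T} \<Longrightarrow> s \<in> {0..T} \<Longrightarrow> \<bar>Wxx x t - Wxx y s\<bar> \<le> K3 * (\<bar>x - y\<bar> + \<bar>t - s\<bar>)"
    using bWxx by (elim blipE) blast
  obtain K4 where K4: "0 \<le> K4" "\<And>x y t s. t \<in> {0..T} \<Longrightarrow> s \<in> {0..T} \<Longrightarrow> \<bar>Wt x t - Wt y s\<bar> \<le> K4 * (\<bar>x - y\<bar> + \<bar>t - s\<bar>)"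
    using bWt by (elim blipE) blast
  have Wpos: "0 < ?W x t" if "t \<in> {0..T}" for x t using W_ge(1)[OF that \<open>0 < g\<close>, of x] \<open>0 < g\<close> by linarith
  have arg_pos: "0 < g\<^sup>2 * (1 + T - t) + (S 1 x t)\<^sup>2" if "t \<in> {0..T}" for x t
    using W_ge(3)[OF that \<open>0 < g\<close>, of x] \<open>0 < g\<close> by (meson less_le_trans zero_less_power)
  have dx: "((\<lambda>x. ?W x t) has_real_derivative Wx x t) (at x)" if "t \<in> {0..T}" for x t
  proof -
    have "((\<lambda>x. sqrt (g\<^sup>2 * (1 + T - t) + (S 1 x t)\<^sup>2)) has_real_derivative
       (2 * S 1 x t * S 2 x t) * (inverse (sqrt (g\<^sup>2 * (1 + T - t) + (S 1 x t)\<^sup>2)) / 2)) (at x)"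
      using arg_pos[OF that, of x] that S_dx[of t 1 x]
      by (auto intro!: derivative_eq_intros simp: numeral_2_eq_2)
    then show ?thesis by (simp add: Wx_def W_def mult.assoc)
  qed
  have dxx: "((\<lambda>x. Wx x t) has_real_derivative Wxx x t) (at x)" if "t \<in> {0..T}" for x t
  proof -
    have d: "((\<lambda>x. S 1 x t) has_real_derivative S 2 x t) (at x)" "((\<lambda>x. S 2 x t) has_real_derivative S 3 x t) (at x)"
      using that S_dx[of t 1 x] S_dx[of t 2 x] by (auto simp: numeral_2_eq_2 numeral_3_eq_3)
    have "((\<lambda>x. S 1 x t * S 2 x t * inverse (?W x t)) has_real_derivative
       (S 2 x t * S 2 x t + S 1 x t * S 3 x t) * inverse (?W x t)
        + S 1 x t * S 2 x t * (- (inverse (?W x t) * Wx x t * inverse (?W x t)))) (at x)"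
      using Wpos[OF that, of x] by (auto intro!: derivative_eq_intros d[unfolded One_nat_def] dx that simp: algebra_simps)
    then show ?thesis
      by (simp add: Wx_def[abs_def] Wxx_def power2_eq_square power3_eq_cube algebra_simps)
  qed
  have dt: "((\<lambda>t. ?W x t) has_real_derivative Wt x t) (at t within {0..T})" if "t \<in> {0..T}" for x t
  proof -
    have "((\<lambda>t. S 1 x t) has_real_derivative S 3 x t) (at t within {0..T})"
      using that has_field_derivative_subset[OF S_dt[of t 1 x], of "{0..T}"] by (auto simp: numeral_3_eq_3)
    then have "((\<lambda>t. sqrt (g\<^sup>2 * (1 + T - t) + (S 1 x t)\<^sup>2)) has_real_derivative
       (2 * S 1 x t * S 3 x t - g\<^sup>2) * (inverse (sqrt (g\<^sup>2 * (1 + T - t) + (S 1 x t)\<^sup>2)) / 2)) (at t within {0..T})"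
      using arg_pos[OF that, of x]
      by (auto intro!: derivative_eq_intros)
    then show ?thesis unfolding Wt_def W_def by (rule DERIV_cong) (simp add: field_simps)
  qed
  \<comment> \<open>Since \<open>rho_x\<close> solves the heat equation, the terms with
    \<open>S 3\<close> cancel in W_xx - W_t. Beyond g^2 / (2 W) there remains (S 2)^2 (W^2 - (S
    1)^2) / W^3, which is nonnegative because W dominates |S 1|.\<close>
  have slack: "g\<^sup>2 / 2 * inverse (K1 + 1) \<le> Wxx x t - Wt x t" if "t \<in> {0..T}" for x t
  proof -
    let ?w = "?W x t"
    have w: "0 < ?w" "?w \<le> K1 + 1" using Wpos[OF that, of x] K1(2)[OF that, of x] by auto
    have sq: "(S 1 x t)\<^sup>2 \<le> ?w\<^sup>2" using W_ge(2)[OF that \<open>0 < g\<close>, of x] w(1) by (metis abs_le_square_iff abs_of_pos)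
    have "(Wxx x t - Wt x t) - g\<^sup>2 / 2 * inverse ?w = (S 2 x t)\<^sup>2 * (?w\<^sup>2 - (S 1 x t)\<^sup>2) * inverse ?w ^ 3"
      using w(1) unfolding Wxx_def Wt_def by (simp add: field_simps power2_eq_square power3_eq_cube)
    also have "\<dots> \<ge> 0" using w(1) sq by (intro mult_nonneg_nonneg) auto
    finally have "g\<^sup>2 / 2 * inverse ?w \<le> Wxx x t - Wt x t" by simp
    moreover have "g\<^sup>2 / 2 * inverse (K1 + 1) \<le> g\<^sup>2 / 2 * inverse ?w"
      using w by (intro mult_left_mono le_imp_inverse_le) auto
    ultimately show ?thesis by (rule order_trans[rotated])
  qed
  define K where "K = K2 + K3 + K4 + 1"
  have K: "0 < K" "K2 \<le> K" "K3 \<le> K" "K4 \<le> K" using K2 K3 K4 by (auto simp: K_def)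
  define c where "c = g\<^sup>2 / 2 * inverse (K1 + 1)"
  have "0 < c" using \<open>0 < g\<close> K1 by (simp add: c_def)
  \<comment> \<open>The remainders sum to K (tau h + h^2 + tau^2). By the mesh condition h^2 is tau
    times (2 A / g^2) h, and tau \<le> h, so everything is at most tau K (2 A / g^2 + 2) h, which
    this choice keeps below the slack tau c.\<close>
  define h0 where "h0 = c / (K * (2 * A / g\<^sup>2 + 2))"
  have den: "0 < K * (2 * A / g\<^sup>2 + 2)" using K A_ge_1 \<open>0 < g\<close> by (intro mult_pos_pos add_nonneg_pos) auto
  show ?thesis
  proof (intro exI[of _ h0] conjI allI impI)
    show "0 < h0" using \<open>0 < c\<close> den by (simp add: h0_def)
    fix h tau x t :: real
    assume "0 < h \<and> h \<le> h0 \<and> 2 * A * tau = g\<^sup>2 * h \<and> 0 \<le> t \<and> t + tau \<le> T"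
    then have h: "0 < h" "h \<le> h0" and tau: "2 * A * tau = g\<^sup>2 * h" and t: "0 \<le> t" "t + tau \<le> T" by auto
    have "0 < 2 * A * tau" using h \<open>0 < g\<close> tau by simp
    then have "0 < tau" using A_ge_1 by (simp add: zero_less_mult_iff)
    have "tau \<le> h"
    proof -
      have "1 * tau \<le> 2 * A * tau" using A_ge_1 \<open>0 < tau\<close> by (intro mult_right_mono) auto
      also have "\<dots> \<le> 1 * h" unfolding tau using \<open>g \<le> 1\<close> \<open>0 < g\<close> h by (intro mult_right_mono) (auto simp: power_le_one)
      finally show ?thesis by simp
    qed
    have tT: "t \<in> {0..T}" "t + tau \<in> {0..T}" using t \<open>0 < tau\<close> by auto
    have e1: "\<bar>?W (x + s) t - ?W x t - s * Wx x t\<bar> \<le> K * h\<^sup>2" if "s\<^sup>2 = h\<^sup>2" for s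
    proof -
      have "\<bar>?W (x + s) t - ?W x t - (x + s - x) * Wx x t\<bar> \<le> K2 * (x + s - x)\<^sup>2"
      proof (rule first_order_expansion[of UNIV])
        show "\<bar>Wx y t - Wx z t\<bar> \<le> K2 * \<bar>y - z\<bar>" for y z using K2(2)[OF tT(1) tT(1), of y z] by simp
      qed (use dx[OF tT(1)] K2(1) in simp_all)
      also have "\<dots> \<le> K * h\<^sup>2" using K that by (auto intro!: mult_right_mono)
      finally show ?thesis by simp
    qed
    have e2: "\<bar>Wx (x + s) t - Wx x t - s * Wxx x t\<bar> \<le> K * h\<^sup>2" if "s\<^sup>2 = h\<^sup>2" for s
    proof -
      have "\<bar>Wx (x + s) t - Wx x t - (x + s - x) * Wxx x t\<bar> \<le> K3 * (x + s - x)\<^sup>2"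
      proof (rule first_order_expansion[of UNIV])
        show "\<bar>Wxx y t - Wxx z t\<bar> \<le> K3 * \<bar>y - z\<bar>" for y z using K3(2)[OF tT(1) tT(1), of y z] by simp
      qed (use dxx[OF tT(1)] K3(1) in simp_all)
      also have "\<dots> \<le> K * h\<^sup>2" using K that by (auto intro!: mult_right_mono)
      finally show ?thesis by simp
    qed
    have e3: "\<bar>?W x (t + tau) - ?W x t - tau * Wt x t\<bar> \<le> K * tau\<^sup>2"
    proof -
      have "\<bar>?W x (t + tau) - ?W x t - (t + tau - t) * Wt x t\<bar> \<le> K4 * (t + tau - t)\<^sup>2"
      proof (rule first_order_expansion[of "{0..T}"])
        show "\<bar>Wt x s - Wt x s'\<bar> \<le> K4 * \<bar>s - s'\<bar>" if "s \<in> {0..T}" "s' \<in> {0..T}" for s s'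
          using K4(2)[OF that, of x x] by simp
      qed (use dt tT K4 in auto)
      also have "\<dots> \<le> K * tau\<^sup>2" using K by (auto intro!: mult_right_mono)
      finally show ?thesis by simp
    qed
    have GW: "G y t / ?W y t = Wx y t" for y by (simp add: G_def Wx_def divide_inverse)
    have f1: "?W x t - K * h\<^sup>2 \<le> (?W (x + h) t + ?W (x - h) t) / 2"
      using e1[of h] e1[of "-h"] by (simp add: abs_le_iff)
    have "2 * h * Wxx x t - 2 * (K * h\<^sup>2) \<le> Wx (x + h) t - Wx (x - h) t"
      using e2[of h] e2[of "-h"] by (simp add: abs_le_iff)
    then have "tau / (2 * h) * (2 * h * Wxx x t - 2 * (K * h\<^sup>2)) \<le> tau / (2 * h) * (Wx (x + h) t - Wx (x - h) t)"
      using \<open>0 < tau\<close> h by (intro mult_left_mono) auto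
    moreover have "tau / (2 * h) * (2 * h * Wxx x t - 2 * (K * h\<^sup>2)) = tau * Wxx x t - tau * (K * h)"
      using h by (simp add: field_simps power2_eq_square)
    ultimately have f2: "tau * Wxx x t - tau * (K * h) \<le> tau / (2 * h) * (Wx (x + h) t - Wx (x - h) t)" by simp
    have f3: "?W x (t + tau) \<le> ?W x t + tau * Wt x t + K * tau\<^sup>2" using e3 by linarith
    have "tau * (K * h) + K * h\<^sup>2 + K * tau\<^sup>2 \<le> tau * c"
    proof -
      have "h\<^sup>2 = tau * (2 * A / g\<^sup>2 * h)" using tau \<open>0 < g\<close> by (simp add: field_simps power2_eq_square)
      moreover have "K * (2 * A / g\<^sup>2 + 2) * h \<le> c"
        using h(2) den unfolding h0_def by (simp add: pos_le_divide_eq mult.commute)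
      moreover have "K * (tau * tau) \<le> tau * (K * h)" using \<open>tau \<le> h\<close> K \<open>0 < tau\<close> by (simp add: mult_left_mono)
      moreover have "tau * (K * (2 * A / g\<^sup>2 + 2) * h) \<le> tau * c" using calculation(2) \<open>0 < tau\<close> by (intro mult_left_mono) auto
      ultimately show ?thesis by (simp add: algebra_simps power2_eq_square[of tau])
    qed
    moreover have "tau * c \<le> tau * (Wxx x t - Wt x t)" using slack[OF tT(1), of x] \<open>0 < tau\<close> by (intro mult_left_mono) (auto simp: c_def)
    ultimately have f4: "tau * (K * h) + K * h\<^sup>2 + K * tau\<^sup>2 \<le> tau * Wxx x t - tau * Wt x t" by (simp add: right_diff_distrib)
    have "?W x (t + tau) \<le> (?W (x + h) t + ?W (x - h) t) / 2 + tau / (2 * h) * (Wx (x + h) t - Wx (x - h) t)"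
      using f1 f2 f3 f4 by linarith
    also have "\<dots> = lf_step h tau t (\<lambda>x. ?W x t) x"
      unfolding GW lf_step_def by (simp add: add_divide_distrib right_diff_distrib)
    finally show "?W x (t + tau) \<le> lf_step h tau t (\<lambda>x. ?W x t) x" .
  qed
qed

end

section \<open>The Lax-Friedrichs scheme\<close>

text \<open>The scheme controls central differences, that is, increments over exactly 2 h. Chaining
  them leaves a rest shorter than 2 h, for which the crude constant \<open>M\<close> suffices; it
  enters only with a factor \<open>h\<close>.\<close>

lemma lipschitz_chain_le:
  fixes f :: "real \<Rightarrow> real"
  assumes "0 < h" and lip: "\<And>x y. \<bar>f x - f y\<bar> \<le> M * \<bar>x - y\<bar>"
    and step: "\<And>x. f (x + 2 * h) - f x \<le> 2 * h * a" and "x \<le> y"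
  shows "f y - f x \<le> a * (y - x) + 2 * h * (M + \<bar>a\<bar>)"
proof -
  have "0 \<le> M" using lip[of 0 1] by simp
  define m where "m = nat \<lfloor>(y - x) / (2 * h)\<rfloor>"
  have "real m = of_int \<lfloor>(y - x) / (2 * h)\<rfloor>" using \<open>0 < h\<close> \<open>x \<le> y\<close> by (simp add: m_def)
  then have m: "real m \<le> (y - x) / (2 * h)" "(y - x) / (2 * h) < real m + 1"
    by (simp_all only: of_int_floor_le real_of_int_floor_add_one_gt)
  define r where "r = y - (x + 2 * h * m)"
  have r: "0 \<le> r" "r \<le> 2 * h" using m \<open>0 < h\<close> by (auto simp: r_def field_simps)
  have "f (x + 2 * h * n) - f x \<le> 2 * h * a * n" for n :: nat
  proof (induction n)
    case (Suc n)
    then show ?case using step[of "x + 2 * h * n"] by (simp add: algebra_simps)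
  qed simp
  then have "f (x + 2 * h * m) - f x \<le> 2 * h * a * m" .
  moreover have "f y - f (x + 2 * h * m) \<le> M * r" using lip[of y "x + 2 * h * m"] r by (simp add: r_def)
  moreover have "M * r \<le> M * (2 * h)" using r \<open>0 \<le> M\<close> by (intro mult_left_mono)
  moreover have "(- a) * r \<le> \<bar>a\<bar> * (2 * h)" using r by (intro mult_mono) auto
  moreover have "2 * h * a * m = a * (y - x) - a * r" by (simp add: r_def algebra_simps)
  ultimately show ?thesis by (simp add: algebra_simps)
qed

text \<open>One bracket of \<open>lf_step\<close> as a function of its value of \<open>u\<close>.
  Its derivative 1/2 - c / p^2 is nonnegative for large values; the condition on p q is the exact
  two-point version.\<close>

lemma flux_mono:
  fixes p q c :: real
  assumes "0 < q" "q \<le> p" "2 * \<bar>c\<bar> \<le> p * q"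
  shows "q / 2 + c / q \<le> p / 2 + c / p"
proof -
  have "0 < p * q" "0 < p" using assms by (auto intro: mult_pos_pos)
  have "(p / 2 + c / p) - (q / 2 + c / q) = (p - q) * (p * q - 2 * c) / (2 * (p * q))"
    using assms \<open>0 < p\<close> by (simp add: field_simps)
  also have "\<dots> \<ge> 0" using assms \<open>0 < p * q\<close> by (intro divide_nonneg_pos mult_nonneg_nonneg) auto
  finally show ?thesis by simp
qed

text \<open>A step of the scheme depends on the two neighbouring values through nonnegative weights
  of sum one, as long as the slopes satisfy the CFL condition.\<close>
lemma step_difference:
  fixes a b a' b' :: real
  assumes "0 < h" and p: "p = (a - b) / (2 * h)" "p' = (a' - b') / (2 * h)" "0 < p" "0 < p'"
    and cfl: "\<bar>c\<bar> \<le> h * (p * p')"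
  obtains m where "\<bar>m\<bar> \<le> 1/2"
    "((a + b) / 2 + c / p) - ((a' + b') / 2 + c / p') = (a - a') * (1/2 - m) + (b - b') * (1/2 + m)"
proof (rule that[of "c / (2 * (h * (p * p')))"])
  have pos: "0 < h * (p * p')" using p(3,4) \<open>0 < h\<close> by (intro mult_pos_pos)
  then have "\<bar>c\<bar> / (2 * (h * (p * p'))) \<le> 1/2" using cfl by (simp add: pos_divide_le_eq)
  then show "\<bar>c / (2 * (h * (p * p')))\<bar> \<le> 1/2" using pos by (simp only: abs_divide abs_of_pos mult_pos_pos zero_less_numeral)
  have ab: "a = b + 2 * h * p" "a' = b' + 2 * h * p'" using p(1,2) \<open>0 < h\<close> by (simp_all add: field_simps)
  show "((a + b) / 2 + c / p) - ((a' + b') / 2 + c / p') =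
    (a - a') * (1/2 - c / (2 * (h * (p * p')))) + (b - b') * (1/2 + c / (2 * (h * (p * p'))))"
    unfolding ab using p(3,4) \<open>0 < h\<close> by (simp add: field_simps)
qed

lemma weighted_bounds:
  fixes m :: real
  assumes "\<bar>m\<bar> \<le> 1/2"
  shows "a \<le> D \<Longrightarrow> b \<le> D \<Longrightarrow> a * (1/2 - m) + b * (1/2 + m) \<le> D"
    "\<bar>a\<bar> \<le> D \<Longrightarrow> \<bar>b\<bar> \<le> D \<Longrightarrow> \<bar>a * (1/2 - m) + b * (1/2 + m)\<bar> \<le> D"
proof -
  have *: "a * (1/2 - m) + b * (1/2 + m) \<le> D" if "a \<le> D" "b \<le> D" for a b
  proof -
    have "a * (1/2 - m) + b * (1/2 + m) \<le> D * (1/2 - m) + D * (1/2 + m)"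
      using assms that by (intro add_mono mult_right_mono) auto
    also have "\<dots> = D" by (simp add: algebra_simps)
    finally show ?thesis .
  qed
  show "a \<le> D \<Longrightarrow> b \<le> D \<Longrightarrow> a * (1/2 - m) + b * (1/2 + m) \<le> D" by (rule *)
  show "\<bar>a\<bar> \<le> D \<Longrightarrow> \<bar>b\<bar> \<le> D \<Longrightarrow> \<bar>a * (1/2 - m) + b * (1/2 + m)\<bar> \<le> D"
    using *[of a b] *[of "-a" "-b"] by (auto simp: abs_le_iff algebra_simps)
qed

text \<open>\<open>k0_mono\<close> is the integrated form of the slope inequality. The reflections,
  together with the parity of \<open>S\<close>, replace the lateral conditions by symmetries that
  every step of the scheme preserves.\<close>

locale dislocation = heat_family +
  fixes T :: real and k0 :: "real \<Rightarrow> real" and L0 :: real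
  assumes T_pos: "0 < T"
    and k0_lip: "\<bar>k0 x - k0 y\<bar> \<le> L0 * \<bar>x - y\<bar>"
    and k0_mono: "x \<le> y \<Longrightarrow> \<bar>S 0 y 0 - S 0 x 0\<bar> \<le> k0 y - k0 x"
    and k0_reflect0: "k0 (- x) = 2 * k0 0 - k0 x"
    and k0_reflect1: "k0 (2 - x) = 2 * k0 1 - k0 x"
begin

lemma L0_nonneg: "0 \<le> L0" using k0_lip[of 0 1] by simp

definition CG :: real where "CG = B 2 * B 2 + B 1 * B 3"

lemma CG_nonneg: "0 \<le> CG" by (simp add: CG_def B_nonneg)

lemma G_lip: "0 \<le> t \<Longrightarrow> \<bar>G x t - G y t\<bar> \<le> CG * \<bar>x - y\<bar>"
proof (rule lipschitz_of_deriv_bound[of UNIV])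
  fix x assume t: "0 \<le> t"
  show "((\<lambda>x. G x t) has_real_derivative S 2 x t * S 2 x t + S 1 x t * S 3 x t) (at x)"
    using S_dx[OF t, of 1 x] S_dx[OF t, of 2 x] unfolding G_def
    by (auto intro!: derivative_eq_intros simp: numeral_2_eq_2 numeral_3_eq_3)
  have "\<bar>S 2 x t * S 2 x t\<bar> \<le> B 2 * B 2" "\<bar>S 1 x t * S 3 x t\<bar> \<le> B 1 * B 3"
    unfolding abs_mult by (intro mult_mono S_bound t B_nonneg; simp)+
  then show "\<bar>S 2 x t * S 2 x t + S 1 x t * S 3 x t\<bar> \<le> CG" unfolding CG_def by linarith
qed auto

lemma G_reflect: "0 \<le> t \<Longrightarrow> G (- x) t = - G x t" "0 \<le> t \<Longrightarrow> G (2 - x) t = - G x t"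
proof -
  show *: "G (- x) t = - G x t" if "0 \<le> t" for x using S_minus[OF that, of 1 x] S_minus[OF that, of 2 x] by (simp add: G_def)
  have "G (2 - x) t = G (- x) t" using S_period[of 1 "-x" t] S_period[of 2 "-x" t] by (simp add: G_def add.commute)
  with * show "0 \<le> t \<Longrightarrow> G (2 - x) t = - G x t" by simp
qed

lemma G_continuous: "continuous_on (UNIV \<times> {0..}) (\<lambda>z. G (fst z) (snd z))"
  unfolding G_def by (intro continuous_intros S_continuous)

text \<open>The scheme is run at every real \<open>x\<close>, not on a spatial grid, so that only
  time has to be interpolated later. The steepening 2 + T consists of 1 + T, which lifts the initial
  slope above \<open>W\<close>, and 1 for the consistency error of central differences.\<close>

primrec kap :: "real \<Rightarrow> real \<Rightarrow> real \<Rightarrow> nat \<Rightarrow> real \<Rightarrow> real" where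
  "kap g h tau 0 = (\<lambda>x. k0 x + g * (2 + T) * x)"
| "kap g h tau (Suc n) = (\<lambda>x. (kap g h tau n (x + h) + kap g h tau n (x - h)) / 2
     + tau * G x (n * tau) / ((kap g h tau n (x + h) - kap g h tau n (x - h)) / (2 * h)))"

declare kap.simps(2) [simp del]

text \<open>\<open>Lmax\<close> bounds central differences uniformly in \<open>g\<close> and becomes
  the Lipschitz constant of the limit. \<open>Lcrude\<close> holds for arbitrary increments at the
  price of 1 / g. In both, 2 + T bounds the steepening, as g \<le> 1.\<close>

definition Lmax :: real where "Lmax = L0 + 2 + T + T * CG"

definition Lcrude :: "real \<Rightarrow> real" where "Lcrude g = L0 + 2 + T + T * CG / g"

lemma Lmax_nonneg: "0 \<le> Lmax" using L0_nonneg T_pos CG_nonneg by (simp add: Lmax_def)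
lemma Lcrude_nonneg: "0 < g \<Longrightarrow> 0 \<le> Lcrude g" using L0_nonneg T_pos CG_nonneg by (simp add: Lcrude_def)

end

text \<open>\<open>cfl\<close> gives |tau G| \<le> g^2 h / 2, which suffices for monotonicity at
  slopes of at least \<open>g\<close>; \<open>h_small\<close> is for the initial slopes, and
  \<open>W_sub\<close> holds for small \<open>h\<close> by
  \<open>W_discrete_subsolution\<close>.\<close>

locale scheme = dislocation +
  fixes g h tau :: real
  assumes g: "0 < g" "g \<le> 1" and h: "0 < h" and tau: "0 < tau"
    and cfl: "2 * A * tau = g\<^sup>2 * h" and h_small: "B 2 * h \<le> g"
    and W_sub: "0 \<le> t \<Longrightarrow> t + tau \<le> T \<Longrightarrow>
     W T g x (t + tau) \<le> lf_step h tau t (\<lambda>x. W T g x t) x"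
begin

abbreviation "K \<equiv> kap g h tau"

definition slope :: "nat \<Rightarrow> real \<Rightarrow> real" where
  "slope n x = (K n (x + h) - K n (x - h)) / (2 * h)"

lemma K_Suc: "K (Suc n) x = (K n (x + h) + K n (x - h)) / 2 + tau * G x (n * tau) / slope n x"
  by (simp add: slope_def kap.simps(2))

text \<open>The two averages at x + h and x - h share the value \<open>K n x\<close>, which cancels.
  So the central difference of the scheme for \<open>kappa\<close> is exactly the Lax-Friedrichs
  scheme for the conservation law.\<close>

lemma slope_Suc: "slope (Suc n) x = lf_step h tau (n * tau) (slope n) x"
proof -
  have "slope (Suc n) x = (K (Suc n) (x + h) - K (Suc n) (x - h)) / (2 * h)" by (simp add: slope_def)
  also have "\<dots> = ((K n (x + h + h) + K n x) / 2 - (K n x + K n (x - h - h)) / 2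
     + tau * G (x + h) (n * tau) / slope n (x + h) - tau * G (x - h) (n * tau) / slope n (x - h)) / (2 * h)"
    unfolding K_Suc by simp
  also have "\<dots> = lf_step h tau (n * tau) (slope n) x"
  proof -
    have q: "K n (x + h + h) = K n x + 2 * h * slope n (x + h)" "K n (x - h - h) = K n x - 2 * h * slope n (x - h)"
      using h by (simp_all add: slope_def)
    show ?thesis unfolding q lf_step_def using h by (simp add: add_divide_distrib diff_divide_distrib mult.commute)
  qed
  finally show ?thesis .
qed

lemma tau_G: "0 \<le> t \<Longrightarrow> \<bar>tau * G x t\<bar> \<le> g\<^sup>2 / 2 * h"
proof -
  assume t: "0 \<le> t"
  have "\<bar>tau * G x t\<bar> \<le> tau * A" using tau G_bound[OF t, of x] by (simp add: abs_mult mult_left_mono)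
  moreover have "2 * (tau * A) = g\<^sup>2 * h" using cfl by (simp add: ac_simps)
  ultimately show ?thesis by simp
qed

lemma flux_coeff: "0 \<le> t \<Longrightarrow> 2 * \<bar>tau / (2 * h) * G x t\<bar> \<le> g * g"
proof -
  assume t: "0 \<le> t"
  have "2 * \<bar>tau / (2 * h) * G x t\<bar> = \<bar>tau * G x t\<bar> / h" using h by (simp add: abs_mult)
  also have "\<dots> \<le> g\<^sup>2 / 2" using tau_G[OF t, of x] h by (simp add: pos_divide_le_eq)
  also have "\<dots> \<le> g * g" by (simp add: power2_eq_square)
  finally show ?thesis .
qed

lemma S0_central: "0 \<le> t \<Longrightarrow> \<bar>S 0 (x + h) t - S 0 (x - h) t - 2 * h * S 1 x t\<bar> \<le> 2 * h * (B 2 * h)"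
proof -
  assume t: "0 \<le> t"
  have e: "\<bar>S 0 y t - S 0 x t - (y - x) * S 1 x t\<bar> \<le> B 2 * (y - x)\<^sup>2" for y
  proof (rule first_order_expansion[of UNIV])
    show "((\<lambda>x. S 0 x t) has_real_derivative S 1 x t) (at x)" for x using S_dx[OF t, of 0 x] by simp
    show "\<bar>S 1 x t - S 1 y t\<bar> \<le> B 2 * \<bar>x - y\<bar>" for x y using S_lipschitz[OF t t, of 1 x y] by (simp add: numeral_2_eq_2)
  qed (auto simp: B_nonneg)
  show ?thesis using e[of "x + h"] e[of "x - h"] by (simp add: abs_le_iff power2_eq_square algebra_simps)
qed

text \<open>Discrete comparison with \<open>W\<close>. The induction is self-sustaining: slopes
  above W \<ge> g lie in the region where a step is monotone, and monotonicity with
  \<open>W_sub\<close> gives the bound at the next level.\<close>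

lemma slope_lower: "n * tau \<le> T \<Longrightarrow> W T g x (n * tau) \<le> slope n x"
proof (induction n arbitrary: x)
  case 0
  \<comment> \<open>At the start \<open>W\<close> is at most |S 1| + g (1 + T), and passing from
    \<open>S 1\<close> to a central difference of \<open>S 0\<close> loses at most B 2 h \<le> g;
    both are covered by the steepening g (2 + T).\<close>
  have "2 * h * \<bar>S 1 x 0\<bar> - 2 * h * (B 2 * h) \<le> \<bar>S 0 (x + h) 0 - S 0 (x - h) 0\<bar>"
    using S0_central[of 0 x] h by (simp add: abs_mult)
  also have "\<dots> \<le> k0 (x + h) - k0 (x - h)" using k0_mono[of "x - h" "x + h"] h by simp
  finally have "2 * h * (\<bar>S 1 x 0\<bar> - B 2 * h + g * (2 + T)) \<le> K 0 (x + h) - K 0 (x - h)"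
    by (simp add: algebra_simps)
  then have "\<bar>S 1 x 0\<bar> - B 2 * h + g * (2 + T) \<le> slope 0 x"
    using h by (simp add: slope_def pos_le_divide_eq mult.commute)
  moreover have "W T g x 0 \<le> \<bar>S 1 x 0\<bar> + g * (1 + T)"
  proof -
    have "g\<^sup>2 * (1 + T) \<le> (g * (1 + T))\<^sup>2"
      using T_pos by (simp add: power_mult_distrib power2_eq_square[of "1 + T"] mult_left_mono)
    then have "g\<^sup>2 * (1 + T - 0) + (S 1 x 0)\<^sup>2 \<le> (\<bar>S 1 x 0\<bar> + g * (1 + T))\<^sup>2"
    proof -
      have "0 \<le> 2 * \<bar>S 1 x 0\<bar> * (g * (1 + T))" using g T_pos by (intro mult_nonneg_nonneg) auto
      with \<open>g\<^sup>2 * (1 + T) \<le> (g * (1 + T))\<^sup>2\<close> show ?thesis unfolding power2_sum power2_abs diff_zero by linarith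
    qed
    then show ?thesis unfolding W_def using g T_pos by (intro real_le_lsqrt) auto
  qed
  ultimately show ?case using h_small by (simp add: algebra_simps)
next
  case (Suc n)
  define t where "t = n * tau"
  have t: "0 \<le> t" "t + tau \<le> T" using Suc.prems tau by (auto simp: t_def algebra_simps)
  then have tT: "t \<in> {0..T}" using tau by auto
  have IH: "W T g y t \<le> slope n y" for y using Suc.IH[of y] t tau by (simp add: t_def)
  have Wg: "g \<le> W T g y t" for y by (rule W_ge(1)[OF tT g(1)])
  have fm: "W T g y t / 2 + c / W T g y t \<le> slope n y / 2 + c / slope n y" if "2 * \<bar>c\<bar> \<le> g * g" for c y
  proof (rule flux_mono)
    show "0 < W T g y t" using Wg[of y] g by linarith
    have "g * g \<le> slope n y * W T g y t" using Wg[of y] IH[of y] g by (intro mult_mono) auto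
    with that show "2 * \<bar>c\<bar> \<le> slope n y * W T g y t" by linarith
  qed (rule IH)
  have "W T g x (Suc n * tau) = W T g x (t + tau)" by (simp add: t_def algebra_simps)
  also have "\<dots> \<le> lf_step h tau t (\<lambda>x. W T g x t) x" by (rule W_sub[OF t])
  also have "\<dots> \<le> slope (Suc n) x"
    unfolding slope_Suc lf_step_def t_def[symmetric]
    using fm[OF flux_coeff[OF t(1), of "x + h"], of "x + h"] fm[of "- (tau / (2 * h) * G (x - h) t)" "x - h"]
      flux_coeff[OF t(1), of "x - h"] by simp
  finally show ?case .
qed

lemma slope_ge:
  assumes "n * tau \<le> T"
  shows "g \<le> slope n x" "\<bar>S 1 x (n * tau)\<bar> \<le> slope n x"
proof -
  have "n * tau \<in> {0..T}" using assms tau by simp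
  from W_ge(1,2)[OF this g(1), of x] slope_lower[OF assms, of x]
  show "g \<le> slope n x" "\<bar>S 1 x (n * tau)\<bar> \<le> slope n x" by linarith+
qed

text \<open>Comparison with the constant \<open>M\<close>. One step raises it by at most tau CG / M,
  and M \<ge> 1, which the summand 2 guarantees, makes this independent of \<open>g\<close>.\<close>

lemma slope_upper: "n * tau \<le> T \<Longrightarrow> slope n x \<le> L0 + 2 + T + n * tau * CG"
proof (induction n arbitrary: x)
  case 0
  have "k0 (x + h) - k0 (x - h) \<le> L0 * (2 * h)" using k0_lip[of "x + h" "x - h"] h by (simp add: abs_le_iff)
  moreover have "g * (2 + T) * (2 * h) \<le> 1 * (2 + T) * (2 * h)"
    using g h T_pos by (intro mult_right_mono) auto
  ultimately have "K 0 (x + h) - K 0 (x - h) \<le> (L0 + 2 + T) * (2 * h)" by (simp add: algebra_simps)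
  then show ?case using h by (simp add: slope_def pos_divide_le_eq)
next
  case (Suc n)
  define t where "t = n * tau"
  define M where "M = L0 + 2 + T + t * CG"
  have t: "0 \<le> t" "t + tau \<le> T" "t \<le> T" using Suc.prems tau by (auto simp: t_def algebra_simps)
  have M: "1 \<le> M" using L0_nonneg T_pos CG_nonneg t by (simp add: M_def)
  have IH: "slope n y \<le> M" for y using Suc.IH[of y] t by (simp add: t_def M_def)
  have ge: "g \<le> slope n y" for y by (rule slope_ge) (use t in \<open>simp add: t_def\<close>)
  have fm: "slope n y / 2 + c / slope n y \<le> M / 2 + c / M" if "2 * \<bar>c\<bar> \<le> g * g" for c y
  proof (rule flux_mono)
    show "0 < slope n y" using ge[of y] g by linarith
    have "g * g \<le> M * slope n y" using ge[of y] IH[of y] g by (intro mult_mono) auto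
    with that show "2 * \<bar>c\<bar> \<le> M * slope n y" by linarith
  qed (rule IH)
  have "slope (Suc n) x \<le> (M / 2 + tau / (2 * h) * G (x + h) t / M) + (M / 2 + - (tau / (2 * h) * G (x - h) t) / M)"
    unfolding slope_Suc lf_step_def t_def[symmetric]
    using fm[OF flux_coeff[OF t(1), of "x + h"], of "x + h"] fm[of "- (tau / (2 * h) * G (x - h) t)" "x - h"]
      flux_coeff[OF t(1), of "x - h"] by simp
  also have "\<dots> = M + tau / (2 * h) * (G (x + h) t - G (x - h) t) / M"
    by (simp add: algebra_simps diff_divide_distrib add_divide_distrib)
  also have "\<dots> \<le> M + tau * CG / 1"
  proof -
    have "G (x + h) t - G (x - h) t \<le> CG * (2 * h)" using G_lip[OF t(1), of "x + h" "x - h"] h by (simp add: abs_le_iff)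
    then have "tau / (2 * h) * (G (x + h) t - G (x - h) t) \<le> tau / (2 * h) * (CG * (2 * h))"
      using tau h by (intro mult_left_mono) auto
    also have "\<dots> = tau * CG" using h by simp
    finally have "tau / (2 * h) * (G (x + h) t - G (x - h) t) / M \<le> tau * CG / M" using M by (intro divide_right_mono) auto
    also have "\<dots> \<le> tau * CG / 1" using M tau CG_nonneg by (intro divide_left_mono) auto
    finally show ?thesis by simp
  qed
  finally show ?case by (simp add: M_def t_def algebra_simps)
qed

lemma slope_le_Lmax: "n * tau \<le> T \<Longrightarrow> slope n x \<le> Lmax"
proof -
  assume n: "n * tau \<le> T"
  then have "n * tau * CG \<le> T * CG" using CG_nonneg by (intro mult_right_mono)
  with slope_upper[OF n, of x] show ?thesis by (simp add: Lmax_def)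
qed

lemma G_div_slope: "n * tau \<le> T \<Longrightarrow> \<bar>G x (n * tau) / slope n x\<bar> \<le> B 2"
proof -
  assume n: "n * tau \<le> T"
  have t: "0 \<le> n * tau" using tau by simp
  have pos: "0 < slope n x" using slope_ge(1)[OF n, of x] g by linarith
  have "\<bar>G x (n * tau)\<bar> \<le> slope n x * B 2"
    unfolding G_def abs_mult by (intro mult_mono slope_ge n S_bound t) (use pos in auto)
  then show ?thesis using pos by (simp add: abs_divide pos_divide_le_eq mult.commute)
qed

text \<open>Needed because slope bounds say nothing about points closer than 2 h. With
  \<open>G\<close> frozen at \<open>x\<close>, the values at two points differ by a weighted mean of
  earlier differences; exchanging \<open>G x t\<close> for \<open>G y t\<close> costs CG |x - y| / g
  per unit of time.\<close>

lemma K_lip: "n * tau \<le> T \<Longrightarrow> \<bar>K n x - K n y\<bar> \<le> Lcrude g * \<bar>x - y\<bar>"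
proof -
  have "\<bar>K n x - K n y\<bar> \<le> (L0 + 2 + T + n * tau * CG / g) * \<bar>x - y\<bar>" if "n * tau \<le> T" for x y
    using that
  proof (induction n arbitrary: x y)
    case 0
    have "\<bar>K 0 x - K 0 y\<bar> = \<bar>(k0 x - k0 y) + g * (2 + T) * (x - y)\<bar>" by (simp add: algebra_simps)
    also have "\<dots> \<le> \<bar>k0 x - k0 y\<bar> + \<bar>g * (2 + T) * (x - y)\<bar>" by (rule abs_triangle_ineq)
    also have "\<dots> \<le> L0 * \<bar>x - y\<bar> + 1 * (2 + T) * \<bar>x - y\<bar>"
      using g T_pos by (auto simp: abs_mult intro!: add_mono k0_lip mult_right_mono)
    finally show ?case by (simp add: algebra_simps)
  next
    case (Suc n)
    define t where "t = n * tau"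
    have t: "0 \<le> t" "t \<le> T" using Suc.prems tau by (auto simp: t_def algebra_simps)
    have ge: "g \<le> slope n z" for z by (rule slope_ge) (use t in \<open>simp add: t_def\<close>)
    have pos: "0 < slope n z" for z using ge[of z] g by linarith
    define D where "D = (L0 + 2 + T + t * CG / g) * \<bar>x - y\<bar>"
    have IH: "\<bar>K n (x + s) - K n (y + s)\<bar> \<le> D" for s
      using Suc.IH[of "x + s" "y + s"] t by (simp add: t_def D_def)
    have cf: "\<bar>tau * G x t\<bar> \<le> h * (slope n x * slope n y)"
    proof -
      have "g * g \<le> slope n x * slope n y" using ge g by (intro mult_mono) (auto intro: less_imp_le pos)
      moreover have "g\<^sup>2 / 2 \<le> g * g" by (simp add: power2_eq_square)
      ultimately have "g\<^sup>2 / 2 \<le> slope n x * slope n y" by (rule order_trans[rotated])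
      then have "g\<^sup>2 / 2 * h \<le> slope n x * slope n y * h" using h by (intro mult_right_mono) auto
      with tau_G[OF t(1), of x] show ?thesis by (simp add: mult.commute)
    qed
    obtain m where m: "\<bar>m\<bar> \<le> 1/2"
      "((K n (x + h) + K n (x - h)) / 2 + tau * G x t / slope n x) - ((K n (y + h) + K n (y - h)) / 2 + tau * G x t / slope n y)
        = (K n (x + h) - K n (y + h)) * (1/2 - m) + (K n (x - h) - K n (y - h)) * (1/2 + m)"
      using step_difference[OF h slope_def slope_def pos pos cf] by blast
    define P where "P = ((K n (x + h) + K n (x - h)) / 2 + tau * G x t / slope n x)
        - ((K n (y + h) + K n (y - h)) / 2 + tau * G x t / slope n y)"
    have "\<bar>K (Suc n) x - K (Suc n) y\<bar> = \<bar>P + tau * (G x t - G y t) / slope n y\<bar>"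
      unfolding K_Suc P_def t_def[symmetric] by (simp add: right_diff_distrib diff_divide_distrib)
    also have "\<dots> \<le> \<bar>P\<bar> + \<bar>tau * (G x t - G y t) / slope n y\<bar>" by (rule abs_triangle_ineq)
    also have "\<dots> \<le> D + tau * (CG * \<bar>x - y\<bar>) / g"
    proof (rule add_mono)
      show "\<bar>P\<bar> \<le> D"
        unfolding P_def m(2) by (rule weighted_bounds(2)[OF m(1)]) (use IH[of h] IH[of "-h"] in simp_all)
      show "\<bar>tau * (G x t - G y t) / slope n y\<bar> \<le> tau * (CG * \<bar>x - y\<bar>) / g"
        unfolding abs_divide abs_mult
        using tau g ge[of y] pos[of y] G_lip[OF t(1), of x y] by (intro frac_le mult_mono) auto
    qed
    also have "\<dots> = (L0 + 2 + T + Suc n * tau * CG / g) * \<bar>x - y\<bar>"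
    proof -
      have st: "real (Suc n) * tau = t + tau" by (simp add: t_def distrib_right)
      show ?thesis unfolding D_def st by (simp add: distrib_right add_divide_distrib)
    qed
    finally show ?case .
  qed
  moreover assume n: "n * tau \<le> T"
  ultimately have "\<bar>K n x - K n y\<bar> \<le> (L0 + 2 + T + n * tau * CG / g) * \<bar>x - y\<bar>" by simp
  also have "\<dots> \<le> Lcrude g * \<bar>x - y\<bar>"
  proof (rule mult_right_mono)
    have "n * tau * CG / g \<le> T * CG / g" using n CG_nonneg g by (intro divide_right_mono mult_right_mono) auto
    then show "L0 + 2 + T + n * tau * CG / g \<le> Lcrude g" by (simp add: Lcrude_def)
  qed simp
  finally show ?thesis .
qed

text \<open>The averaging moves a value by up to \<open>Lcrude g * h\<close>, and \<open>h\<close>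
  is 2 A / g^2 times \<open>tau\<close>. This crude speed is used for equicontinuity at fixed
  \<open>g\<close> only.\<close>

lemma K_time_step: "n * tau \<le> T \<Longrightarrow> \<bar>K (Suc n) x - K n x\<bar> \<le> (Lcrude g * (2 * A / g\<^sup>2) + B 2) * tau"
proof -
  assume n: "n * tau \<le> T"
  define Q where "Q = tau * (G x (n * tau) / slope n x)"
  have Q: "\<bar>Q\<bar> \<le> tau * B 2"
    unfolding Q_def abs_mult[of tau]
    using mult_left_mono[OF G_div_slope[OF n, of x], of tau] tau by (simp only: abs_of_pos less_imp_le)
  have a: "\<bar>K n (x + h) - K n x\<bar> \<le> Lcrude g * h" "\<bar>K n (x - h) - K n x\<bar> \<le> Lcrude g * h"
    using K_lip[OF n, of "x + h" x] K_lip[OF n, of "x - h" x] h by simp_all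
  have "K (Suc n) x - K n x = (K n (x + h) - K n x) / 2 + (K n (x - h) - K n x) / 2 + Q"
    unfolding K_Suc Q_def by (simp add: field_simps)
  then have "\<bar>K (Suc n) x - K n x\<bar> \<le> Lcrude g * h + tau * B 2"
  proof -
    have "\<bar>u / 2 + v / 2 + q\<bar> \<le> c + d" if "\<bar>u\<bar> \<le> c" "\<bar>v\<bar> \<le> c" "\<bar>q\<bar> \<le> d" for u v q c d :: real
      using that by linarith
    from this[OF a Q] show ?thesis by (simp only: \<open>K (Suc n) x - K n x = _\<close>)
  qed
  moreover have "h = tau * (2 * A / g\<^sup>2)" using cfl g by (simp add: field_simps)
  then have "Lcrude g * h = Lcrude g * (2 * A / g\<^sup>2) * tau" by simp
  ultimately show ?thesis by (simp only: distrib_right mult.commute[of tau])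
qed

text \<open>The source of a time bound free of \<open>g\<close>. The cone Lcrude |y - x| is covered
  by a parabola of parameter \<open>eta\<close>; under averaging a parabola only rises, by h^2 per
  step inside the bracket. Over all steps this totals at most T h^2 / tau, which vanishes with the
  mesh; then \<open>eta\<close> can be sent to 0, and only the source bound \<open>B 2\<close>
  remains.\<close>

lemma K_barrier:
  assumes "real (n + m) * tau \<le> T" "0 < eta" "s \<in> {1, -1}"
  shows "s * (K (n + m) y - K n x) \<le> Lcrude g * eta / 2 + Lcrude g * ((y - x)\<^sup>2 + m * h\<^sup>2) / (2 * eta) + B 2 * (m * tau)"
  using assms(1)
proof (induction m arbitrary: y)
  case 0
  have n: "n * tau \<le> T" using 0 by simp
  have "s * (K n y - K n x) \<le> \<bar>K n y - K n x\<bar>" using assms(3) by auto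
  also have "\<dots> \<le> Lcrude g * \<bar>y - x\<bar>" by (rule K_lip[OF n])
  also have "\<dots> \<le> Lcrude g * ((eta + (y - x)\<^sup>2 / eta) / 2)"
  proof (rule mult_left_mono[OF _ Lcrude_nonneg[OF g(1)]])
    have "2 * eta * \<bar>y - x\<bar> \<le> eta\<^sup>2 + (y - x)\<^sup>2" using sum_squares_bound[of eta "\<bar>y - x\<bar>"] by simp
    then show "\<bar>y - x\<bar> \<le> (eta + (y - x)\<^sup>2 / eta) / 2" using \<open>0 < eta\<close> by (simp add: field_simps power2_eq_square)
  qed
  finally show ?case using \<open>0 < eta\<close> by (simp add: field_simps)
next
  case (Suc m)
  have nm: "real (n + m) * tau \<le> T" using Suc.prems tau by (simp add: algebra_simps)
  let ?R = "\<lambda>y. Lcrude g * eta / 2 + Lcrude g * ((y - x)\<^sup>2 + m * h\<^sup>2) / (2 * eta) + B 2 * (m * tau)"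
  have IH: "s * (K (n + m) y - K n x) \<le> ?R y" for y by (rule Suc.IH[OF nm])
  have "s * (K (n + Suc m) y - K n x) = (s * (K (n + m) (y + h) - K n x) + s * (K (n + m) (y - h) - K n x)) / 2
      + s * (tau * (G y (real (n + m) * tau) / slope (n + m) y))"
    unfolding add_Suc_right K_Suc by (simp add: field_simps)
  also have "\<dots> \<le> (?R (y + h) + ?R (y - h)) / 2 + tau * B 2"
  proof (intro add_mono divide_right_mono IH)
    have "s * (tau * (G y (real (n + m) * tau) / slope (n + m) y)) \<le> tau * \<bar>G y (real (n + m) * tau) / slope (n + m) y\<bar>"
      using abs_ge_self[of "s * (tau * (G y (real (n + m) * tau) / slope (n + m) y))"] assms(3) tau
      by (auto simp: abs_mult abs_divide)
    also have "\<dots> \<le> tau * B 2" using G_div_slope[OF nm, of y] tau by (intro mult_left_mono) auto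
    finally show "s * (tau * (G y (real (n + m) * tau) / slope (n + m) y)) \<le> tau * B 2" .
  qed simp
  \<comment> \<open>The mean of (y + h - x)^2 and (y - h - x)^2 is (y - x)^2 + h^2, which supplies
    the extra h^2.\<close>
  also have "\<dots> = Lcrude g * eta / 2 + Lcrude g * ((y - x)\<^sup>2 + Suc m * h\<^sup>2) / (2 * eta) + B 2 * (Suc m * tau)"
    using \<open>0 < eta\<close> by (simp add: field_simps power2_eq_square)
  finally show ?case .
qed

text \<open>The slope bounds in a form that survives the limit: every error term carries a factor
  \<open>h\<close>. The third bound chains the increments of s S 0 - K, each at most the consistency
  error of the central difference.\<close>

lemma K_increment:
  assumes n: "n * tau \<le> T" and "x \<le> y"
  shows "K n y - K n x \<le> Lmax * (y - x) + 2 * h * (Lcrude g + Lmax)"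
    and "g * (y - x) - 2 * h * (Lcrude g + g) \<le> K n y - K n x"
    and "s \<in> {1, -1} \<Longrightarrow> s * (S 0 y (n * tau) - S 0 x (n * tau)) - B 2 * h * (y - x)
      - 2 * h * (Lcrude g + B 1 + B 2 * h) \<le> K n y - K n x"
proof -
  have K2: "K n (x + 2 * h) - K n x = 2 * h * slope n (x + h)" for x
  proof -
    have "x + 2 * h = x + h + h" by simp
    then show ?thesis using h by (simp only: slope_def) simp
  qed
  have t: "0 \<le> n * tau" using tau by simp
  have "K n y - K n x \<le> Lmax * (y - x) + 2 * h * (Lcrude g + \<bar>Lmax\<bar>)"
    by (rule lipschitz_chain_le[OF h K_lip[OF n] _ \<open>x \<le> y\<close>])
      (use slope_le_Lmax[OF n] h in \<open>simp add: K2\<close>)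
  then show "K n y - K n x \<le> Lmax * (y - x) + 2 * h * (Lcrude g + Lmax)" using Lmax_nonneg by simp
  have "(- K n y) - (- K n x) \<le> (- g) * (y - x) + 2 * h * (Lcrude g + \<bar>- g\<bar>)"
  proof (rule lipschitz_chain_le[OF h _ _ \<open>x \<le> y\<close>])
    show "\<bar>- K n x - - K n y\<bar> \<le> Lcrude g * \<bar>x - y\<bar>" for x y using K_lip[OF n, of x y] by simp
    show "- K n (x + 2 * h) - - K n x \<le> 2 * h * - g" for x
    proof -
      have "2 * h * g \<le> 2 * h * slope n (x + h)" using slope_ge(1)[OF n, of "x + h"] h by (intro mult_left_mono) auto
      then show ?thesis using K2[of x] by linarith
    qed
  qed
  then show "g * (y - x) - 2 * h * (Lcrude g + g) \<le> K n y - K n x" using g by simp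
  assume s: "s \<in> {1, -1}"
  have "(s * S 0 y (n * tau) - K n y) - (s * S 0 x (n * tau) - K n x) \<le> (B 2 * h) * (y - x) + 2 * h * ((Lcrude g + B 1) + \<bar>B 2 * h\<bar>)"
  proof (rule lipschitz_chain_le[OF h _ _ \<open>x \<le> y\<close>])
    show "\<bar>(s * S 0 x (n * tau) - K n x) - (s * S 0 y (n * tau) - K n y)\<bar> \<le> (Lcrude g + B 1) * \<bar>x - y\<bar>" for x y
      using K_lip[OF n, of x y] S_lipschitz[OF t t, of 0 x y] s by (auto simp: algebra_simps abs_le_iff)
    show "(s * S 0 (x + 2 * h) (n * tau) - K n (x + 2 * h)) - (s * S 0 x (n * tau) - K n x) \<le> 2 * h * (B 2 * h)" for x
    proof -
      have c: "\<bar>S 0 (x + 2 * h) (n * tau) - S 0 x (n * tau) - 2 * h * S 1 (x + h) (n * tau)\<bar> \<le> 2 * h * (B 2 * h)"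
        using S0_central[OF t, of "x + h"] by (simp add: algebra_simps)
      have "2 * h * \<bar>S 1 (x + h) (n * tau)\<bar> \<le> K n (x + 2 * h) - K n x"
        unfolding K2 using slope_ge(2)[OF n, of "x + h"] h by (intro mult_left_mono) auto
      then have "2 * h * S 1 (x + h) (n * tau) \<le> K n (x + 2 * h) - K n x" "- (2 * h * S 1 (x + h) (n * tau)) \<le> K n (x + 2 * h) - K n x"
        using mult_left_mono[OF abs_ge_self[of "S 1 (x + h) (n * tau)"], of "2 * h"]
          mult_left_mono[OF abs_ge_minus_self[of "S 1 (x + h) (n * tau)"], of "2 * h"] h
        by (auto simp del: mult_le_cancel_left_pos intro: order_trans[rotated])
      with c s show ?thesis by (auto simp: abs_le_iff)
    qed
  qed
  then show "s * (S 0 y (n * tau) - S 0 x (n * tau)) - B 2 * h * (y - x)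
      - 2 * h * (Lcrude g + B 1 + B 2 * h) \<le> K n y - K n x"
    using B_nonneg[of 2] h by (simp add: algebra_simps)
qed

text \<open>About 0 and 1 the central slope of a point-symmetric function is even while
  \<open>G\<close> is odd, so the symmetry passes from level to level. The centre of symmetry is a
  fixed point of the reflection, which pins the lateral values.\<close>

lemma K_reflect: "K n (- x) = 2 * k0 0 - K n x" "K n (2 - x) = 2 * (k0 1 + g * (2 + T)) - K n x"
proof -
  have "K n (2 * c - x) = 2 * d - K n x"
    if k: "\<And>x. K 0 (2 * c - x) = 2 * d - K 0 x" and r: "\<And>x t. 0 \<le> t \<Longrightarrow> G (2 * c - x) t = - G x t" for c d x
  proof (induction n arbitrary: x)
    case (Suc n)
    have e: "K n (2 * c - x + h) = 2 * d - K n (x - h)" "K n (2 * c - x - h) = 2 * d - K n (x + h)"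
      using Suc[of "x - h"] Suc[of "x + h"] by (simp_all add: algebra_simps)
    then have "slope n (2 * c - x) = slope n x" by (simp add: slope_def)
    then show ?case unfolding K_Suc using e r[of "n * tau" x] tau by (simp add: field_simps)
  qed (rule k)
  from this[of 0 "k0 0" x] this[of 1 "k0 1 + g * (2 + T)" x]
  show "K n (- x) = 2 * k0 0 - K n x" "K n (2 - x) = 2 * (k0 1 + g * (2 + T)) - K n x"
    using k0_reflect0 k0_reflect1 G_reflect by (simp_all add: algebra_simps)
qed

lemma K_lateral: "K n 0 = k0 0" "K n 1 = k0 1 + g * (2 + T)"
  using K_reflect[of n 0] K_reflect(2)[of n 1] by simp_all

end

section \<open>Viscosity solutions and limits of the scheme\<close>

text \<open>The sets \<open>D n\<close> may be unions of time levels that miss \<open>z0\<close>; it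
  is enough that some points of theirs approach it. The quadratic strictness of the maximum then
  forces the maximisers to converge.\<close>

lemma perturbed_maxima_converge:
  fixes f :: "'a::metric_space \<Rightarrow> real"
  assumes f: "continuous_on C f" and "z0 \<in> C"
    and strict: "\<And>z. z \<in> C \<Longrightarrow> f z \<le> f z0 - (dist z z0)\<^sup>2"
    and D: "\<And>n. D n \<subseteq> C" "\<And>n. compact (D n)"
    and F: "\<And>n. continuous_on (D n) (F n)"
    and err: "\<And>e. 0 < e \<Longrightarrow> \<forall>\<^sub>F n in sequentially. \<forall>z\<in>D n. \<bar>F n z - f z\<bar> \<le> e"
    and w: "\<forall>\<^sub>F n in sequentially. w n \<in> D n" "w \<longlonglongrightarrow> z0"
  obtains z where "\<forall>\<^sub>F n in sequentially. z n \<in> D n \<and> (\<forall>y\<in>D n. F n y \<le> F n (z n))" "z \<longlonglongrightarrow> z0"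
proof -
  have "\<exists>z. D n \<noteq> {} \<longrightarrow> z \<in> D n \<and> (\<forall>y\<in>D n. F n y \<le> F n z)" for n
    using continuous_attains_sup[OF D(2) _ F] by blast
  then obtain z where z: "\<And>n. D n \<noteq> {} \<Longrightarrow> z n \<in> D n \<and> (\<forall>y\<in>D n. F n y \<le> F n (z n))" by metis
  have ev: "\<forall>\<^sub>F n in sequentially. z n \<in> D n \<and> (\<forall>y\<in>D n. F n y \<le> F n (z n))"
    using w(1) by (rule eventually_mono) (use z in blast)
  have "(\<lambda>n. f (w n)) \<longlonglongrightarrow> f z0"
    by (rule continuous_on_tendsto_compose[OF f w(2) \<open>z0 \<in> C\<close>])
      (use w(1) D(1) in \<open>auto elim!: eventually_mono\<close>)
  have "z \<longlonglongrightarrow> z0"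
  proof (rule tendstoI)
    fix e :: real assume "0 < e"
    \<comment> \<open>Three errors of size \<open>d\<close> enter: approximation at the maximiser,
      approximation at \<open>w n\<close>, and the gap between f at \<open>w n\<close> and at
      \<open>z0\<close>. So the squared distance stays below 3 e^2 / 4.\<close>
    define d where "d = e\<^sup>2 / 4"
    have "0 < d" using \<open>0 < e\<close> by (simp add: d_def)
    have "\<forall>\<^sub>F n in sequentially. dist (f (w n)) (f z0) < d"
      using tendstoD[OF \<open>(\<lambda>n. f (w n)) \<longlonglongrightarrow> f z0\<close> \<open>0 < d\<close>] .
    then show "\<forall>\<^sub>F n in sequentially. dist (z n) z0 < e"
      using ev err[OF \<open>0 < d\<close>] w(1)
    proof eventually_elim
      case (elim n)
      then have "\<bar>f (w n) - f z0\<bar> < d" "F n (w n) \<le> F n (z n)" "\<bar>F n (w n) - f (w n)\<bar> \<le> d" "\<bar>F n (z n) - f (z n)\<bar> \<le> d"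
        by (auto simp: dist_real_def)
      moreover have "f (z n) \<le> f z0 - (dist (z n) z0)\<^sup>2" using strict elim D(1) by blast
      ultimately have "(dist (z n) z0)\<^sup>2 < 3 * d" by linarith
      also have "\<dots> \<le> e\<^sup>2" by (simp add: d_def)
      finally show ?case using \<open>0 < e\<close> by (simp add: power2_less_imp_less)
    qed
  qed
  with ev that show ?thesis by blast
qed

text \<open>Sub- and supersolutions are treated together: \<open>s = 1\<close> for tests touching from above,
  \<open>s = -1\<close> from below.\<close>
lemma visc_solution_iff_signed:
  "visc_solution X F u \<longleftrightarrow> continuous_on X u \<and>
    (\<forall>s\<in>{1, -1}. \<forall>\<phi> \<phi>'. C1_test X \<phi> \<phi>' \<longrightarrow> (\<forall>z0\<in>X.
      (\<exists>e>0. \<forall>z\<in>X \<inter> ball z0 e. s * (u z - \<phi> z) \<le> s * (u z0 - \<phi> z0))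
      \<longrightarrow> s * F z0 (\<phi>' z0 (1, 0)) (\<phi>' z0 (0, 1)) \<le> 0))"
proof -
  have "(- 1 * (a - b) \<le> - 1 * (c - d)) \<longleftrightarrow> a - b \<ge> c - d" "(- 1 * y \<le> 0) \<longleftrightarrow> y \<ge> 0" for a b c d y :: real
    by auto
  then show ?thesis
    unfolding visc_solution_def visc_subsolution_def visc_supersolution_def
    by (simp only: ball_simps mult_1) blast
qed

text \<open>Makes a touching point strict while leaving the gradient of the test function at
  \<open>z0\<close> unchanged.\<close>

lemma C1_test_perturb:
  fixes s :: real
  assumes "C1_test X \<phi> \<phi>'"
  shows "C1_test X (\<lambda>z. \<phi> z + s * (dist z z0)\<^sup>2) (\<lambda>z v. \<phi>' z v + s * (2 * ((z - z0) \<bullet> v)))"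
proof -
  have "((\<lambda>z. s * (dist z z0)\<^sup>2) has_derivative (\<lambda>v. s * (2 * ((z - z0) \<bullet> v)))) (at z)" for z
    unfolding dist_norm power2_norm_eq_inner
    by (auto intro!: derivative_eq_intros simp: inner_commute)
  then show ?thesis
    using assms unfolding C1_test_def by (auto intro!: has_derivative_add continuous_intros)
qed

lemma C1_test_partial:
  assumes "C1_test X \<phi> \<phi>'" "(x, t) \<in> X"
  shows "((\<lambda>y. \<phi> (y, t)) has_real_derivative \<phi>' (x, t) (1, 0)) (at x)"
    "((\<lambda>s. \<phi> (x, s)) has_real_derivative \<phi>' (x, t) (0, 1)) (at t)"
proof -
  have d: "(\<phi> has_derivative \<phi>' (x, t)) (at (x, t))" using assms by (auto simp: C1_test_def)
  then interpret linear "\<phi>' (x, t)" by (rule has_derivative_linear)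
  have "((\<lambda>y. \<phi> (y, t)) has_derivative (\<lambda>v. \<phi>' (x, t) (v, 0))) (at x)"
    by (rule has_derivative_compose[of "\<lambda>y. (y, t)" "\<lambda>v. (v, 0)" x UNIV \<phi> "\<phi>' (x, t)", simplified])
      (auto intro!: derivative_eq_intros d)
  moreover have "(\<lambda>v. \<phi>' (x, t) (v, 0)) = (*) (\<phi>' (x, t) (1, 0))"
  proof
    show "\<phi>' (x, t) (v, 0) = \<phi>' (x, t) (1, 0) * v" for v using scaleR[of v "(1, 0)"] by (simp add: mult.commute)
  qed
  ultimately show "((\<lambda>y. \<phi> (y, t)) has_real_derivative \<phi>' (x, t) (1, 0)) (at x)"
    by (simp only: has_field_derivative_def)
  have "((\<lambda>s. \<phi> (x, s)) has_derivative (\<lambda>v. \<phi>' (x, t) (0, v))) (at t)"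
    by (rule has_derivative_compose[of "\<lambda>s. (x, s)" "\<lambda>v. (0, v)" t UNIV \<phi> "\<phi>' (x, t)", simplified])
      (auto intro!: derivative_eq_intros d)
  moreover have "(\<lambda>v. \<phi>' (x, t) (0, v)) = (*) (\<phi>' (x, t) (0, 1))"
  proof
    show "\<phi>' (x, t) (0, v) = \<phi>' (x, t) (0, 1) * v" for v using scaleR[of v "(0, 1)"] by (simp add: mult.commute)
  qed
  ultimately show "((\<lambda>s. \<phi> (x, s)) has_real_derivative \<phi>' (x, t) (0, 1)) (at t)"
    by (simp only: has_field_derivative_def)
qed

lemma C1_test_mvt:
  assumes \<phi>: "C1_test X \<phi> \<phi>'"
  shows "x < y \<Longrightarrow> {x..y} \<times> {t} \<subseteq> X \<Longrightarrow> \<exists>z. dist z (x, t) \<le> y - x \<and> \<phi> (y, t) - \<phi> (x, t) = (y - x) * \<phi>' z (1, 0)"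
    "t < s \<Longrightarrow> {x} \<times> {t..s} \<subseteq> X \<Longrightarrow> \<exists>z. dist z (x, t) \<le> s - t \<and> \<phi> (x, s) - \<phi> (x, t) = (s - t) * \<phi>' z (0, 1)"
proof -
  assume *: "x < y" "{x..y} \<times> {t} \<subseteq> X"
  have "\<exists>z. x < z \<and> z < y \<and> \<phi> (y, t) - \<phi> (x, t) = (y - x) * \<phi>' (z, t) (1, 0)"
    by (rule MVT2[OF *(1)]) (use * in \<open>auto intro!: C1_test_partial[OF \<phi>]\<close>)
  then obtain z where "x < z" "z < y" "\<phi> (y, t) - \<phi> (x, t) = (y - x) * \<phi>' (z, t) (1, 0)" by blast
  then show "\<exists>z. dist z (x, t) \<le> y - x \<and> \<phi> (y, t) - \<phi> (x, t) = (y - x) * \<phi>' z (1, 0)"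
    by (intro exI[of _ "(z, t)"]) (auto simp: dist_Pair_Pair dist_real_def)
next
  assume *: "t < s" "{x} \<times> {t..s} \<subseteq> X"
  have "\<exists>z. t < z \<and> z < s \<and> \<phi> (x, s) - \<phi> (x, t) = (s - t) * \<phi>' (x, z) (0, 1)"
    by (rule MVT2[OF *(1)]) (use * in \<open>auto intro!: C1_test_partial[OF \<phi>]\<close>)
  then obtain z where "t < z" "z < s" "\<phi> (x, s) - \<phi> (x, t) = (s - t) * \<phi>' (x, z) (0, 1)" by blast
  then show "\<exists>z. dist z (x, t) \<le> s - t \<and> \<phi> (x, s) - \<phi> (x, t) = (s - t) * \<phi>' z (0, 1)"
    by (intro exI[of _ "(x, z)"]) (auto simp: dist_Pair_Pair dist_real_def)
qed

lemma perturbed_local_max: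
  assumes "open X" "z0 \<in> X" "0 < e"
    and loc: "\<forall>z\<in>X \<inter> ball z0 e. s * (u z - \<phi> z) \<le> s * (u z0 - \<phi> z0)"
    and "s \<in> {1, -1::real}"
  obtains r where "0 < r" "cball z0 r \<subseteq> X"
    "\<And>z. z \<in> cball z0 r \<Longrightarrow> s * (u z - (\<phi> z + s * (dist z z0)\<^sup>2)) \<le> s * (u z0 - (\<phi> z0 + s * (dist z0 z0)\<^sup>2)) - (dist z z0)\<^sup>2"
proof -
  obtain r where r: "0 < r" "cball z0 r \<subseteq> X" using assms(1,2) by (meson open_contains_cball_eq)
  define q where "q = min r (e / 2)"
  have sub: "cball z0 q \<subseteq> cball z0 r" unfolding q_def by (rule subset_cball) simp
  show ?thesis
  proof (rule that[of q])
    show "0 < q" using r \<open>0 < e\<close> by (simp add: q_def)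
    show "cball z0 q \<subseteq> X" using sub r by simp
    fix z assume z: "z \<in> cball z0 q"
    then have "z \<in> X \<inter> ball z0 e" using sub r \<open>0 < e\<close> by (auto simp: q_def)
    then have "s * (u z - \<phi> z) \<le> s * (u z0 - \<phi> z0)" using loc by blast
    then show "s * (u z - (\<phi> z + s * (dist z z0)\<^sup>2)) \<le> s * (u z0 - (\<phi> z0 + s * (dist z0 z0)\<^sup>2)) - (dist z z0)\<^sup>2"
      using assms(5) by (auto simp: algebra_simps)
  qed
qed

text \<open>Used for the limit in \<open>g\<close>. In product form the equation is continuous in
  the gradient, so the vanishing lower bound on the slopes is harmless here.\<close>

lemma visc_solution_uniform_limit:
  fixes u :: "nat \<Rightarrow> real \<times> real \<Rightarrow> real"
  assumes "open X" and R: "continuous_on X R"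
    and sol: "\<And>n. visc_solution X (\<lambda>z p1 p2. p2 * p1 - R z) (u n)"
    and lim: "\<And>e. 0 < e \<Longrightarrow> \<forall>\<^sub>F n in sequentially. \<forall>z\<in>X. \<bar>u n z - v z\<bar> \<le> e"
    and v: "continuous_on X v"
  shows "visc_solution X (\<lambda>z p1 p2. p2 * p1 - R z) v"
  unfolding visc_solution_iff_signed
proof (intro conjI v ballI allI impI, elim exE conjE)
  fix s :: real and \<phi> :: "real \<times> real \<Rightarrow> real" and \<phi>' z0 e
  assume s: "s \<in> {1, -1}" and \<phi>: "C1_test X \<phi> \<phi>'" and z0: "z0 \<in> X" and "0 < e"
    and loc: "\<forall>z\<in>X \<inter> ball z0 e. s * (v z - \<phi> z) \<le> s * (v z0 - \<phi> z0)"
  define \<psi> where "\<psi> z = \<phi> z + s * (dist z z0)\<^sup>2" for z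
  define \<psi>' where "\<psi>' z w = \<phi>' z w + s * (2 * ((z - z0) \<bullet> w))" for z w
  have \<psi>: "C1_test X \<psi> \<psi>'" unfolding \<psi>_def \<psi>'_def by (rule C1_test_perturb[OF \<phi>])
  have c\<psi>: "continuous_on X \<psi>"
    using \<psi> by (auto simp: C1_test_def intro!: continuous_at_imp_continuous_on has_derivative_continuous)
  obtain r where r: "0 < r" "cball z0 r \<subseteq> X" 
    and strict: "\<And>z. z \<in> cball z0 r \<Longrightarrow> s * (v z - \<psi> z) \<le> s * (v z0 - \<psi> z0) - (dist z z0)\<^sup>2"
    unfolding \<psi>_def by (rule perturbed_local_max[OF \<open>open X\<close> z0 \<open>0 < e\<close> loc s]) blast
  have cu: "continuous_on X (u n)" for n using sol[of n] by (simp add: visc_solution_iff_signed)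
  obtain z where z: "\<forall>\<^sub>F n in sequentially. z n \<in> cball z0 r \<and> (\<forall>y\<in>cball z0 r. s * (u n y - \<psi> y) \<le> s * (u n (z n) - \<psi> (z n)))"
    and z_lim: "z \<longlonglongrightarrow> z0"
  proof (rule perturbed_maxima_converge[of "cball z0 r" "\<lambda>z. s * (v z - \<psi> z)" z0 "\<lambda>_. cball z0 r" "\<lambda>n z. s * (u n z - \<psi> z)" "\<lambda>_. z0"])
    show "continuous_on (cball z0 r) (\<lambda>z. s * (v z - \<psi> z))"
      by (intro continuous_intros continuous_on_subset[OF v] continuous_on_subset[OF c\<psi>] r)
    show "continuous_on (cball z0 r) (\<lambda>z. s * (u n z - \<psi> z))" for n
      by (intro continuous_intros continuous_on_subset[OF cu] continuous_on_subset[OF c\<psi>] r)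
    show "\<forall>\<^sub>F n in sequentially. \<forall>z\<in>cball z0 r. \<bar>s * (u n z - \<psi> z) - s * (v z - \<psi> z)\<bar> \<le> e" if "0 < e" for e
      using lim[OF that]
    proof eventually_elim
      case (elim n)
      show ?case
      proof
        fix z assume "z \<in> cball z0 r"
        then have "\<bar>u n z - v z\<bar> \<le> e" using elim r by blast
        then show "\<bar>s * (u n z - \<psi> z) - s * (v z - \<psi> z)\<bar> \<le> e" using s by (auto simp: abs_minus_commute)
      qed
    qed
  qed (use r strict that in auto)
  have "\<forall>\<^sub>F n in sequentially. z n \<in> ball z0 r" 
    using topological_tendstoD[OF z_lim open_ball, of z0 r] r by simp
  with z have ineq: "\<forall>\<^sub>F n in sequentially. s * (\<psi>' (z n) (0, 1) * \<psi>' (z n) (1, 0) - R (z n)) \<le> 0"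
  proof eventually_elim
    case (elim n)
    have "z n \<in> X" using elim(1) r by auto
    moreover have "\<exists>e>0. \<forall>y\<in>X \<inter> ball (z n) e. s * (u n y - \<psi> y) \<le> s * (u n (z n) - \<psi> (z n))"
    proof -
      obtain d where "0 < d" "ball (z n) d \<subseteq> ball z0 r" using elim(2) open_ball by (meson openE)
      then show ?thesis using elim(1) by (intro exI[of _ d]) (auto dest: less_imp_le)
    qed
    ultimately show ?case using sol[of n] \<psi> s unfolding visc_solution_iff_signed by blast
  qed
  have zX: "\<forall>\<^sub>F n in sequentially. z n \<in> X" using z by (rule eventually_mono) (use r in auto)
  have "(\<lambda>n. s * (\<psi>' (z n) (0, 1) * \<psi>' (z n) (1, 0) - R (z n))) \<longlonglongrightarrow> s * (\<psi>' z0 (0, 1) * \<psi>' z0 (1, 0) - R z0)"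
  proof (intro tendsto_intros)
    show "(\<lambda>n. \<psi>' (z n) (0, 1)) \<longlonglongrightarrow> \<psi>' z0 (0, 1)" "(\<lambda>n. \<psi>' (z n) (1, 0)) \<longlonglongrightarrow> \<psi>' z0 (1, 0)"
      using \<psi> continuous_on_tendsto_compose[OF _ z_lim z0 zX] by (auto simp: C1_test_def)
    show "(\<lambda>n. R (z n)) \<longlonglongrightarrow> R z0" by (rule continuous_on_tendsto_compose[OF R z_lim z0 zX])
  qed
  from tendsto_upperbound[OF this ineq] have "s * (\<psi>' z0 (0, 1) * \<psi>' z0 (1, 0) - R z0) \<le> 0" by simp
  then show "s * (\<phi>' z0 (0, 1) * \<phi>' z0 (1, 0) - R z0) \<le> 0" by (simp add: \<psi>'_def)
qed

section \<open>The mesh limit at fixed steepening\<close>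

locale scheme_limit = dislocation +
  fixes g :: real and h tau :: "nat \<Rightarrow> real" and N :: "nat \<Rightarrow> nat"
    and I :: "nat \<Rightarrow> real \<times> real \<Rightarrow> real" and kappa :: "real \<times> real \<Rightarrow> real"
  assumes schemes: "\<And>n. scheme S B T k0 L0 g (h n) (tau n)"
    and N_tau: "\<And>n. N n * tau n = T" and tau_lim: "tau \<longlonglongrightarrow> 0" and h_lim: "h \<longlonglongrightarrow> 0"
    and I_grid: "\<And>n k x. k \<le> N n \<Longrightarrow> I n (x, k * tau n) = kap g (h n) (tau n) k x"
    and I_cont: "\<And>n. continuous_on UNIV (I n)"
    and kappa_cont: "continuous_on ({0..1} \<times> {0..T}) kappa"
    and I_lim: "\<And>e. 0 < e \<Longrightarrow> \<forall>\<^sub>F n in sequentially. \<forall>z\<in>{0..1} \<times> {0..T}. \<bar>I n z - kappa z\<bar> \<le> e"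
begin

lemma g_pos: "0 < g" and tau_pos: "0 < tau n" and h_pos: "0 < h n"
  and cfl_n: "2 * A * tau n = g\<^sup>2 * h n"
  using scheme.g[OF schemes[of n]] scheme.tau[OF schemes[of n]] scheme.h[OF schemes[of n]] scheme.cfl[OF schemes[of n]]
  by auto

definition idx :: "nat \<Rightarrow> real \<Rightarrow> nat" where "idx n t = nat \<lfloor>t / tau n\<rfloor>"

lemma idx:
  assumes "t \<in> {0..T}"
  shows "idx n t \<le> N n" "idx n t * tau n \<le> t" "t \<le> idx n t * tau n + tau n"
proof -
  have r: "real (idx n t) = of_int \<lfloor>t / tau n\<rfloor>" using assms tau_pos[of n] by (simp add: idx_def)
  have "real (idx n t) \<le> t / tau n" unfolding r by (rule of_int_floor_le)
  then show 1: "idx n t * tau n \<le> t" using tau_pos[of n] by (simp add: pos_le_divide_eq)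
  have "t / tau n < real (idx n t) + 1" unfolding r by (rule real_of_int_floor_add_one_gt)
  then show "t \<le> idx n t * tau n + tau n" using tau_pos[of n] by (simp add: pos_divide_less_eq algebra_simps)
  have "real (idx n t) * tau n \<le> N n * tau n" using 1 assms N_tau[of n] by simp
  then show "idx n t \<le> N n" using tau_pos[of n] by simp
qed

lemma idx_lim: "t \<in> {0..T} \<Longrightarrow> (\<lambda>n. idx n t * tau n) \<longlonglongrightarrow> t"
proof -
  assume t: "t \<in> {0..T}"
  have l: "(\<lambda>n. t - tau n) \<longlonglongrightarrow> t" using tendsto_diff[OF tendsto_const tau_lim, of t] by simp
  have "t - tau n \<le> idx n t * tau n" for n using idx(3)[OF t, of n] by linarith
  then show ?thesis
    by (intro tendsto_sandwich[OF _ _ l tendsto_const] always_eventually allI) (use idx(2)[OF t] in blast)+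
qed

lemma kap_lim:
  assumes x: "x \<in> {0..1}" and t: "t \<in> {0..T}"
  shows "(\<lambda>n. kap g (h n) (tau n) (idx n t) x) \<longlonglongrightarrow> kappa (x, t)"
proof -
  have mem: "(x, idx n t * tau n) \<in> {0..1} \<times> {0..T}" for n
    using x t idx(2)[OF t, of n] tau_pos[of n] by auto
  have "(\<lambda>n. kappa (x, idx n t * tau n)) \<longlonglongrightarrow> kappa (x, t)"
    by (rule continuous_on_tendsto_compose[OF kappa_cont])
      (use x t mem in \<open>auto intro!: tendsto_intros idx_lim\<close>)
  moreover have "(\<lambda>n. I n (x, idx n t * tau n) - kappa (x, idx n t * tau n)) \<longlonglongrightarrow> 0"
  proof (rule tendstoI)
    fix e :: real assume "0 < e"
    then have "0 < e / 2" by simp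
    from I_lim[OF this] show "\<forall>\<^sub>F n in sequentially. dist (I n (x, idx n t * tau n) - kappa (x, idx n t * tau n)) 0 < e"
    proof eventually_elim
      case (elim n)
      then have "\<bar>I n (x, idx n t * tau n) - kappa (x, idx n t * tau n)\<bar> \<le> e / 2" using mem by blast
      then show ?case using \<open>0 < e\<close> by (simp add: dist_real_def)
    qed
  qed
  ultimately have "(\<lambda>n. (I n (x, idx n t * tau n) - kappa (x, idx n t * tau n)) + kappa (x, idx n t * tau n)) \<longlonglongrightarrow> 0 + kappa (x, t)"
    by (rule tendsto_add[rotated])
  then show ?thesis by (simp add: I_grid[OF idx(1)[OF t]])
qed

lemma kappa_increment:
  assumes xy: "x \<in> {0..1}" "y \<in> {0..1}" "x \<le> y" and t: "t \<in> {0..T}"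
  shows "kappa (y, t) - kappa (x, t) \<le> Lmax * (y - x)"
    and "g * (y - x) \<le> kappa (y, t) - kappa (x, t)"
    and "s \<in> {1, -1} \<Longrightarrow> s * (S 0 y t - S 0 x t) \<le> kappa (y, t) - kappa (x, t)"
proof -
  let ?k = "\<lambda>n x. kap g (h n) (tau n) (idx n t) x"
  have n: "real (idx n t) * tau n \<le> T" for n using idx(2)[OF t, of n] t by simp
  have d: "(\<lambda>n. ?k n y - ?k n x) \<longlonglongrightarrow> kappa (y, t) - kappa (x, t)" by (intro tendsto_intros kap_lim xy t)
  have "(\<lambda>n. Lmax * (y - x) + 2 * h n * (Lcrude g + Lmax)) \<longlonglongrightarrow> Lmax * (y - x) + 2 * 0 * (Lcrude g + Lmax)"
    by (intro tendsto_intros h_lim)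
  from LIMSEQ_le[OF d this] show "kappa (y, t) - kappa (x, t) \<le> Lmax * (y - x)"
    using scheme.K_increment(1)[OF schemes n xy(3)] by auto
  have "(\<lambda>n. g * (y - x) - 2 * h n * (Lcrude g + g)) \<longlonglongrightarrow> g * (y - x) - 2 * 0 * (Lcrude g + g)"
    by (intro tendsto_intros h_lim)
  from LIMSEQ_le[OF this d] show "g * (y - x) \<le> kappa (y, t) - kappa (x, t)"
    using scheme.K_increment(2)[OF schemes n xy(3)] by auto
  assume s: "s \<in> {1, -1}"
  have S0: "(\<lambda>n. S 0 z (idx n t * tau n)) \<longlonglongrightarrow> S 0 z t" for z
  proof -
    have "(\<lambda>n. (z, idx n t * tau n)) \<longlonglongrightarrow> (z, t)" by (intro tendsto_intros idx_lim t)
    from continuous_on_tendsto_compose[OF S_continuous[of 0] this] show ?thesis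
      using t tau_pos by (simp add: less_imp_le)
  qed
  have "(\<lambda>n. s * (S 0 y (idx n t * tau n) - S 0 x (idx n t * tau n)) - B 2 * h n * (y - x)
      - 2 * h n * (Lcrude g + B 1 + B 2 * h n))
    \<longlonglongrightarrow> s * (S 0 y t - S 0 x t) - B 2 * 0 * (y - x) - 2 * 0 * (Lcrude g + B 1 + B 2 * 0)"
    by (intro tendsto_intros h_lim S0)
  from LIMSEQ_le[OF this d] show "s * (S 0 y t - S 0 x t) \<le> kappa (y, t) - kappa (x, t)"
    using scheme.K_increment(3)[OF schemes n xy(3) s] by auto
qed

text \<open>The barrier is taken with x = y. The mesh goes to zero first, which removes the
  diffusion term for fixed \<open>eta\<close>, and then \<open>eta\<close> goes to zero, which
  removes the remaining dependence on \<open>g\<close>.\<close>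

lemma kappa_time_increment:
  assumes x: "x \<in> {0..1}" and t: "t \<in> {0..T}" "t' \<in> {0..T}" "t \<le> t'"
  shows "\<bar>kappa (x, t') - kappa (x, t)\<bar> \<le> B 2 * (t' - t)"
proof -
  have key: "s * (kappa (x, t') - kappa (x, t)) \<le> B 2 * (t' - t) + Lcrude g * eta / 2"
    if s: "s \<in> {1, -1}" and "0 < eta" for s eta
  proof -
    let ?k = "\<lambda>n t. kap g (h n) (tau n) (idx n t) x"
    have le: "s * (?k n t' - ?k n t) \<le> Lcrude g * eta / 2
        + Lcrude g * (T * (2 * A / g\<^sup>2) * tau n * (2 * A / g\<^sup>2)) / (2 * eta) + B 2 * (t' - t + tau n)" for n
    proof -
      have hn: "h n = 2 * A / g\<^sup>2 * tau n" using cfl_n[of n] g_pos by (simp add: field_simps)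
      have "idx n t \<le> idx n t'" unfolding idx_def using t tau_pos[of n] by (intro nat_mono floor_mono divide_right_mono) auto
      define m where "m = idx n t' - idx n t"
      have m: "idx n t' = idx n t + m" using \<open>idx n t \<le> idx n t'\<close> by (simp add: m_def)
      have mt: "m * tau n \<le> t' - t + tau n" "m * tau n \<le> T"
        using idx(2)[OF t(2), of n] idx(3)[OF t(1), of n] t tau_pos[of n] unfolding m
        by (auto simp: algebra_simps intro: order_trans[of _ "real (idx n t) * tau n + real m * tau n"])
      have "s * (kap g (h n) (tau n) (idx n t + m) x - ?k n t) \<le> Lcrude g * eta / 2
          + Lcrude g * ((x - x)\<^sup>2 + m * (h n)\<^sup>2) / (2 * eta) + B 2 * (m * tau n)"
        by (rule scheme.K_barrier[OF schemes _ \<open>0 < eta\<close> s]) (use idx(2)[OF t(2), of n] t in \<open>simp add: m\<close>)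
      also have "\<dots> \<le> Lcrude g * eta / 2
        + Lcrude g * (T * (2 * A / g\<^sup>2) * tau n * (2 * A / g\<^sup>2)) / (2 * eta) + B 2 * (t' - t + tau n)"
      proof (intro add_mono order_refl divide_right_mono mult_left_mono mt B_nonneg Lcrude_nonneg g_pos)
        \<comment> \<open>One factor \<open>tau n\<close> of h^2 is spent on m tau \<le> T; the
          other remains and tends to 0.\<close>
        have "m * (h n)\<^sup>2 = (m * tau n) * ((2 * A / g\<^sup>2) * tau n * (2 * A / g\<^sup>2))"
          unfolding hn by (simp add: power2_eq_square)
        also have "\<dots> \<le> T * ((2 * A / g\<^sup>2) * tau n * (2 * A / g\<^sup>2))"
          using mt(2) A_ge_1 tau_pos[of n] by (intro mult_right_mono) auto
        finally show "(x - x)\<^sup>2 + m * (h n)\<^sup>2 \<le> T * (2 * A / g\<^sup>2) * tau n * (2 * A / g\<^sup>2)" by (simp add: mult.assoc)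
      qed (use \<open>0 < eta\<close> in auto)
      finally show ?thesis by (simp add: m)
    qed
    have l1: "(\<lambda>n. s * (?k n t' - ?k n t)) \<longlonglongrightarrow> s * (kappa (x, t') - kappa (x, t))"
      by (intro tendsto_intros kap_lim x t)
    have l2: "(\<lambda>n. Lcrude g * eta / 2
        + Lcrude g * (T * (2 * A / g\<^sup>2) * tau n * (2 * A / g\<^sup>2)) / (2 * eta) + B 2 * (t' - t + tau n))
      \<longlonglongrightarrow> Lcrude g * eta / 2 + Lcrude g * (T * (2 * A / g\<^sup>2) * 0 * (2 * A / g\<^sup>2)) / (2 * eta) + B 2 * (t' - t + 0)"
      by (intro tendsto_intros tau_lim) (use \<open>0 < eta\<close> in auto)
    have "s * (kappa (x, t') - kappa (x, t)) \<le> Lcrude g * eta / 2 + Lcrude g * (T * (2 * A / g\<^sup>2) * 0 * (2 * A / g\<^sup>2)) / (2 * eta) + B 2 * (t' - t + 0)"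
      by (rule LIMSEQ_le[OF l1 l2]) (use le in blast)
    then show ?thesis by simp
  qed
  have key2: "s * (kappa (x, t') - kappa (x, t)) \<le> B 2 * (t' - t) + e" if "s \<in> {1, -1}" "0 < e" for s e
  proof -
    define eta where "eta = 2 * e / (Lcrude g + 1)"
    have L: "0 < Lcrude g + 1" using Lcrude_nonneg[OF g_pos] by simp
    then have "0 < eta" using that by (simp add: eta_def)
    have "Lcrude g * eta / 2 \<le> e" using L that by (simp add: eta_def field_simps)
    with key[OF that(1) \<open>0 < eta\<close>] show ?thesis by linarith
  qed
  have "s * (kappa (x, t') - kappa (x, t)) \<le> B 2 * (t' - t)" if "s \<in> {1, -1}" for s
    by (rule field_le_epsilon) (rule key2[OF that])
  from this[of 1] this[of "-1"] show ?thesis by auto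
qed

lemma kappa_initial: "x \<in> {0..1} \<Longrightarrow> kappa (x, 0) = k0 x + g * (2 + T) * x"
proof -
  assume "x \<in> {0..1}"
  then have "(\<lambda>n. kap g (h n) (tau n) (idx n 0) x) \<longlonglongrightarrow> kappa (x, 0)" using T_pos by (intro kap_lim) auto
  then have "(\<lambda>n::nat. k0 x + g * (2 + T) * x) \<longlonglongrightarrow> kappa (x, 0)" by (simp only: idx_def) simp
  then show ?thesis using LIMSEQ_unique[OF _ tendsto_const] by blast
qed

lemma kappa_lateral:
  assumes "t \<in> {0..T}"
  shows "kappa (0, t) = k0 0" "kappa (1, t) = k0 1 + g * (2 + T)"
proof -
  have "(\<lambda>n::nat. k0 0) \<longlonglongrightarrow> kappa (0, t)" "(\<lambda>n::nat. k0 1 + g * (2 + T)) \<longlonglongrightarrow> kappa (1, t)"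
    using kap_lim[of 0 t] kap_lim[of 1 t] assms by (simp_all only: scheme.K_lateral[OF schemes]) simp_all
  then show "kappa (0, t) = k0 0" "kappa (1, t) = k0 1 + g * (2 + T)"
    using LIMSEQ_unique[OF _ tendsto_const] by blast+
qed

text \<open>Since \<open>kappa\<close> grows at rate at least \<open>g\<close>, a test function
  touching it from above must do so to the right of the point, and one touching from below to the
  left. This permits division by the slope of the test function.\<close>

lemma test_slope_ge:
  assumes \<phi>: "((\<lambda>y. \<phi> (y, t)) has_real_derivative D) (at x)" and x: "0 < x" "x < 1" and t: "t \<in> {0..T}"
    and "0 < r" and s: "s \<in> {1, -1}"
    and loc: "\<And>y. \<bar>y - x\<bar> < r \<Longrightarrow> s * (kappa (y, t) - \<phi> (y, t)) \<le> s * (kappa (x, t) - \<phi> (x, t))"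
  shows "g \<le> D"
proof (rule ccontr)
  assume neg: "\<not> g \<le> D"
  have d: "((\<lambda>y. \<phi> (y, t) - g * y) has_real_derivative D - g) (at x)"
    by (auto intro!: derivative_eq_intros \<phi>)
  show False
  proof (cases "s = 1")
    case True
    obtain d where d: "0 < d" "\<And>k. 0 < k \<Longrightarrow> k < d \<Longrightarrow> \<phi> (x + k, t) - g * (x + k) < \<phi> (x, t) - g * x"
      using DERIV_neg_dec_right[OF d] neg by auto
    define k where "k = min (d / 2) (min (r / 2) (1 - x))"
    have k: "0 < k" "k < d" "k < r" "x + k \<le> 1" using d x \<open>0 < r\<close> by (auto simp: k_def)
    show False
      using d(2)[OF k(1,2)] loc[of "x + k"] kappa_increment(2)[of x "x + k" t] k x t True
      by (auto simp: algebra_simps)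
  next
    case False
    then have "s = -1" using s by auto
    obtain d where d: "0 < d" "\<And>k. 0 < k \<Longrightarrow> k < d \<Longrightarrow> \<phi> (x, t) - g * x < \<phi> (x - k, t) - g * (x - k)"
      using DERIV_neg_dec_left[OF d] neg by auto
    define k where "k = min (d / 2) (min (r / 2) x)"
    have k: "0 < k" "k < d" "k < r" "0 \<le> x - k" using d x \<open>0 < r\<close> by (auto simp: k_def)
    show False
      using d(2)[OF k(1,2)] loc[of "x - k"] kappa_increment(2)[of "x - k" x t] k x t \<open>s = -1\<close>
      by (auto simp: algebra_simps)
  qed
qed

text \<open>Shifting the test function to agree with the scheme at the new level, monotonicity lets
  it replace the two old values. The test slope \<open>q\<close> is a difference quotient and is
  only known to be at least g / 2; the factor 2 in the mesh condition is there for this.\<close>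

lemma discrete_test_inequality:
  assumes k: "Suc k \<le> N n" and s: "s \<in> {1, -1}"
    and q: "q = (\<psi> (x + h n, k * tau n) - \<psi> (x - h n, k * tau n)) / (2 * h n)" "g / 2 \<le> q"
    and max: "\<And>y. y \<in> {x - h n, x + h n} \<Longrightarrow> s * (kap g (h n) (tau n) k y - \<psi> (y, k * tau n))
       \<le> s * (kap g (h n) (tau n) (Suc k) x - \<psi> (x, Suc k * tau n))"
  shows "s * (\<psi> (x, Suc k * tau n) - (\<psi> (x + h n, k * tau n) + \<psi> (x - h n, k * tau n)) / 2
     - tau n * G x (k * tau n) / q) \<le> 0"
proof -
  interpret scheme S B T k0 L0 g "h n" "tau n" by (rule schemes)
  define C where "C = K (Suc k) x - \<psi> (x, Suc k * tau n)"
  define a b where "a = \<psi> (x + h n, k * tau n) + C" and "b = \<psi> (x - h n, k * tau n) + C"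
  have kT: "real k * tau n \<le> T"
  proof -
    have "real k * tau n \<le> N n * tau n" using k tau by (intro mult_right_mono) auto
    then show ?thesis using N_tau[of n] by simp
  qed
  have p: "g \<le> slope k x" by (rule slope_ge(1)[OF kT])
  have pos: "0 < slope k x" "0 < q" using p q(2) g by auto
  have qab: "q = (a - b) / (2 * h n)" by (simp add: q(1) a_def b_def)
  have "g * (g / 2) \<le> slope k x * q" using p q(2) g by (intro mult_mono) auto
  then have "g\<^sup>2 / 2 * h n \<le> h n * (slope k x * q)" using h by (simp add: power2_eq_square)
  then have c: "\<bar>tau n * G x (k * tau n)\<bar> \<le> h n * (slope k x * q)"
    using tau_G[of "k * tau n" x] tau by simp
  obtain m where m: "\<bar>m\<bar> \<le> 1/2"
    "((K k (x + h n) + K k (x - h n)) / 2 + tau n * G x (k * tau n) / slope k x) - ((a + b) / 2 + tau n * G x (k * tau n) / q)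
      = (K k (x + h n) - a) * (1/2 - m) + (K k (x - h n) - b) * (1/2 + m)"
    using step_difference[OF h slope_def qab pos c] by blast
  have "s * (K k (x + h n) - a) \<le> 0" "s * (K k (x - h n) - b) \<le> 0"
    using max[of "x + h n"] max[of "x - h n"] s by (auto simp: a_def b_def C_def)
  then have "(s * (K k (x + h n) - a)) * (1/2 - m) + (s * (K k (x - h n) - b)) * (1/2 + m) \<le> 0"
    by (rule weighted_bounds(1)[OF m(1)])
  also have "(s * (K k (x + h n) - a)) * (1/2 - m) + (s * (K k (x - h n) - b)) * (1/2 + m)
    = s * (K (Suc k) x - ((a + b) / 2 + tau n * G x (k * tau n) / q))"
    unfolding K_Suc m(2) by (simp add: algebra_simps)
  also have "K (Suc k) x - ((a + b) / 2 + tau n * G x (k * tau n) / q) = 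
      \<psi> (x, Suc k * tau n) - (\<psi> (x + h n, k * tau n) + \<psi> (x - h n, k * tau n)) / 2
     - tau n * G x (k * tau n) / q"
    by (simp add: a_def b_def C_def field_simps)
  finally show ?thesis .
qed

end

section \<open>Existence by compactness\<close>

lemma eventually_choice:
  assumes "\<forall>\<^sub>F n in F. \<exists>y. P n y"
  obtains f where "\<forall>\<^sub>F n in F. P n (f n)"
  by (rule that[of "\<lambda>n. SOME y. P n y"]) (use assms in \<open>auto elim!: eventually_mono intro: someI\<close>)

context scheme_limit
begin

text \<open>The argument for monotone and consistent schemes: perturbed maxima of the approximations
  approach the touching point, the test function inherits the discrete inequality there, and
  consistency passes to the limit.\<close>

theorem kappa_viscosity:
  "visc_solution ({0<..<1} \<times> {0<..<T}) (\<lambda>z p1 p2. p2 * p1 - G (fst z) (snd z)) kappa"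
  unfolding visc_solution_iff_signed
proof (intro conjI ballI allI impI, goal_cases)
  case 1
  show ?case by (rule continuous_on_subset[OF kappa_cont]) auto
next
  case (2 s \<phi> \<phi>' z0)
  define X where "X = {0<..<1::real} \<times> {0<..<T}"
  have s: "s \<in> {1, -1}" and \<phi>: "C1_test X \<phi> \<phi>'" and z0: "z0 \<in> X" using 2 by (auto simp: X_def)
  obtain e where "0 < e" and loc: "\<forall>z\<in>X \<inter> ball z0 e. s * (kappa z - \<phi> z) \<le> s * (kappa z0 - \<phi> z0)"
    using 2(4) unfolding X_def by blast
  have "open X" unfolding X_def by (intro open_Times) auto
  have X_sub: "X \<subseteq> {0..1} \<times> {0..T}" by (auto simp: X_def)
  define x0 t0 where "x0 = fst z0" and "t0 = snd z0"
  have z0_eq: "z0 = (x0, t0)" by (simp add: x0_def t0_def)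
  have x0: "0 < x0" "x0 < 1" and t0: "0 < t0" "t0 < T" using z0 by (auto simp: X_def z0_eq)
  define \<psi> where "\<psi> z = \<phi> z + s * (dist z z0)\<^sup>2" for z
  define \<psi>' where "\<psi>' z w = \<phi>' z w + s * (2 * ((z - z0) \<bullet> w))" for z w
  have \<psi>: "C1_test X \<psi> \<psi>'" unfolding \<psi>_def \<psi>'_def by (rule C1_test_perturb[OF \<phi>])
  have c\<psi>: "continuous_on X \<psi>"
    using \<psi> by (auto simp: C1_test_def intro!: continuous_at_imp_continuous_on has_derivative_continuous)
  obtain r where r: "0 < r" "cball z0 r \<subseteq> X" 
    and strict: "\<And>z. z \<in> cball z0 r \<Longrightarrow> s * (kappa z - \<psi> z) \<le> s * (kappa z0 - \<psi> z0) - (dist z z0)\<^sup>2"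
    unfolding \<psi>_def by (rule perturbed_local_max[OF \<open>open X\<close> z0 \<open>0 < e\<close> loc s]) blast
  \<comment> \<open>Maxima are sought on the time levels only, where \<open>I n\<close> coincides
    with the scheme; space remains continuous.\<close>
  define D where "D n = {z \<in> cball z0 r. \<exists>k\<le>N n. snd z = k * tau n}" for n
  have D_sub: "D n \<subseteq> cball z0 r" for n by (auto simp: D_def)
  have w_lim: "(\<lambda>n. (x0, idx n t0 * tau n)) \<longlonglongrightarrow> z0"
    unfolding z0_eq using t0 by (intro tendsto_intros idx_lim) auto
  obtain z where z: "\<forall>\<^sub>F n in sequentially. z n \<in> D n \<and> (\<forall>y\<in>D n. s * (I n y - \<psi> y) \<le> s * (I n (z n) - \<psi> (z n)))"
    and z_lim: "z \<longlonglongrightarrow> z0"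
  proof (rule perturbed_maxima_converge[of "cball z0 r" "\<lambda>z. s * (kappa z - \<psi> z)" z0 D "\<lambda>n z. s * (I n z - \<psi> z)" "\<lambda>n. (x0, idx n t0 * tau n)"])
    show "continuous_on (cball z0 r) (\<lambda>z. s * (kappa z - \<psi> z))"
      using r(2) X_sub by (intro continuous_intros continuous_on_subset[OF kappa_cont] continuous_on_subset[OF c\<psi>]) auto
    show "continuous_on (D n) (\<lambda>z. s * (I n z - \<psi> z))" for n
      using r(2) D_sub[of n] by (intro continuous_intros continuous_on_subset[OF I_cont] continuous_on_subset[OF c\<psi>]) auto
    show "compact (D n)" for n
    proof -
      have "D n = cball z0 r \<inter> (\<Union>k\<in>{..N n}. {z. snd z = k * tau n})" by (auto simp: D_def)
      also have "compact \<dots>"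
        by (intro compact_Int_closed compact_cball closed_UN finite_atMost ballI closed_Collect_eq continuous_intros)
      finally show ?thesis .
    qed
    show "\<forall>\<^sub>F n in sequentially. \<forall>z\<in>D n. \<bar>s * (I n z - \<psi> z) - s * (kappa z - \<psi> z)\<bar> \<le> e" if "0 < e" for e
      using I_lim[OF that]
    proof eventually_elim
      case (elim n)
      show ?case
      proof
        fix z assume "z \<in> D n"
        then have "\<bar>I n z - kappa z\<bar> \<le> e" using elim r D_sub[of n] X_sub by blast
        then show "\<bar>s * (I n z - \<psi> z) - s * (kappa z - \<psi> z)\<bar> \<le> e" using s by (auto simp: abs_minus_commute)
      qed
    qed
    show "\<forall>\<^sub>F n in sequentially. (x0, idx n t0 * tau n) \<in> D n"
      using topological_tendstoD[OF w_lim open_ball, of z0 r, OF centre_in_ball[THEN iffD2, OF r(1)]]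
    proof eventually_elim
      case (elim n)
      have "idx n t0 \<le> N n" using t0 by (intro idx(1)) auto
      then show ?case unfolding D_def mem_Collect_eq snd_conv using elim by (intro conjI exI[of _ "idx n t0"]) auto
    qed
  qed (use r strict D_sub that w_lim in auto)
  \<comment> \<open>A common measure of mesh size: all points of the stencil, and the intermediate
    points of the mean value theorem, lie within 3 q of the maximiser.\<close>
  define q where "q n = h n + tau n" for n
  have q_lim: "q \<longlonglongrightarrow> 0" using tendsto_add[OF h_lim tau_lim] by (simp add: q_def[abs_def])
  have dz: "(\<lambda>n. dist (z n) z0) \<longlonglongrightarrow> 0" using z_lim by (rule tendsto_dist_iff[THEN iffD1])
  have q_dz: "(\<lambda>n. 3 * q n + dist (z n) z0) \<longlonglongrightarrow> 0"
    using tendsto_add[OF tendsto_mult[OF tendsto_const q_lim] dz, of 3] by simp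
  have near: "y \<longlonglongrightarrow> z0" if "\<forall>\<^sub>F n in sequentially. dist (y n) (z n) \<le> 3 * q n" for y
  proof -
    have "\<forall>\<^sub>F n in sequentially. norm (dist (y n) z0) \<le> 3 * q n + dist (z n) z0"
      using that
    proof eventually_elim
      case (elim n)
      show ?case using elim dist_triangle[of "y n" z0 "z n"] by simp
    qed
    from Lim_null_comparison[OF this q_dz] show ?thesis by (rule tendsto_dist_iff[THEN iffD2])
  qed
  have in_ball: "\<forall>\<^sub>F n in sequentially. 3 * q n + dist (z n) z0 < r"
    using order_tendstoD(2)[OF q_dz r(1)] .
  \<comment> \<open>The maximiser must have a preceding time level. It eventually does, since its
    time tends to t0 > 0 and so is not level 0.\<close>
  define Q where "Q n k x \<longleftrightarrow> z n = (x, real (Suc k) * tau n) \<and> Suc k \<le> N n" for n k and x :: real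
  have "\<forall>\<^sub>F n in sequentially. \<exists>p. Q n (fst p) (snd p)"
  proof -
    have "(\<lambda>n. snd (z n)) \<longlonglongrightarrow> t0" using tendsto_snd[OF z_lim] by (simp add: t0_def)
    then have "\<forall>\<^sub>F n in sequentially. 0 < snd (z n)" using t0 order_tendstoD(1) by blast
    with z show ?thesis
    proof eventually_elim
      case (elim n)
      then obtain k where k: "k \<le> N n" "snd (z n) = k * tau n" by (auto simp: D_def)
      then have "k \<noteq> 0" using elim by (cases k) auto
      then obtain k' where "k = Suc k'" by (cases k) auto
      then show ?case using k by (intro exI[of _ "(k', fst (z n))"]) (auto simp: Q_def prod_eq_iff)
    qed
  qed
  then obtain p where p: "\<forall>\<^sub>F n in sequentially. Q n (fst (p n)) (snd (p n))" by (rule eventually_choice)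
  define k where "k n = fst (p n)" for n
  define x where "x n = snd (p n)" for n
  define t where "t n = k n * tau n" for n
  have kx: "\<forall>\<^sub>F n in sequentially. z n = (x n, t n + tau n) \<and> Suc (k n) \<le> N n"
    using p by (rule eventually_mono) (auto simp: Q_def k_def x_def t_def algebra_simps)
  have box: "dist (y, u) (z n) \<le> 3 * q n" if "z n = (x n, t n + tau n)" "\<bar>y - x n\<bar> \<le> h n" "\<bar>u - (t n + tau n)\<bar> \<le> tau n" for n y u
  proof -
    have "dist (y, u) (z n) \<le> \<bar>y - x n\<bar> + \<bar>u - (t n + tau n)\<bar>"
      unfolding that(1) dist_Pair_Pair dist_real_def using sqrt_sum_squares_le_sum_abs[of "\<bar>y - x n\<bar>" "\<bar>u - (t n + tau n)\<bar>"] by simp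
    also have "\<dots> \<le> 3 * q n" using that h_pos[of n] tau_pos[of n] by (simp add: q_def)
    finally show ?thesis .
  qed
  have boxX: "\<forall>\<^sub>F n in sequentially. \<forall>y u. \<bar>y - x n\<bar> \<le> h n \<longrightarrow> \<bar>u - (t n + tau n)\<bar> \<le> tau n \<longrightarrow> (y, u) \<in> cball z0 r"
    using kx in_ball
  proof eventually_elim
    case (elim n)
    show ?case
    proof (intro allI impI)
      fix y u assume *: "\<bar>y - x n\<bar> \<le> h n" "\<bar>u - (t n + tau n)\<bar> \<le> tau n"
      have "dist (y, u) (z n) \<le> 3 * q n" using elim * by (intro box) auto
      then have "dist (y, u) z0 \<le> r" using elim(2) dist_triangle[of "(y, u)" z0 "z n"] by linarith
      then show "(y, u) \<in> cball z0 r" by (simp add: dist_commute)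
    qed
  qed
  have "\<forall>\<^sub>F n in sequentially. \<exists>y. dist y (z n) \<le> 3 * q n \<and> \<psi> (x n, t n + tau n) - \<psi> (x n, t n) = tau n * \<psi>' y (0, 1)"
    using kx boxX
  proof eventually_elim
    case (elim n)
    have "{x n} \<times> {t n..t n + tau n} \<subseteq> X" using elim(2) r(2) h_pos[of n] by force
    then obtain y where y: "dist y (x n, t n) \<le> tau n" "\<psi> (x n, t n + tau n) - \<psi> (x n, t n) = tau n * \<psi>' y (0, 1)"
      using C1_test_mvt(2)[OF \<psi>, of "t n" "t n + tau n" "x n"] tau_pos[of n] by auto
    have "dist (x n, t n) (z n) \<le> tau n" using elim(1) tau_pos[of n] by (simp add: dist_Pair_Pair dist_real_def)
    then have "dist y (z n) \<le> 3 * q n" using y(1) dist_triangle[of y "z n" "(x n, t n)"] h_pos[of n] tau_pos[of n] by (simp add: q_def)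
    with y show ?case by blast
  qed
  then obtain y where y: "\<forall>\<^sub>F n in sequentially. dist (y n) (z n) \<le> 3 * q n \<and> \<psi> (x n, t n + tau n) - \<psi> (x n, t n) = tau n * \<psi>' (y n) (0, 1)"
    by (rule eventually_choice)
  \<comment> \<open>The test function is only C1, so no second-order expansion is available. Mean
    values at converging points replace it, on the left half, the right half and the whole of the
    stencil.\<close>
  have horizontal: "\<forall>\<^sub>F n in sequentially. \<exists>y. dist y (z n) \<le> 3 * q n \<and>
      \<psi> (x n + b * h n, t n) - \<psi> (x n + a * h n, t n) = (b - a) * h n * \<psi>' y (1, 0)" if ab: "-1 \<le> a" "a < b" "b \<le> 1" for a b
    using kx boxX
  proof eventually_elim
    case (elim n)
    have abh: "- h n \<le> a * h n" "a * h n < b * h n" "b * h n \<le> h n"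
      using ab h_pos[of n] mult_right_mono[of "-1" a "h n"] mult_right_mono[of b 1 "h n"] by auto
    have "{x n + a * h n..x n + b * h n} \<times> {t n} \<subseteq> X"
    proof
      fix v assume "v \<in> {x n + a * h n..x n + b * h n} \<times> {t n}"
      then obtain y where v: "v = (y, t n)" "x n + a * h n \<le> y" "y \<le> x n + b * h n" by auto
      then have "\<bar>y - x n\<bar> \<le> h n" using abh by auto
      then show "v \<in> X" using elim(2) r(2) tau_pos[of n] v(1) by auto
    qed
    then obtain y where y: "dist y (x n + a * h n, t n) \<le> (x n + b * h n) - (x n + a * h n)"
       "\<psi> (x n + b * h n, t n) - \<psi> (x n + a * h n, t n) = ((x n + b * h n) - (x n + a * h n)) * \<psi>' y (1, 0)"
      using C1_test_mvt(1)[OF \<psi>, of "x n + a * h n" "x n + b * h n" "t n"] abh by auto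
    have "dist (x n + a * h n, t n) (z n) \<le> \<bar>a * h n\<bar> + tau n"
      using elim(1) tau_pos[of n] sqrt_sum_squares_le_sum_abs[of "\<bar>a * h n\<bar>" "tau n"] by (simp add: dist_Pair_Pair dist_real_def)
    moreover have "\<bar>a * h n\<bar> \<le> h n" using abh by auto
    ultimately have "dist y (z n) \<le> 3 * q n"
      using y(1) dist_triangle[of y "z n" "(x n + a * h n, t n)"] h_pos[of n] tau_pos[of n] abh by (simp add: q_def)
    with y(2) show ?case by (intro exI[of _ y]) (simp add: algebra_simps)
  qed
  obtain y1 where y1: "\<forall>\<^sub>F n in sequentially. dist (y1 n) (z n) \<le> 3 * q n \<and>
      \<psi> (x n + h n, t n) - \<psi> (x n, t n) = h n * \<psi>' (y1 n) (1, 0)"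
    using horizontal[of 0 1] by (auto elim!: eventually_choice)
  obtain y2 where y2: "\<forall>\<^sub>F n in sequentially. dist (y2 n) (z n) \<le> 3 * q n \<and>
      \<psi> (x n, t n) - \<psi> (x n - h n, t n) = h n * \<psi>' (y2 n) (1, 0)"
    using horizontal[of "-1" 0] by (auto elim!: eventually_choice)
  obtain y3 where y3: "\<forall>\<^sub>F n in sequentially. dist (y3 n) (z n) \<le> 3 * q n \<and>
      \<psi> (x n + h n, t n) - \<psi> (x n - h n, t n) = 2 * h n * \<psi>' (y3 n) (1, 0)"
    using horizontal[of "-1" 1] by (auto elim!: eventually_choice)
  have lims: "y \<longlonglongrightarrow> z0" "y1 \<longlonglongrightarrow> z0" "y2 \<longlonglongrightarrow> z0" "y3 \<longlonglongrightarrow> z0"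
    by (intro near; use y y1 y2 y3 in \<open>auto elim: eventually_mono\<close>)+
  have \<psi>t: "(\<lambda>n. \<psi>' (v n) (0, 1)) \<longlonglongrightarrow> \<psi>' z0 (0, 1)" and \<psi>x: "(\<lambda>n. \<psi>' (v n) (1, 0)) \<longlonglongrightarrow> \<psi>' z0 (1, 0)"
    if "v \<longlonglongrightarrow> z0" for v
    using \<psi> continuous_on_tendsto_compose[OF _ that z0 topological_tendstoD[OF that \<open>open X\<close> z0]] by (auto simp: C1_test_def)
  have slope: "g \<le> \<psi>' z0 (1, 0)"
  proof (rule test_slope_ge)
    show "((\<lambda>y. \<psi> (y, t0)) has_real_derivative \<psi>' z0 (1, 0)) (at x0)"
      using C1_test_partial(1)[OF \<psi>, of x0 t0] z0 by (simp add: z0_eq)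
    show "s * (kappa (y, t0) - \<psi> (y, t0)) \<le> s * (kappa (x0, t0) - \<psi> (x0, t0))" if "\<bar>y - x0\<bar> < r" for y
    proof -
      have "(y, t0) \<in> cball z0 r" using that by (simp add: z0_eq dist_Pair_Pair dist_real_def abs_minus_commute)
      from strict[OF this] show ?thesis using zero_le_power2[of "dist (y, t0) z0"] unfolding z0_eq by linarith
    qed
  qed (use x0 t0 r s in auto)
  then have pos: "0 < \<psi>' z0 (1, 0)" using g_pos by linarith
  have "g / 2 < \<psi>' z0 (1, 0)" using slope g_pos by linarith
  then have steep: "\<forall>\<^sub>F n in sequentially. g / 2 < \<psi>' (y3 n) (1, 0)" using order_tendstoD(1)[OF \<psi>x[OF lims(4)]] by blast
  \<comment> \<open>The discrete inequality divided by \<open>tau\<close>. The numerical diffusion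
    appears as A / g^2, that is h / (2 tau), times a difference of two first derivatives at points
    with the same limit, so it vanishes although h / tau stays fixed.\<close>
  have ineq: "\<forall>\<^sub>F n in sequentially. s * (\<psi>' (y n) (0, 1) - A / g\<^sup>2 * (\<psi>' (y1 n) (1, 0) - \<psi>' (y2 n) (1, 0))
      - G (x n) (t n) / \<psi>' (y3 n) (1, 0)) \<le> 0"
    using kx boxX z steep y y1 y2 y3
  proof eventually_elim
    case (elim n)
    note kx = elim(1) and box = elim(2) and zmax = elim(3) and st = elim(4)
    have eq: "\<psi> (x n, t n + tau n) - \<psi> (x n, t n) = tau n * \<psi>' (y n) (0, 1)"
      "\<psi> (x n + h n, t n) - \<psi> (x n, t n) = h n * \<psi>' (y1 n) (1, 0)"
      "\<psi> (x n, t n) - \<psi> (x n - h n, t n) = h n * \<psi>' (y2 n) (1, 0)"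
      "\<psi> (x n + h n, t n) - \<psi> (x n - h n, t n) = 2 * h n * \<psi>' (y3 n) (1, 0)"
      using elim by auto
    have st1: "real (Suc (k n)) * tau n = t n + tau n" by (simp add: t_def algebra_simps)
    have "s * (\<psi> (x n, Suc (k n) * tau n) - (\<psi> (x n + h n, k n * tau n) + \<psi> (x n - h n, k n * tau n)) / 2
       - tau n * G (x n) (k n * tau n) / \<psi>' (y3 n) (1, 0)) \<le> 0"
    proof (rule discrete_test_inequality[OF _ s])
      show "Suc (k n) \<le> N n" using kx by simp
      show "\<psi>' (y3 n) (1, 0) = (\<psi> (x n + h n, k n * tau n) - \<psi> (x n - h n, k n * tau n)) / (2 * h n)"
        using eq(4) h_pos[of n] by (simp add: t_def)
      show "g / 2 \<le> \<psi>' (y3 n) (1, 0)" using st by simp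
      fix v assume v: "v \<in> {x n - h n, x n + h n}"
      have "(v, t n) \<in> D n"
        unfolding D_def using box v h_pos[of n] tau_pos[of n] kx by (auto simp: t_def intro!: exI[of _ "k n"])
      then have "s * (I n (v, t n) - \<psi> (v, t n)) \<le> s * (I n (z n) - \<psi> (z n))" using zmax by blast
      then show "s * (kap g (h n) (tau n) (k n) v - \<psi> (v, k n * tau n))
         \<le> s * (kap g (h n) (tau n) (Suc (k n)) (x n) - \<psi> (x n, Suc (k n) * tau n))"
        using kx I_grid[of "k n" n v] I_grid[of "Suc (k n)" n "x n"] unfolding st1 by (simp add: t_def)
    qed
    also have "\<psi> (x n, Suc (k n) * tau n) - (\<psi> (x n + h n, k n * tau n) + \<psi> (x n - h n, k n * tau n)) / 2
       - tau n * G (x n) (k n * tau n) / \<psi>' (y3 n) (1, 0)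
      = tau n * (\<psi>' (y n) (0, 1) - A / g\<^sup>2 * (\<psi>' (y1 n) (1, 0) - \<psi>' (y2 n) (1, 0)) - G (x n) (t n) / \<psi>' (y3 n) (1, 0))"
    proof -
      have hn: "h n = tau n * (2 * (A / g\<^sup>2))" using cfl_n[of n] g_pos by (simp add: field_simps)
      have "\<psi> (x n, t n + tau n) = \<psi> (x n, t n) + tau n * \<psi>' (y n) (0, 1)"
        "\<psi> (x n + h n, t n) = \<psi> (x n, t n) + h n * \<psi>' (y1 n) (1, 0)"
        "\<psi> (x n - h n, t n) = \<psi> (x n, t n) - h n * \<psi>' (y2 n) (1, 0)"
        using eq(1-3) by linarith+
      then have "\<psi> (x n, t n + tau n) - (\<psi> (x n + h n, t n) + \<psi> (x n - h n, t n)) / 2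
        = tau n * \<psi>' (y n) (0, 1) - h n / 2 * (\<psi>' (y1 n) (1, 0) - \<psi>' (y2 n) (1, 0))"
        by (simp add: field_simps)
      also have "h n / 2 = tau n * (A / g\<^sup>2)" using hn by simp
      finally show ?thesis unfolding st1 t_def[symmetric] by (simp add: algebra_simps)
    qed
    finally have "tau n * (s * (\<psi>' (y n) (0, 1) - A / g\<^sup>2 * (\<psi>' (y1 n) (1, 0) - \<psi>' (y2 n) (1, 0)) - G (x n) (t n) / \<psi>' (y3 n) (1, 0))) \<le> 0"
      by (simp only: mult.left_commute)
    then show ?case using tau_pos[of n] by (simp only: mult_le_0_iff) auto
  qed
  have "(\<lambda>n. (x n, t n)) \<longlonglongrightarrow> z0"
  proof (rule near)
    show "\<forall>\<^sub>F n in sequentially. dist (x n, t n) (z n) \<le> 3 * q n"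
      using kx
    proof eventually_elim
      case (elim n)
      show ?case by (rule box) (use elim h_pos[of n] tau_pos[of n] in auto)
    qed
  qed
  moreover have "\<forall>\<^sub>F n in sequentially. (x n, t n) \<in> UNIV \<times> {0..}"
    using tau_pos by (auto simp: t_def less_imp_le)
  ultimately have Glim: "(\<lambda>n. G (x n) (t n)) \<longlonglongrightarrow> G x0 t0"
    using continuous_on_tendsto_compose[OF G_continuous, of "\<lambda>n. (x n, t n)" z0] t0 by (simp add: z0_eq)
  have "(\<lambda>n. s * (\<psi>' (y n) (0, 1) - A / g\<^sup>2 * (\<psi>' (y1 n) (1, 0) - \<psi>' (y2 n) (1, 0)) - G (x n) (t n) / \<psi>' (y3 n) (1, 0)))
    \<longlonglongrightarrow> s * (\<psi>' z0 (0, 1) - A / g\<^sup>2 * (\<psi>' z0 (1, 0) - \<psi>' z0 (1, 0)) - G x0 t0 / \<psi>' z0 (1, 0))"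
    by (intro tendsto_intros \<psi>t \<psi>x lims Glim) (use pos in auto)
  from tendsto_upperbound[OF this ineq] have "s * (\<psi>' z0 (0, 1) - G x0 t0 / \<psi>' z0 (1, 0)) \<le> 0" by simp
  \<comment> \<open>The slope is positive by \<open>test_slope_ge\<close>, so multiplication by it
    restores the product form with its sign.\<close>
  then have "\<psi>' z0 (1, 0) * (s * (\<psi>' z0 (0, 1) - G x0 t0 / \<psi>' z0 (1, 0))) \<le> 0"
    using pos by (simp only: mult_le_0_iff) auto
  also have "\<psi>' z0 (1, 0) * (s * (\<psi>' z0 (0, 1) - G x0 t0 / \<psi>' z0 (1, 0))) = s * (\<psi>' z0 (0, 1) * \<psi>' z0 (1, 0) - G x0 t0)"
    using pos by (simp add: field_simps)
  finally show ?case by (simp add: \<psi>'_def z0_eq)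
qed

end

text \<open>A lower envelope of cones in time over the levels. The time step bound makes it exact on
  each level, and a minimum of functions with the same Lipschitz constants in \<open>x\<close> and
  \<open>t\<close> keeps these constants.\<close>

lemma time_interpolation:
  fixes k :: "nat \<Rightarrow> real \<Rightarrow> real"
  assumes "0 \<le> M'" and x: "\<And>n x y. n \<le> N \<Longrightarrow> \<bar>k n x - k n y\<bar> \<le> M * \<bar>x - y\<bar>"
    and t: "\<And>n x. n < N \<Longrightarrow> \<bar>k (Suc n) x - k n x\<bar> \<le> M' * tau" and "0 < tau"
  obtains J :: "real \<times> real \<Rightarrow> real" where "\<And>n x. n \<le> N \<Longrightarrow> J (x, n * tau) = k n x"
    "\<And>x y t s. \<bar>J (x, t) - J (y, s)\<bar> \<le> M * \<bar>x - y\<bar> + M' * \<bar>t - s\<bar>"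
proof -
  define J where "J z = Min ((\<lambda>n. k n (fst z) + M' * \<bar>snd z - n * tau\<bar>) ` {..N})" for z :: "real \<times> real"
  have time: "\<bar>k (n + m) x - k n x\<bar> \<le> M' * (m * tau)" if "n + m \<le> N" for n m x
    using that
  proof (induction m)
    case (Suc m)
    then show ?case using t[of "n + m" x] by (simp add: algebra_simps) 
  qed simp
  have time': "\<bar>k n x - k m x\<bar> \<le> M' * \<bar>n * tau - m * tau\<bar>" if "n \<le> N" "m \<le> N" for n m x
  proof (cases "n \<le> m")
    case True
    then have "\<bar>n * tau - m * tau\<bar> = (m - n) * tau" using \<open>0 < tau\<close> by (simp add: abs_if of_nat_diff algebra_simps)
    then show ?thesis using time[of n "m - n" x] True that by (simp add: abs_minus_commute)
  next
    case False
    then have "\<bar>n * tau - m * tau\<bar> = (n - m) * tau" using \<open>0 < tau\<close> by (simp add: abs_if of_nat_diff algebra_simps)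
    then show ?thesis using time[of m "n - m" x] False that by simp
  qed
  have le: "J (x, t) \<le> k n x + M' * \<bar>t - n * tau\<bar>" if "n \<le> N" for n x t
    unfolding J_def by (rule Min_le) (use that in auto)
  have ex: "\<exists>n\<le>N. J (x, t) = k n x + M' * \<bar>t - n * tau\<bar>" for x t
  proof -
    have "J (x, t) \<in> (\<lambda>n. k n (fst (x, t)) + M' * \<bar>snd (x, t) - n * tau\<bar>) ` {..N}" unfolding J_def by (rule Min_in) auto
    then show ?thesis by auto
  qed
  have J_le: "J (x, t) \<le> J (y, s) + (M * \<bar>x - y\<bar> + M' * \<bar>t - s\<bar>)" for x y t s
  proof -
    obtain n where n: "n \<le> N" "J (y, s) = k n y + M' * \<bar>s - n * tau\<bar>" using ex by blast
    have "M' * \<bar>t - n * tau\<bar> \<le> M' * (\<bar>t - s\<bar> + \<bar>s - n * tau\<bar>)" using \<open>0 \<le> M'\<close> by (intro mult_left_mono) auto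
    with le[OF n(1), of x t] x[OF n(1), of x y] n(2) show ?thesis by (simp add: distrib_left abs_le_iff)
  qed
  show ?thesis
  proof (rule that[of J])
    show "J (x, n * tau) = k n x" if "n \<le> N" for n x
    proof (rule antisym)
      show "J (x, n * tau) \<le> k n x" using le[OF that, of x "n * tau"] by simp
      obtain m where "m \<le> N" "J (x, n * tau) = k m x + M' * \<bar>n * tau - m * tau\<bar>" using ex by blast
      then show "k n x \<le> J (x, n * tau)" using time'[OF that, of m x] by (simp add: abs_le_iff)
    qed
    show "\<bar>J (x, t) - J (y, s)\<bar> \<le> M * \<bar>x - y\<bar> + M' * \<bar>t - s\<bar>" for x y t s
      using J_le[of x t y s] J_le[of y s x t] by (simp add: abs_le_iff abs_minus_commute)
  qed
qed

lemma Arzela_Ascoli_lipschitz: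
  fixes J :: "nat \<Rightarrow> real \<times> real \<Rightarrow> real"
  assumes lip: "\<And>n x y t s. x \<in> {0..1} \<Longrightarrow> y \<in> {0..1} \<Longrightarrow> t \<in> {0..T} \<Longrightarrow> s \<in> {0..T} \<Longrightarrow>
      \<bar>J n (x, t) - J n (y, s)\<bar> \<le> M * \<bar>x - y\<bar> + M' * \<bar>t - s\<bar>"
    and M: "0 \<le> M" "0 \<le> M'" and "0 \<le> T" and bd: "\<And>n. \<bar>J n (0, 0)\<bar> \<le> C"
  obtains kappa r where "continuous_on ({0..1} \<times> {0..T}) kappa" "strict_mono (r :: nat \<Rightarrow> nat)"
    "\<And>e. 0 < e \<Longrightarrow> \<forall>\<^sub>F n in sequentially. \<forall>z\<in>{0..1} \<times> {0..T}. \<bar>J (r n) z - kappa z\<bar> \<le> e"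
proof -
  let ?X = "{0..1::real} \<times> {0..T}"
  have lip': "\<bar>J n z - J n w\<bar> \<le> (M + M') * dist z w" if "z \<in> ?X" "w \<in> ?X" for n z w
  proof -
    have "\<bar>J n z - J n w\<bar> \<le> M * \<bar>fst z - fst w\<bar> + M' * \<bar>snd z - snd w\<bar>"
      using lip[of "fst z" "fst w" "snd z" "snd w" n] that by auto
    also have "\<dots> \<le> M * dist z w + M' * dist z w"
      using dist_fst_le[of z w] dist_snd_le[of z w] M by (intro add_mono mult_left_mono) (auto simp: dist_real_def)
    finally show ?thesis by (simp add: algebra_simps)
  qed
  obtain kappa r where kr: "continuous_on ?X kappa" "strict_mono (r :: nat \<Rightarrow> nat)"
    "\<And>e. 0 < e \<Longrightarrow> \<exists>N. \<forall>n x. n \<ge> N \<and> x \<in> ?X \<longrightarrow> norm (J (r n) x - kappa x) < e"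
  proof (rule Arzela_Ascoli[of ?X J "C + M + M' * T"])
    show "compact ?X" by (intro compact_Times compact_Icc)
    show "norm (J n z) \<le> C + M + M' * T" if "z \<in> ?X" for n z
    proof -
      have "\<bar>J n z - J n (0, 0)\<bar> \<le> M * \<bar>fst z - 0\<bar> + M' * \<bar>snd z - 0\<bar>"
        using lip[of "fst z" 0 "snd z" 0 n] that \<open>0 \<le> T\<close> by auto
      also have "\<dots> \<le> M * 1 + M' * T" using that M by (intro add_mono mult_left_mono) auto
      finally show ?thesis using bd[of n] by simp
    qed
    show "\<exists>d. 0 < d \<and> (\<forall>n w. w \<in> ?X \<and> norm (z - w) < d \<longrightarrow> norm (J n z - J n w) < e)" if "z \<in> ?X" "0 < e" for z e
    proof (intro exI[of _ "e / (M + M' + 1)"] conjI allI impI)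
      show "0 < e / (M + M' + 1)" using that M by simp
      fix n w assume w: "w \<in> ?X \<and> norm (z - w) < e / (M + M' + 1)"
      have "\<bar>J n z - J n w\<bar> \<le> (M + M') * dist z w" using lip' that w by blast
      also have "\<dots> \<le> (M + M' + 1) * dist z w" by (intro mult_right_mono) auto
      also have "\<dots> < e" using w M by (simp add: dist_norm pos_less_divide_eq mult.commute)
      finally show "norm (J n z - J n w) < e" by simp
    qed
  qed (use that in blast)
  show ?thesis
  proof (rule that[OF kr(1,2)])
    fix e :: real assume "0 < e"
    from kr(3)[OF this] obtain N where "\<forall>n x. n \<ge> N \<and> x \<in> ?X \<longrightarrow> norm (J (r n) x - kappa x) < e" by blast
    then show "\<forall>\<^sub>F n in sequentially. \<forall>z\<in>?X. \<bar>J (r n) z - kappa z\<bar> \<le> e"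
      by (intro eventually_sequentiallyI[of N]) (auto intro: less_imp_le)
  qed
qed

section \<open>Passing to the limit in the mesh, then in the steepening\<close>

context dislocation
begin

lemma scheme_limit_exists:
  assumes g: "0 < g" "g \<le> 1"
  obtains h tau N I kappa where "scheme_limit S B T k0 L0 g h tau N I kappa"
proof -
  obtain h0 where h0: "0 < h0" "\<And>h tau x t. 0 < h \<and> h \<le> h0 \<and> 2 * A * tau = g\<^sup>2 * h \<and> 0 \<le> t \<and> t + tau \<le> T \<Longrightarrow>
     W T g x (t + tau) \<le> lf_step h tau t (\<lambda>x. W T g x t) x"
    using W_discrete_subsolution[OF g T_pos] by blast
  \<comment> \<open>Dividing \<open>T\<close> exactly makes the last level coincide with the final
    time; \<open>hn\<close> is then dictated by the mesh condition.\<close>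
  define tn where "tn n = T / real (Suc n)" for n
  define hn where "hn n = 2 * A / g\<^sup>2 * tn n" for n
  have tn_pos: "0 < tn n" for n using T_pos by (simp add: tn_def)
  have hn_pos: "0 < hn n" for n using tn_pos A_ge_1 g by (simp add: hn_def)
  have tn_lim: "tn \<longlonglongrightarrow> 0" unfolding tn_def by (rule LIMSEQ_Suc[OF lim_const_over_n])
  have hn_lim: "hn \<longlonglongrightarrow> 0" using tendsto_mult[OF tendsto_const tn_lim, of "2 * A / g\<^sup>2"] by (simp add: hn_def[abs_def])
  \<comment> \<open>Below this threshold both smallness conditions on \<open>h\<close> hold: the one
    for the subsolution and B 2 h \<le> g.\<close>
  define d where "d = min h0 (g / (B 2 + 1))"
  have "0 < d" using h0 g B_nonneg[of 2] by (simp add: d_def)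
  then have "\<forall>\<^sub>F n in sequentially. hn n < d" using order_tendstoD(2)[OF hn_lim] by blast
  then obtain N0 where N0: "\<And>n. n \<ge> N0 \<Longrightarrow> hn n < d" by (auto simp: eventually_sequentially)
  have sch: "scheme S B T k0 L0 g (hn (n + N0)) (tn (n + N0))" for n
  proof unfold_locales
    have hd: "hn (n + N0) < d" by (rule N0) simp
    show "0 < g" "g \<le> 1" "0 < hn (n + N0)" "0 < tn (n + N0)" using g hn_pos tn_pos by auto
    show c: "2 * A * tn (n + N0) = g\<^sup>2 * hn (n + N0)" using g by (simp add: hn_def)
    show "B 2 * hn (n + N0) \<le> g"
    proof -
      have "B 2 * hn (n + N0) \<le> (B 2 + 1) * hn (n + N0)" using hn_pos[of "n + N0"] by (intro mult_right_mono) auto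
      also have "\<dots> \<le> (B 2 + 1) * (g / (B 2 + 1))" using hd B_nonneg[of 2] by (intro mult_left_mono) (auto simp: d_def)
      also have "\<dots> = g" using B_nonneg[of 2] by simp
      finally show ?thesis .
    qed
    show "W T g x (t + tn (n + N0)) \<le> lf_step (hn (n + N0)) (tn (n + N0)) t (\<lambda>x. W T g x t) x"
      if "0 \<le> t" "t + tn (n + N0) \<le> T" for x t
      by (rule h0(2)) (use hd hn_pos c that in \<open>auto simp: d_def\<close>)
  qed
  define M where "M = Lcrude g"
  define M' where "M' = Lcrude g * (2 * A / g\<^sup>2) + B 2"
  have M: "0 \<le> M" "0 \<le> M'" using Lcrude_nonneg[OF g(1)] A_ge_1 B_nonneg[of 2] by (auto simp: M_def M'_def)
  have NT: "real (Suc (n + N0)) * tn (n + N0) = T" for n by (simp add: tn_def)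
  have "\<exists>J. (\<forall>k x. k \<le> Suc (n + N0) \<longrightarrow> J (x, k * tn (n + N0)) = kap g (hn (n + N0)) (tn (n + N0)) k x)
      \<and> (\<forall>x y t s. \<bar>J (x, t) - J (y, s)\<bar> \<le> M * \<bar>x - y\<bar> + M' * \<bar>t - s\<bar>)" for n
  proof -
    have kT: "real k * tn (n + N0) \<le> T" if "k \<le> Suc (n + N0)" for k
    proof -
      have "real k * tn (n + N0) \<le> real (Suc (n + N0)) * tn (n + N0)"
        using that tn_pos[of "n + N0"] by (intro mult_right_mono) auto
      then show ?thesis by (simp only: NT)
    qed
    show ?thesis
    proof (rule time_interpolation[of M' "Suc (n + N0)" "kap g (hn (n + N0)) (tn (n + N0))" M "tn (n + N0)"])
      show "\<bar>kap g (hn (n + N0)) (tn (n + N0)) k x - kap g (hn (n + N0)) (tn (n + N0)) k y\<bar> \<le> M * \<bar>x - y\<bar>"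
        if "k \<le> Suc (n + N0)" for k x y unfolding M_def by (rule scheme.K_lip[OF sch kT[OF that]])
      show "\<bar>kap g (hn (n + N0)) (tn (n + N0)) (Suc k) x - kap g (hn (n + N0)) (tn (n + N0)) k x\<bar> \<le> M' * tn (n + N0)"
        if "k < Suc (n + N0)" for k x unfolding M'_def by (rule scheme.K_time_step[OF sch kT]) (use that in simp)
    qed (use M tn_pos in blast)+
  qed
  then obtain J where J: "\<And>n k x. k \<le> Suc (n + N0) \<Longrightarrow> J n (x, k * tn (n + N0)) = kap g (hn (n + N0)) (tn (n + N0)) k x"
    "\<And>n x y t s. \<bar>J n (x, t) - J n (y, s)\<bar> \<le> M * \<bar>x - y\<bar> + M' * \<bar>t - s\<bar>" by metis
  have J0: "\<bar>J n (0, 0)\<bar> \<le> \<bar>k0 0\<bar>" for n using J(1)[of 0 n 0] by simp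
  obtain kappa r where kr: "continuous_on ({0..1} \<times> {0..T}) kappa" "strict_mono (r :: nat \<Rightarrow> nat)"
    "\<And>e. 0 < e \<Longrightarrow> \<forall>\<^sub>F n in sequentially. \<forall>z\<in>{0..1} \<times> {0..T}. \<bar>J (r n) z - kappa z\<bar> \<le> e"
    by (rule Arzela_Ascoli_lipschitz[of T J M M', OF J(2) M _ J0]) (use T_pos in auto)
  have sub: "filterlim (\<lambda>n. r n + N0) sequentially sequentially"
    using filterlim_subseq[OF kr(2)] by (intro filterlim_at_top_mono[OF filterlim_subseq[OF kr(2)]]) auto
  have "scheme_limit S B T k0 L0 g (\<lambda>n. hn (r n + N0)) (\<lambda>n. tn (r n + N0)) (\<lambda>n. Suc (r n + N0)) (\<lambda>n. J (r n)) kappa"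
  proof (intro scheme_limit.intro scheme_limit_axioms.intro dislocation_axioms)
    show "(\<lambda>n. tn (r n + N0)) \<longlonglongrightarrow> 0" by (rule filterlim_compose[OF tn_lim sub])
    show "(\<lambda>n. hn (r n + N0)) \<longlonglongrightarrow> 0" by (rule filterlim_compose[OF hn_lim sub])
    show "continuous_on UNIV (J (r n))" for n
    proof (rule lipschitz_on_continuous_on)
      show "(M + M')-lipschitz_on UNIV (J (r n))"
      proof (rule lipschitz_onI)
        fix z w :: "real \<times> real"
        have "\<bar>J (r n) z - J (r n) w\<bar> \<le> M * \<bar>fst z - fst w\<bar> + M' * \<bar>snd z - snd w\<bar>"
          using J(2)[of "r n" "fst z" "snd z" "fst w" "snd w"] by simp
        also have "\<dots> \<le> M * dist z w + M' * dist z w"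
          using dist_fst_le[of z w] dist_snd_le[of z w] M by (intro add_mono mult_left_mono) (auto simp: dist_real_def)
        finally show "dist (J (r n) z) (J (r n) w) \<le> (M + M') * dist z w" by (simp add: dist_real_def algebra_simps)
      qed (use M in simp)
    qed
  qed (use kr J(1) sch NT in \<open>simp_all del: of_nat_Suc\<close>)
  then show ?thesis by (rule that)
qed

text \<open>A second compactness argument, now with the constants \<open>Lmax\<close> and
  \<open>B 2\<close>, which do not involve \<open>g\<close>. The excess g (2 + T) x in the datum,
  and so in the value at x = 1, disappears in the limit.\<close>

theorem dislocation_solution:
  obtains kappa where
    "\<And>x y t. x \<in> {0..1} \<Longrightarrow> y \<in> {0..1} \<Longrightarrow> x \<le> y \<Longrightarrow> t \<in> {0..T} \<Longrightarrow>
      \<bar>S 0 y t - S 0 x t\<bar> \<le> kappa (y, t) - kappa (x, t) \<and> kappa (y, t) - kappa (x, t) \<le> Lmax * (y - x)"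
    "\<And>x t t'. x \<in> {0..1} \<Longrightarrow> t \<in> {0..T} \<Longrightarrow> t' \<in> {0..T} \<Longrightarrow> \<bar>kappa (x, t) - kappa (x, t')\<bar> \<le> B 2 * \<bar>t - t'\<bar>"
    "\<And>x. x \<in> {0..1} \<Longrightarrow> kappa (x, 0) = k0 x"
    "\<And>t. t \<in> {0..T} \<Longrightarrow> kappa (0, t) = k0 0" "\<And>t. t \<in> {0..T} \<Longrightarrow> kappa (1, t) = k0 1"
    "visc_solution ({0<..<1} \<times> {0<..<T}) (\<lambda>z p1 p2. p2 * p1 - G (fst z) (snd z)) kappa"
proof -
  define g where "g n = 1 / real (Suc n)" for n
  have g: "0 < g n" "g n \<le> 1" for n by (auto simp: g_def)
  have g_lim: "g \<longlonglongrightarrow> 0" unfolding g_def by (rule LIMSEQ_Suc[OF lim_const_over_n])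
  have "\<exists>kappa h tau N I. scheme_limit S B T k0 L0 (g n) h tau N I kappa" for n
    by (rule scheme_limit_exists[OF g[of n]]) blast
  then obtain K where K: "\<And>n. \<exists>h tau N I. scheme_limit S B T k0 L0 (g n) h tau N I (K n)" by metis
  have inc: "K n (y, t) - K n (x, t) \<le> Lmax * (y - x)" "\<bar>S 0 y t - S 0 x t\<bar> \<le> K n (y, t) - K n (x, t)"
    if "x \<in> {0..1}" "y \<in> {0..1}" "x \<le> y" "t \<in> {0..T}" for n x y t
  proof -
    obtain h tau N I where "scheme_limit S B T k0 L0 (g n) h tau N I (K n)" using K by blast
    then interpret scheme_limit S B T k0 L0 "g n" h tau N I "K n" .
    show "K n (y, t) - K n (x, t) \<le> Lmax * (y - x)" by (rule kappa_increment(1)[OF that])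
    show "\<bar>S 0 y t - S 0 x t\<bar> \<le> K n (y, t) - K n (x, t)"
      using kappa_increment(3)[OF that, of 1] kappa_increment(3)[OF that, of "-1"] by (simp add: abs_le_iff)
  qed
  have time: "\<bar>K n (x, t) - K n (x, t')\<bar> \<le> B 2 * \<bar>t - t'\<bar>" if "x \<in> {0..1}" "t \<in> {0..T}" "t' \<in> {0..T}" for n x t t'
  proof -
    obtain h tau N I where "scheme_limit S B T k0 L0 (g n) h tau N I (K n)" using K by blast
    then interpret scheme_limit S B T k0 L0 "g n" h tau N I "K n" .
    show ?thesis using kappa_time_increment[of x t t'] kappa_time_increment[of x t' t] that
      by (cases "t \<le> t'") (simp_all add: abs_minus_commute)
  qed
  have bdry: "(x \<in> {0..1} \<longrightarrow> K n (x, 0) = k0 x + g n * (2 + T) * x) \<and>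
      (t \<in> {0..T} \<longrightarrow> K n (0, t) = k0 0 \<and> K n (1, t) = k0 1 + g n * (2 + T))" for n x t
  proof -
    obtain h tau N I where "scheme_limit S B T k0 L0 (g n) h tau N I (K n)" using K by blast
    then interpret scheme_limit S B T k0 L0 "g n" h tau N I "K n" .
    show ?thesis using kappa_initial kappa_lateral by blast
  qed
  have visc: "visc_solution ({0<..<1} \<times> {0<..<T}) (\<lambda>z p1 p2. p2 * p1 - G (fst z) (snd z)) (K n)" for n
    using K[of n] scheme_limit.kappa_viscosity by blast
  have lip: "\<bar>K n (x, t) - K n (y, s)\<bar> \<le> Lmax * \<bar>x - y\<bar> + B 2 * \<bar>t - s\<bar>"
    if "x \<in> {0..1}" "y \<in> {0..1}" "t \<in> {0..T}" "s \<in> {0..T}" for n x y t s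
  proof -
    have "\<bar>K n (x, t) - K n (y, t)\<bar> \<le> Lmax * \<bar>x - y\<bar>"
    proof (cases "x \<le> y")
      case True
      then show ?thesis using inc[OF that(1,2) _ that(3), of n] abs_ge_zero[of "S 0 y t - S 0 x t"] by (simp add: abs_le_iff)
    next
      case False
      then show ?thesis using inc[OF that(2,1) _ that(3), of n] abs_ge_zero[of "S 0 x t - S 0 y t"] by (simp add: abs_le_iff)
    qed
    then show ?thesis using time[OF that(2-4), of n] by linarith
  qed
  have K0: "\<bar>K n (0, 0)\<bar> \<le> \<bar>k0 0\<bar>" for n using bdry[where n = n and x = 0] by simp
  obtain kappa r where kr: "continuous_on ({0..1} \<times> {0..T}) kappa" "strict_mono (r :: nat \<Rightarrow> nat)"
    "\<And>e. 0 < e \<Longrightarrow> \<forall>\<^sub>F n in sequentially. \<forall>z\<in>{0..1} \<times> {0..T}. \<bar>K (r n) z - kappa z\<bar> \<le> e"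
    by (rule Arzela_Ascoli_lipschitz[of T K Lmax "B 2", OF lip Lmax_nonneg B_nonneg _ K0]) (use T_pos in auto)
  have pt: "(\<lambda>n. K (r n) z) \<longlonglongrightarrow> kappa z" if "z \<in> {0..1} \<times> {0..T}" for z
  proof (rule tendstoI)
    fix e :: real assume "0 < e"
    then have "0 < e / 2" by simp
    from kr(3)[OF this] show "\<forall>\<^sub>F n in sequentially. dist (K (r n) z) (kappa z) < e"
    proof eventually_elim
      case (elim n)
      then have "\<bar>K (r n) z - kappa z\<bar> \<le> e / 2" using that by blast
      then show ?case using \<open>0 < e\<close> by (simp add: dist_real_def)
    qed
  qed
  have gr: "(\<lambda>n. g (r n)) \<longlonglongrightarrow> 0" using LIMSEQ_subseq_LIMSEQ[OF g_lim kr(2)] by (simp add: o_def)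
  show ?thesis
  proof (rule that[of kappa])
    fix x y t :: real assume xy: "x \<in> {0..1}" "y \<in> {0..1}" "x \<le> y" and t: "t \<in> {0..T}"
    have d: "(\<lambda>n. K (r n) (y, t) - K (r n) (x, t)) \<longlonglongrightarrow> kappa (y, t) - kappa (x, t)"
      using xy t by (intro tendsto_intros pt) auto
    show "\<bar>S 0 y t - S 0 x t\<bar> \<le> kappa (y, t) - kappa (x, t) \<and> kappa (y, t) - kappa (x, t) \<le> Lmax * (y - x)"
      using LIMSEQ_le_const[OF d] LIMSEQ_le_const2[OF d] inc[OF xy t] by blast
  next
    fix x t t' :: real assume x: "x \<in> {0..1}" and t: "t \<in> {0..T}" "t' \<in> {0..T}"
    have "(\<lambda>n. \<bar>K (r n) (x, t) - K (r n) (x, t')\<bar>) \<longlonglongrightarrow> \<bar>kappa (x, t) - kappa (x, t')\<bar>"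
      using x t by (intro tendsto_intros pt) auto
    from LIMSEQ_le_const2[OF this] show "\<bar>kappa (x, t) - kappa (x, t')\<bar> \<le> B 2 * \<bar>t - t'\<bar>" using time[OF x t] by blast
  next
    fix x :: real assume x: "x \<in> {0..1}"
    have "(\<lambda>n. K (r n) (x, 0)) \<longlonglongrightarrow> kappa (x, 0)" using x T_pos by (intro pt) auto
    moreover have "(\<lambda>n. K (r n) (x, 0)) = (\<lambda>n. k0 x + g (r n) * (2 + T) * x)" using x bdry by auto
    moreover have "(\<lambda>n. k0 x + g (r n) * (2 + T) * x) \<longlonglongrightarrow> k0 x + 0 * (2 + T) * x"
      by (intro tendsto_intros gr)
    ultimately show "kappa (x, 0) = k0 x" using LIMSEQ_unique by fastforce
  next
    fix t :: real assume t: "t \<in> {0..T}"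
    have "(\<lambda>n. K (r n) (0, t)) \<longlonglongrightarrow> kappa (0, t)" using t by (intro pt) auto
    moreover have "(\<lambda>n. K (r n) (0, t)) = (\<lambda>n. k0 0)" using t bdry by auto
    ultimately show "kappa (0, t) = k0 0" using LIMSEQ_unique[OF _ tendsto_const] by metis
    have "(\<lambda>n. K (r n) (1, t)) \<longlonglongrightarrow> kappa (1, t)" using t by (intro pt) auto
    moreover have "(\<lambda>n. K (r n) (1, t)) = (\<lambda>n. k0 1 + g (r n) * (2 + T))" using t bdry by auto
    moreover have "(\<lambda>n. k0 1 + g (r n) * (2 + T)) \<longlonglongrightarrow> k0 1 + 0 * (2 + T)" by (intro tendsto_intros gr)
    ultimately show "kappa (1, t) = k0 1" using LIMSEQ_unique by fastforce
  next
    show "visc_solution ({0<..<1} \<times> {0<..<T}) (\<lambda>z p1 p2. p2 * p1 - G (fst z) (snd z)) kappa"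
    proof (rule visc_solution_uniform_limit[OF _ _ visc])
      show "open ({0<..<1::real} \<times> {0<..<T})" by (intro open_Times) auto
      show "continuous_on ({0<..<1} \<times> {0<..<T}) (\<lambda>z. G (fst z) (snd z))"
        by (rule continuous_on_subset[OF G_continuous]) auto
      show "\<forall>\<^sub>F n in sequentially. \<forall>z\<in>{0<..<1} \<times> {0<..<T}. \<bar>K (r n) z - kappa z\<bar> \<le> e" if "0 < e" for e
        using kr(3)[OF that] by (rule eventually_mono) auto
      show "continuous_on ({0<..<1} \<times> {0<..<T}) kappa" by (rule continuous_on_subset[OF kr(1)]) auto
    qed
  qed
qed

end

section \<open>Reflection of the data and the theorem\<close>

text \<open>Lets the Lipschitz and monotonicity estimates for the extended datum be checked within
  one unit cell.\<close>

lemma interval_chaining: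
  fixes R :: "real \<Rightarrow> real \<Rightarrow> bool"
  assumes unit: "\<And>m x y. of_int m \<le> x \<Longrightarrow> x \<le> y \<Longrightarrow> y \<le> of_int m + 1 \<Longrightarrow> R x y"
    and trans: "\<And>x y z. x \<le> y \<Longrightarrow> y \<le> z \<Longrightarrow> R x y \<Longrightarrow> R y z \<Longrightarrow> R x z"
    and "x \<le> y"
  shows "R x y"
proof -
  have "R x y" if "x \<le> y" "nat (\<lfloor>y\<rfloor> - \<lfloor>x\<rfloor>) = n" for n x y
    using that
  proof (induction n arbitrary: x y)
    case 0
    then have "\<lfloor>y\<rfloor> = \<lfloor>x\<rfloor>" using floor_mono[OF 0(1)] by simp
    then show ?case using 0 by (intro unit[of "\<lfloor>x\<rfloor>"]) linarith+
  next
    case (Suc n)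
    define z where "z = real_of_int \<lfloor>x\<rfloor> + 1"
    have fz: "\<lfloor>z\<rfloor> = \<lfloor>x\<rfloor> + 1" by (simp add: z_def)
    have "\<lfloor>x\<rfloor> + 1 \<le> \<lfloor>y\<rfloor>" using Suc.prems by linarith
    then have zy: "z \<le> y" unfolding z_def by linarith
    have xz: "x \<le> z" unfolding z_def by linarith
    have "R x z" by (rule unit[of "\<lfloor>x\<rfloor>"]) (use xz in \<open>auto simp: z_def\<close>)
    moreover have "R z y" by (rule Suc.IH[OF zy]) (use Suc.prems fz in simp)
    ultimately show ?case by (rule trans[OF xz zy])
  qed
  with \<open>x \<le> y\<close> show ?thesis by blast
qed

text \<open>Extension from \<open>{0..1}\<close> to the line by point reflections in the end points of the graph.\<close>
definition reflect_ext :: "(real \<Rightarrow> real) \<Rightarrow> real \<Rightarrow> real" where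
  "reflect_ext f x = f 0 + of_int \<lfloor>x\<rfloor> * (f 1 - f 0) +
     (if even \<lfloor>x\<rfloor> then f (x - of_int \<lfloor>x\<rfloor>) - f 0 else f 1 - f (of_int \<lfloor>x\<rfloor> + 1 - x))"

text \<open>The formula of a cell remains valid at its right end, where the floor has already
  jumped; closed cells can thus be chained.\<close>

lemma reflect_ext_on_cell:
  assumes "of_int m \<le> x" "x \<le> of_int m + 1"
  shows "reflect_ext f x = f 0 + of_int m * (f 1 - f 0) + (if even m then f (x - of_int m) - f 0 else f 1 - f (of_int m + 1 - x))"
proof (cases "x = of_int m + 1")
  case True
  then have "\<lfloor>x\<rfloor> = m + 1" by simp
  then show ?thesis using True by (simp add: reflect_ext_def algebra_simps)
next
  case False
  then have "\<lfloor>x\<rfloor> = m" using assms by (intro floor_unique) auto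
  then show ?thesis by (simp add: reflect_ext_def)
qed

lemma reflect_ext_eq: "x \<in> {0..1} \<Longrightarrow> reflect_ext f x = f x"
  using reflect_ext_on_cell[of 0 x f] by simp

lemma reflect_ext_reflect:
  "reflect_ext f (- x) = 2 * f 0 - reflect_ext f x" "reflect_ext f (2 - x) = 2 * f 1 - reflect_ext f x"
proof -
  define m where "m = \<lfloor>x\<rfloor>"
  have m: "of_int m \<le> x" "x \<le> of_int m + 1" unfolding m_def by linarith+
  show *: "reflect_ext f (- x) = 2 * f 0 - reflect_ext f x"
    using reflect_ext_on_cell[OF m, of f] reflect_ext_on_cell[of "- m - 1" "- x" f] m
    by (cases "even m") (simp_all add: algebra_simps)
  have "reflect_ext f (- x + 2) = reflect_ext f (- x) + 2 * (f 1 - f 0)"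
  proof -
    have "\<lfloor>- x + 2\<rfloor> = \<lfloor>- x\<rfloor> + 2" using floor_add_int[of "- x" 2] by simp
    then show ?thesis by (simp add: reflect_ext_def algebra_simps)
  qed
  then show "reflect_ext f (2 - x) = 2 * f 1 - reflect_ext f x" by (simp add: * algebra_simps)
qed

lemma (in heat_family) S_period_int: "S j (x + 2 * of_int m) t = S j x t"
proof -
  have nat: "S j (x + 2 * real n) t = S j x t" for n x
  proof (induction n)
    case (Suc n)
    then show ?case using S_period[of j "x + 2 * real n" t] by (simp add: algebra_simps)
  qed simp
  show ?thesis
  proof (cases "m \<ge> 0")
    case True
    then show ?thesis using nat[of x "nat m"] by simp
  next
    case False
    then show ?thesis using nat[of "x + 2 * of_int m" "nat (- m)"] by simp
  qed
qed

lemma (in heat_family) dislocation_of_data: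
  fixes f :: "real \<Rightarrow> real"
  assumes "0 < T"
    and lip: "\<And>x y. x \<in> {0..1} \<Longrightarrow> y \<in> {0..1} \<Longrightarrow> \<bar>f x - f y\<bar> \<le> L0 * \<bar>x - y\<bar>"
    and mono: "\<And>x y. x \<in> {0..1} \<Longrightarrow> y \<in> {0..1} \<Longrightarrow> x \<le> y \<Longrightarrow> \<bar>S 0 y 0 - S 0 x 0\<bar> \<le> f y - f x"
  shows "dislocation S B T (reflect_ext f) L0"
proof unfold_locales
  let ?k = "reflect_ext f"
  show "0 < T" by fact
  show "?k (- x) = 2 * ?k 0 - ?k x" "?k (2 - x) = 2 * ?k 1 - ?k x" for x
    by (simp_all add: reflect_ext_reflect reflect_ext_eq)
  have lip_le: "\<bar>?k x - ?k y\<bar> \<le> L0 * (y - x)" if "x \<le> y" for x y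
  proof (rule interval_chaining[OF _ _ that])
    show "\<bar>?k x - ?k y\<bar> \<le> L0 * (y - x)" if m: "of_int m \<le> x" "x \<le> y" "y \<le> of_int m + 1" for m x y
    proof (cases "even m")
      case True
      then show ?thesis
        using reflect_ext_on_cell[of m x f] reflect_ext_on_cell[of m y f] m
          lip[of "x - of_int m" "y - of_int m"] by simp
    next
      case False
      then show ?thesis
        using reflect_ext_on_cell[of m x f] reflect_ext_on_cell[of m y f] m
          lip[of "of_int m + 1 - y" "of_int m + 1 - x"] by simp
    qed
    show "\<bar>?k x - ?k z\<bar> \<le> L0 * (z - x)"
      if "\<bar>?k x - ?k y\<bar> \<le> L0 * (y - x)" "\<bar>?k y - ?k z\<bar> \<le> L0 * (z - y)" for x y z
      using that by (simp add: algebra_simps abs_le_iff)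
  qed
  show "\<bar>?k x - ?k y\<bar> \<le> L0 * \<bar>x - y\<bar>" for x y
    using lip_le[of x y] lip_le[of y x] by (cases "x \<le> y") (auto simp: abs_minus_commute)
  show "\<bar>S 0 y 0 - S 0 x 0\<bar> \<le> ?k y - ?k x" if "x \<le> y" for x y
  proof (rule interval_chaining[OF _ _ that])
    show "\<bar>S 0 y 0 - S 0 x 0\<bar> \<le> ?k y - ?k x" if m: "of_int m \<le> x" "x \<le> y" "y \<le> of_int m + 1" for m x y
    proof (cases "even m")
      case True
      then obtain l where l: "m = 2 * l" by blast
      have "S 0 v 0 = S 0 (v - of_int m) 0" for v using S_period_int[of 0 "v - of_int m" l 0] by (simp add: l)
      from this[of x] this[of y] show ?thesis
        using reflect_ext_on_cell[of m x f] reflect_ext_on_cell[of m y f] m True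
          mono[of "x - of_int m" "y - of_int m"] by simp
    next
      case False
      then obtain l where l: "m = 2 * l + 1" by (rule oddE)
      \<comment> \<open>In odd cells the extension runs through the datum backwards; oddness and
        periodicity turn \<open>S 0\<close> around in the same way, so the estimate reduces to the
        unit interval with exchanged end points.\<close>
      have "S 0 v 0 = - S 0 (of_int m + 1 - v) 0" for v
        using S_period_int[of 0 "v - of_int m - 1" "l + 1" 0] S_minus[of 0 0 "v - of_int m - 1"] by (simp add: l algebra_simps)
      from this[of x] this[of y] show ?thesis
        using reflect_ext_on_cell[of m x f] reflect_ext_on_cell[of m y f] m False
          mono[of "of_int m + 1 - y" "of_int m + 1 - x"] by (simp add: abs_minus_commute)
    qed
    show "\<bar>S 0 z 0 - S 0 x 0\<bar> \<le> ?k z - ?k x"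
      if "\<bar>S 0 y 0 - S 0 x 0\<bar> \<le> ?k y - ?k x" "\<bar>S 0 z 0 - S 0 y 0\<bar> \<le> ?k z - ?k y" for x y z
      using that by (simp add: abs_le_iff)
  qed
qed

lemma deriv_nonneg_of_increasing:
  fixes f :: "real \<Rightarrow> real"
  assumes d: "(f has_real_derivative D) (at x)" and "0 < r"
    and inc: "\<And>y. x < y \<Longrightarrow> y < x + r \<Longrightarrow> f x \<le> f y"
  shows "0 \<le> D"
proof (rule ccontr)
  assume "\<not> 0 \<le> D"
  then obtain d where d: "0 < d" "\<And>h. 0 < h \<Longrightarrow> h < d \<Longrightarrow> f (x + h) < f x"
    using DERIV_neg_dec_right[OF d] by auto
  define h where "h = min (d / 2) (r / 2)"
  have "0 < h" "h < d" "h < r" using d \<open>0 < r\<close> by (auto simp: h_def)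
  then show False using d(2)[of h] inc[of "x + h"] by auto
qed

lemma
  fixes c :: real
  shows AE_lborel_fst_neq: "AE z in lborel. fst (z :: real \<times> real) \<noteq> c"
    and AE_lborel_snd_neq: "AE z in lborel. snd (z :: real \<times> real) \<noteq> c"
proof -
  have "{c} \<times> (UNIV :: real set) \<in> null_sets (lborel \<Otimes>\<^sub>M lborel)" "(UNIV :: real set) \<times> {c} \<in> null_sets (lborel \<Otimes>\<^sub>M lborel)"
    by (auto simp: null_sets_def lborel.emeasure_pair_measure_Times)
  then have N: "{c} \<times> (UNIV :: real set) \<in> null_sets lborel" "(UNIV :: real set) \<times> {c} \<in> null_sets lborel"
    by (simp_all only: lborel_prod)
  show "AE z in lborel. fst (z :: real \<times> real) \<noteq> c" by (rule AE_I'[OF N(1)]) auto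
  show "AE z in lborel. snd (z :: real \<times> real) \<noteq> c" by (rule AE_I'[OF N(2)]) auto
qed

theorem theorem5p2:
  fixes T :: real and kappa0 rho0 :: "real \<Rightarrow> real" and rho :: "real \<times> real \<Rightarrow> real"
  assumes "T > 0"
    and "\<exists>L. L-lipschitz_on {0..1} kappa0"
    and "C0_infty_I rho0"
    and "AE x in lborel. x \<in> {0<..<1} \<longrightarrow>
           (\<exists>D. (kappa0 has_real_derivative D) (at x) \<and> D \<ge> \<bar>deriv rho0 x\<bar>)"
    and "heat_solution rho0 rho"
  shows "\<exists>kappa :: real \<times> real \<Rightarrow> real.
           (\<exists>L. L-lipschitz_on ({0..1} \<times> {0..T}) kappa)
         \<and> visc_solution ({0<..<1} \<times> {0<..<T})
             (\<lambda>z p1 p2. p2 * p1 - pdt rho z * pdx rho z) kappa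
         \<and> (\<forall>x\<in>{0<..<1}. kappa (x, 0) = kappa0 x)
         \<and> (\<forall>t\<in>{0..T}. kappa (0, t) = kappa0 0 \<and> kappa (1, t) = kappa0 1)
         \<and> (AE z in lborel. z \<in> {0..1} \<times> {0..T} \<longrightarrow>
              (\<exists>D. ((\<lambda>y. kappa (y, snd z)) has_real_derivative D) (at (fst z))
                   \<and> D \<ge> \<bar>pdx rho z\<bar>))"
proof -
  obtain L0 where L0: "L0-lipschitz_on {0..1} kappa0" using assms(2) by blast
  obtain S B where hf: "heat_family S B" and S_init: "\<And>x. x \<in> {0..1} \<Longrightarrow> S 0 x 0 = rho0 x"
    using heat_family_exists[OF assms(3)] by blast
  interpret heat_family S B by (rule hf)
  have rho0_deriv: "(rho0 has_real_derivative deriv rho0 x) (at x)" for x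
    using smooth_real_has_deriv[of rho0 0 x] assms(3) by (simp add: C0_infty_I_def)
  have rho0_lip: "(B 1)-lipschitz_on {0..1} rho0"
  proof (rule lipschitz_onI)
    fix x y :: real assume "x \<in> {0..1}" "y \<in> {0..1}"
    then show "dist (rho0 x) (rho0 y) \<le> B 1 * dist x y"
      using S_lipschitz[of 0 0 0 x y] by (simp add: dist_real_def S_init)
  qed (rule B_nonneg)
  have mono: "\<bar>S 0 y 0 - S 0 x 0\<bar> \<le> kappa0 y - kappa0 x" if xy: "x \<in> {0..1}" "y \<in> {0..1}" "x \<le> y" for x y
  proof -
    have sub: "{x..y} \<subseteq> {0..1}" using xy by auto
    \<comment> \<open>Both signs together give the bound by the absolute increment of
      \<open>rho0\<close>.\<close>
    have "kappa0 x + s * rho0 x \<le> kappa0 y + s * rho0 y" if s: "s \<in> {1, -1}" for s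
    proof (rule mono_of_AE_deriv_nonneg[OF xy(3)])
      show "(L0 + B 1)-lipschitz_on {x..y} (\<lambda>x. kappa0 x + s * rho0 x)"
        using s lipschitz_on_add[OF lipschitz_on_subset[OF L0 sub] lipschitz_on_subset[OF rho0_lip sub]]
          lipschitz_on_diff[OF lipschitz_on_subset[OF L0 sub] lipschitz_on_subset[OF rho0_lip sub]] by auto
      show "AE v in lborel. v \<in> {x<..<y} \<longrightarrow>
          (\<exists>D. ((\<lambda>x. kappa0 x + s * rho0 x) has_real_derivative D) (at v) \<and> 0 \<le> D)"
        using assms(4)
      proof eventually_elim
        case (elim v)
        show ?case
        proof
          assume "v \<in> {x<..<y}"
          then have "v \<in> {0<..<1}" using xy by auto
          then obtain D where D: "(kappa0 has_real_derivative D) (at v)" "D \<ge> \<bar>deriv rho0 v\<bar>" using elim by blast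
          have "((\<lambda>x. kappa0 x + s * rho0 x) has_real_derivative D + s * deriv rho0 v) (at v)"
            by (auto intro!: derivative_eq_intros D rho0_deriv)
          moreover have "0 \<le> D + s * deriv rho0 v" using D(2) s by auto
          ultimately show "\<exists>D. ((\<lambda>x. kappa0 x + s * rho0 x) has_real_derivative D) (at v) \<and> 0 \<le> D" by blast
        qed
      qed
    qed
    from this[of 1] this[of "-1"] show ?thesis using xy by (simp add: S_init abs_le_iff)
  qed
  interpret dislocation S B T "reflect_ext kappa0" L0
    by (rule dislocation_of_data[OF assms(1) _ mono])
      (use lipschitz_onD[OF L0] in \<open>simp_all add: dist_real_def\<close>)
  obtain kappa where inc: "\<And>x y t. x \<in> {0..1} \<Longrightarrow> y \<in> {0..1} \<Longrightarrow> x \<le> y \<Longrightarrow> t \<in> {0..T} \<Longrightarrow>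
      \<bar>S 0 y t - S 0 x t\<bar> \<le> kappa (y, t) - kappa (x, t) \<and> kappa (y, t) - kappa (x, t) \<le> Lmax * (y - x)"
    and time: "\<And>x t t'. x \<in> {0..1} \<Longrightarrow> t \<in> {0..T} \<Longrightarrow> t' \<in> {0..T} \<Longrightarrow> \<bar>kappa (x, t) - kappa (x, t')\<bar> \<le> B 2 * \<bar>t - t'\<bar>"
    and init: "\<And>x. x \<in> {0..1} \<Longrightarrow> kappa (x, 0) = reflect_ext kappa0 x"
    and lateral: "\<And>t. t \<in> {0..T} \<Longrightarrow> kappa (0, t) = reflect_ext kappa0 0" "\<And>t. t \<in> {0..T} \<Longrightarrow> kappa (1, t) = reflect_ext kappa0 1"
    and visc: "visc_solution ({0<..<1} \<times> {0<..<T}) (\<lambda>z p1 p2. p2 * p1 - G (fst z) (snd z)) kappa"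
    by (rule dislocation_solution) blast
  have x_lip: "\<bar>kappa (x, t) - kappa (y, t)\<bar> \<le> Lmax * \<bar>x - y\<bar>" if "x \<in> {0..1}" "y \<in> {0..1}" "t \<in> {0..T}" for x y t
    using inc[OF that(1,2) _ that(3)] inc[OF that(2,1) _ that(3)] abs_ge_zero[of "S 0 y t - S 0 x t"]
      abs_ge_zero[of "S 0 x t - S 0 y t"] by (cases "x \<le> y") (auto simp: abs_le_iff)
  have lip: "(Lmax + B 2)-lipschitz_on ({0..1} \<times> {0..T}) kappa"
  proof (rule lipschitz_onI)
    fix z w :: "real \<times> real" assume zw: "z \<in> {0..1} \<times> {0..T}" "w \<in> {0..1} \<times> {0..T}"
    have "\<bar>kappa (fst z, snd z) - kappa (fst w, snd z)\<bar> \<le> Lmax * \<bar>fst z - fst w\<bar>" using zw by (intro x_lip) auto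
    moreover have "\<bar>kappa (fst w, snd z) - kappa (fst w, snd w)\<bar> \<le> B 2 * \<bar>snd z - snd w\<bar>" using zw by (intro time) auto
    moreover have "Lmax * \<bar>fst z - fst w\<bar> \<le> Lmax * dist z w" "B 2 * \<bar>snd z - snd w\<bar> \<le> B 2 * dist z w"
      using dist_fst_le[of z w] dist_snd_le[of z w] Lmax_nonneg B_nonneg[of 2]
      by (auto intro!: mult_left_mono simp: dist_real_def)
    ultimately have "\<bar>kappa (fst z, snd z) - kappa (fst w, snd w)\<bar> \<le> Lmax * dist z w + B 2 * dist z w" by linarith
    then show "dist (kappa z) (kappa w) \<le> (Lmax + B 2) * dist z w" by (simp add: dist_real_def distrib_right)
  qed (use Lmax_nonneg B_nonneg[of 2] in simp)
  have derivs: "pdx rho z = S 1 (fst z) (snd z)" "pdt rho z = S 2 (fst z) (snd z)"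
    if "0 < fst z" "fst z < 1" "0 < snd z" for z
    using heat_solution_derivatives[OF assms(5) S_init that] by simp_all
  have "visc_solution ({0<..<1} \<times> {0<..<T}) (\<lambda>z p1 p2. p2 * p1 - pdt rho z * pdx rho z) kappa"
  proof -
    have "G (fst z) (snd z) = pdt rho z * pdx rho z" if "z \<in> {0<..<1} \<times> {0<..<T}" for z
      using that derivs[of z] by (auto simp: G_def mult.commute)
    then show ?thesis using visc unfolding visc_solution_def visc_subsolution_def visc_supersolution_def by simp
  qed
  moreover have "AE z in lborel. z \<in> {0..1} \<times> {0..T} \<longrightarrow>
      (\<exists>D. ((\<lambda>y. kappa (y, snd z)) has_real_derivative D) (at (fst z)) \<and> D \<ge> \<bar>pdx rho z\<bar>)"
  proof -
    \<comment> \<open>Clamping both arguments extends \<open>kappa\<close> to the plane, as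
      differentiability almost everywhere is available for functions on the plane; monotonicity and
      Lipschitz bounds in \<open>x\<close> are preserved.\<close>
    define c where "c = (\<lambda>M v. max 0 (min M v) :: real)"
    have c: "c 1 x \<in> {0..1}" "c T t \<in> {0..T}" for x t using assms(1) by (auto simp: c_def)
    have c_mono: "x \<le> y \<Longrightarrow> c 1 x \<le> c 1 y" and c_lip: "\<bar>c 1 x - c 1 y\<bar> \<le> \<bar>x - y\<bar>" for x y by (auto simp: c_def)
    define K where "K z = kappa (c 1 (fst z), c T (snd z))" for z
    have "AE z in lborel. (\<lambda>y. K (y, snd z)) differentiable (at (fst z))"
    proof (rule AE_differentiable_of_mono_lipschitz_slices[where L = Lmax])
      show "continuous_on UNIV K"
        unfolding K_def
        by (rule continuous_on_compose2[OF lipschitz_on_continuous_on[OF lip]])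
          (use c in \<open>auto simp: c_def intro!: continuous_intros\<close>)
      show "Lmax-lipschitz_on UNIV (\<lambda>x. K (x, t))" for t
      proof (rule lipschitz_onI)
        fix x y :: real
        have "\<bar>K (x, t) - K (y, t)\<bar> \<le> Lmax * \<bar>c 1 x - c 1 y\<bar>" unfolding K_def fst_conv snd_conv by (rule x_lip[OF c(1) c(1) c(2)])
        also have "\<dots> \<le> Lmax * \<bar>x - y\<bar>" by (rule mult_left_mono[OF c_lip Lmax_nonneg])
        finally show "dist (K (x, t)) (K (y, t)) \<le> Lmax * dist x y" by (simp add: dist_real_def)
      qed (rule Lmax_nonneg)
      show "mono (\<lambda>x. K (x, t))" for t
      proof (rule monoI)
        fix x y :: real assume "x \<le> y"
        show "K (x, t) \<le> K (y, t)"
          using inc[OF c(1)[of x] c(1)[of y] c_mono[OF \<open>x \<le> y\<close>] c(2)[of t]] abs_ge_zero[of "S 0 (c 1 y) (c T t) - S 0 (c 1 x) (c T t)"]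
          unfolding K_def fst_conv snd_conv by linarith
      qed
    qed
    \<comment> \<open>Three boundary lines are discarded as null sets: at x = 0 and x = 1 a
      two-sided derivative would involve values outside the rectangle, and \<open>pdx rho\<close> is
      identified only for positive times. The line t = T may stay.\<close>
    with AE_lborel_fst_neq[of 0] AE_lborel_fst_neq[of 1] AE_lborel_snd_neq[of 0]
    show ?thesis
    proof eventually_elim
      case (elim z)
      define x t where "x = fst z" and "t = snd z"
      show ?case
      proof
        assume "z \<in> {0..1} \<times> {0..T}"
        then have x: "0 < x" "x < 1" and t: "0 < t" "t \<le> T" using elim by (auto simp: x_def t_def less_le)
        obtain D where "((\<lambda>y. K (y, t)) has_real_derivative D) (at x)"
          using elim(4) unfolding x_def t_def by (auto simp: real_differentiable_def)
        then have D: "((\<lambda>y. kappa (y, t)) has_real_derivative D) (at x)"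
          by (rule has_field_derivative_transform_within_open[of _ _ _ "{0<..<1}"])
            (use x t in \<open>auto simp: K_def c_def\<close>)
        \<comment> \<open>In the limit the lower slope bound is the statement that
          \<open>kappa\<close> plus or minus \<open>S 0\<close> is nondecreasing in
          \<open>x\<close>, which becomes a derivative inequality wherever \<open>D\<close>
          exists.\<close>
        have "0 \<le> D + s * S 1 x t" if s: "s \<in> {1, -1}" for s
        proof (rule deriv_nonneg_of_increasing)
          show "((\<lambda>y. kappa (y, t) + s * S 0 y t) has_real_derivative D + s * S 1 x t) (at x)"
            using S_dx[of t 0 x] t by (auto intro!: derivative_eq_intros D)
          show "0 < 1 - x" using x by simp
          show "kappa (x, t) + s * S 0 x t \<le> kappa (y, t) + s * S 0 y t" if "x < y" "y < x + (1 - x)" for y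
            using inc[of x y t] that x t s by (auto simp: abs_le_iff)
        qed
        from this[of 1] this[of "-1"] have "\<bar>S 1 x t\<bar> \<le> D" by (simp add: abs_le_iff)
        then have "\<bar>pdx rho z\<bar> \<le> D" using derivs(1)[of z] x t by (simp add: x_def t_def)
        then show "\<exists>D. ((\<lambda>y. kappa (y, snd z)) has_real_derivative D) (at (fst z)) \<and> D \<ge> \<bar>pdx rho z\<bar>"
          using D unfolding x_def t_def by blast
      qed
    qed
  qed
  ultimately show ?thesis
    using lip init lateral by (intro exI[of _ kappa]) (auto simp: reflect_ext_eq)
qed

end
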